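(* Let $a,b>0$ be constants with $a+b<\tfrac12$. There exists $\varepsilon_0>0$ such that for every fixed $0<\varepsilon<\varepsilon_0$ the following holds. Consider data $n,\boldsymbol{s},\boldsymbol{t},H$ with $n\to\infty$ such that, uniformly over $j$, $s_j-s$, $x_j$, $t_j-s$, $y_j$ are $O(n^{1/2+\varepsilon})$; $X=O(n^{1+2\varepsilon})$; and $\frac{(1-2\lambda)^2}{3A}\le a\log n$. Let $G$ be uniformly random in $\mathcal{D}(\boldsymbol{s},\boldsymbol{t})$ and $p=s/(n-1)$. Then (i) the probability that $G$ is arc-disjoint from $H$ is $(1-p)^X\,M$ and (ii) the probability that $G$ contains $H$ as a subdigraph (every arc of $H$ is an arc of $G$) is $p^X\,T$, where \begin{align*} M=\exp\Bigl(&\frac{\lambda X}{(1-\lambda)n}+\frac{\lambda X^2}{2(1-\lambda)n^2}-\frac{R_{1,1}+C_{1,1}}{(1-\lambda)n}-\frac{Y}{\lambda(1-\lambda)n^2}+\frac{\lambda(R_{0,2}+C_{0,2})}{2(1-\lambda)n}\\ &+\frac{\lambda(1-2\lambda)(R_{0,3}+C_{0,3})}{6(1-\lambda)^2n^2}-\frac{(1-2\lambda)(R_{1,2}+C_{1,2})}{2(1-\lambda)^2n^2}-\frac{R_{2,1}+C_{2,1}}{2(1-\lambda)^2n^2}+O(n^{-b})\Bigr), \end{align*} \begin{align*} T=\exp\Bigl(&\frac{(1-\lambda)X}{\lambda n}+\frac{(1-\lambda)X^2}{2\lambda n^2}+\frac{R_{1,1}+C_{1,1}}{\lambda n}-\frac{R_{2,1}+C_{2,1}}{2\lambda^2n^2}-\frac{(1+\lambda)(R_{0,2}+C_{0,2})}{2\lambda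 n}\\ &+\frac{(1+2\lambda)(R_{1,2}+C_{1,2})}{2\lambda^2n^2}-\frac{(1+\lambda)(1+2\lambda)(R_{0,3}+C_{0,3})}{6\lambda^2n^2}-\frac{Y-Y_{0,1}-Y_{1,0}+Y_{1,1}}{\lambda(1-\lambda)n^2}+O(n^{-b})\Bigr). \end{align*}
   Context: A simple digraph has no loops and no multiple arcs. $\boldsymbol{s}=(s_1,\dots,s_n)$, $\boldsymbol{t}=(t_1,\dots,t_n)$ are vectors of positive integers with equal sums; $\mathcal{D}(\boldsymbol{s},\boldsymbol{t})$ is the set of simple digraphs on $\{w_1,\dots,w_n\}$ with out-degrees $s_j$ and in-degrees $t_j$. $H$ is a fixed simple digraph on the same vertices with out-degrees $x_j$ and in-degrees $y_j$. $s=n^{-1}\sum_js_j$, $\lambda=s/n$, $A=\tfrac12\lambda(1-\lambda)$, $\delta_j=s_j-s+\lambda x_j$, $\eta_j=t_j-s+\lambda y_j$, $X=\sum_jx_j$ (number of arcs of $H$). For nonnegative integers $h,\ell$: $R_{h,\ell}=\sum_{j=1}^n\delta_j^hx_j^\ell$, $C_{h,\ell}=\sum_{j=1}^n\eta_j^hy_j^\ell$. Sums over arcs $w_jw_k$ (from $w_j$ to $w_k$) of $H$: $Y=\sum\delta_j\eta_k$, $Y_{1,1}=\sum x_jy_k$, $Y_{0,1}=\sum\delta_jy_k$, $Y_{1,0}=\sum x_j\eta_k$. Asymptotic notation refers to $n\to\infty$. *)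

theory Defs
  imports Complex_Main
begin

text \<open>Vertices w_1..w_n are represented by 0..n-1. A simple digraph is a set of
  arcs (j,k) (arc from j to k) with j,k < n and j \<noteq> k.\<close>

definition arcs :: "nat \<Rightarrow> (nat \<times> nat) set" where
  "arcs n = {(j,k). j < n \<and> k < n \<and> j \<noteq> k}"

definition outdeg :: "(nat \<times> nat) set \<Rightarrow> nat \<Rightarrow> nat" where
  "outdeg G j = card {k. (j,k) \<in> G}"

definition indeg :: "(nat \<times> nat) set \<Rightarrow> nat \<Rightarrow> nat" where
  "indeg G k = card {j. (j,k) \<in> G}"

definition digraphs_deg :: "nat \<Rightarrow> (nat \<Rightarrow> nat) \<Rightarrow> (nat \<Rightarrow> nat) \<Rightarrow> (nat \<times> nat) set set" where
  "digraphs_deg n s t = {G. G \<subseteq> arcs n \<and> (\<forall>j<n. outdeg G j = s j \<and> indeg G j = t j)}"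

definition prob_D :: "nat \<Rightarrow> (nat \<Rightarrow> nat) \<Rightarrow> (nat \<Rightarrow> nat) \<Rightarrow> ((nat \<times> nat) set \<Rightarrow> bool) \<Rightarrow> real" where
  "prob_D n s t P = real (card {G \<in> digraphs_deg n s t. P G}) / real (card (digraphs_deg n s t))"

definition sbar :: "nat \<Rightarrow> (nat \<Rightarrow> nat) \<Rightarrow> real" where
  "sbar n s = (\<Sum>j<n. real (s j)) / real n"

definition lam :: "nat \<Rightarrow> (nat \<Rightarrow> nat) \<Rightarrow> real" where
  "lam n s = sbar n s / real n"

definition Acst :: "nat \<Rightarrow> (nat \<Rightarrow> nat) \<Rightarrow> real" where
  "Acst n s = lam n s * (1 - lam n s) / 2"

definition dlt :: "nat \<Rightarrow> (nat \<Rightarrow> nat) \<Rightarrow> (nat \<times> nat) set \<Rightarrow> nat \<Rightarrow> real" where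
  "dlt n s H j = real (s j) - sbar n s + lam n s * real (outdeg H j)"

definition eta :: "nat \<Rightarrow> (nat \<Rightarrow> nat) \<Rightarrow> (nat \<Rightarrow> nat) \<Rightarrow> (nat \<times> nat) set \<Rightarrow> nat \<Rightarrow> real" where
  "eta n s t H j = real (t j) - sbar n s + lam n s * real (indeg H j)"

definition Xarcs :: "nat \<Rightarrow> (nat \<times> nat) set \<Rightarrow> real" where
  "Xarcs n H = (\<Sum>j<n. real (outdeg H j))"

definition Rs :: "nat \<Rightarrow> (nat \<Rightarrow> nat) \<Rightarrow> (nat \<times> nat) set \<Rightarrow> nat \<Rightarrow> nat \<Rightarrow> real" where
  "Rs n s H h l = (\<Sum>j<n. dlt n s H j ^ h * real (outdeg H j) ^ l)"

definition Cs :: "nat \<Rightarrow> (nat \<Rightarrow> nat) \<Rightarrow> (nat \<Rightarrow> nat) \<Rightarrow> (nat \<times> nat) set \<Rightarrow> nat \<Rightarrow> nat \<Rightarrow> real" where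
  "Cs n s t H h l = (\<Sum>j<n. eta n s t H j ^ h * real (indeg H j) ^ l)"

definition Ysum :: "nat \<Rightarrow> (nat \<Rightarrow> nat) \<Rightarrow> (nat \<Rightarrow> nat) \<Rightarrow> (nat \<times> nat) set \<Rightarrow> real" where
  "Ysum n s t H = (\<Sum>(j,k)\<in>H. dlt n s H j * eta n s t H k)"

definition Y11 :: "(nat \<times> nat) set \<Rightarrow> real" where
  "Y11 H = (\<Sum>(j,k)\<in>H. real (outdeg H j) * real (indeg H k))"

definition Y01 :: "nat \<Rightarrow> (nat \<Rightarrow> nat) \<Rightarrow> (nat \<times> nat) set \<Rightarrow> real" where
  "Y01 n s H = (\<Sum>(j,k)\<in>H. dlt n s H j * real (indeg H k))"

definition Y10 :: "nat \<Rightarrow> (nat \<Rightarrow> nat) \<Rightarrow> (nat \<Rightarrow> nat) \<Rightarrow> (nat \<times> nat) set \<Rightarrow> real" where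
  "Y10 n s t H = (\<Sum>(j,k)\<in>H. real (outdeg H j) * eta n s t H k)"

definition Mexp :: "nat \<Rightarrow> (nat \<Rightarrow> nat) \<Rightarrow> (nat \<Rightarrow> nat) \<Rightarrow> (nat \<times> nat) set \<Rightarrow> real" where
  "Mexp n s t H = (let l = lam n s; N = real n; X = Xarcs n H;
      R = Rs n s H; C = Cs n s t H in
      l * X / ((1 - l) * N) + l * X^2 / (2 * (1 - l) * N^2)
      - (R 1 1 + C 1 1) / ((1 - l) * N)
      - Ysum n s t H / (l * (1 - l) * N^2)
      + l * (R 0 2 + C 0 2) / (2 * (1 - l) * N)
      + l * (1 - 2*l) * (R 0 3 + C 0 3) / (6 * (1 - l)^2 * N^2)
      - (1 - 2*l) * (R 1 2 + C 1 2) / (2 * (1 - l)^2 * N^2)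
      - (R 2 1 + C 2 1) / (2 * (1 - l)^2 * N^2))"

definition Texp :: "nat \<Rightarrow> (nat \<Rightarrow> nat) \<Rightarrow> (nat \<Rightarrow> nat) \<Rightarrow> (nat \<times> nat) set \<Rightarrow> real" where
  "Texp n s t H = (let l = lam n s; N = real n; X = Xarcs n H;
      R = Rs n s H; C = Cs n s t H in
      (1 - l) * X / (l * N) + (1 - l) * X^2 / (2 * l * N^2)
      + (R 1 1 + C 1 1) / (l * N)
      - (R 2 1 + C 2 1) / (2 * l^2 * N^2)
      - (1 + l) * (R 0 2 + C 0 2) / (2 * l * N)
      + (1 + 2*l) * (R 1 2 + C 1 2) / (2 * l^2 * N^2)
      - (1 + l) * (1 + 2*l) * (R 0 3 + C 0 3) / (6 * l^2 * N^2)
      - (Ysum n s t H - Y01 n s H - Y10 n s t H + Y11 H) / (l * (1 - l) * N^2))"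

end

theory Submission
  imports Defs "HOL-Analysis.Convex"
begin

text \<open>Revealing the arcs of \<open>H\<close> one at a time, the probability of avoiding \<open>H\<close> is a product of factors
  \<open>1 - P\<close>, where \<open>P\<close> is the probability of a single arc in a random digraph with given degrees that
  avoids the arcs already revealed; hence it suffices to know such a probability up to an error of
  order \<open>n powr (-3/2)\<close>, apart from small powers of \<open>n\<close>.

  Take two rows \<open>a\<close>, \<open>b\<close> of the adjacency matrix and let \<open>\<alpha>\<close> and \<open>\<beta>\<close> count the free columns in which
  only row \<open>a\<close>, respectively only row \<open>b\<close>, has an entry 1. Given everything except how these columns
  are shared out between the two rows, all ways of sharing them out are equally likely. Therefore
  \<open>P(a,v) - P(b,v)\<close> is exactly the mean of \<open>(\<alpha> - \<beta>) / (\<alpha> + \<beta>)\<close> over the event that column \<open>v\<close> is one of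
  them. Here \<open>\<alpha> - \<beta>\<close> is of order \<open>n powr (1/2)\<close>, and \<open>\<alpha> + \<beta>\<close> is concentrated because the codegree of two
  rows has a small fourth central moment. Averaging over \<open>b\<close> gives \<open>P(a,v)\<close> to leading order; since
  conditioning on a bounded number of entries leads to measures of the same kind, inserting an
  estimate on the right-hand side yields a better one, and two such rounds reach the required order.

  The exponent of the theorem, as a function of \<open>H\<close>, changes by \<open>ln ((1 - P) / (1 - p))\<close>, up to this
  error, when an arc is added to \<open>H\<close>. Containing \<open>H\<close> means avoiding \<open>H\<close> in the complementary digraph.\<close>

subsection \<open>Averages\<close>

definition avg :: "'b set \<Rightarrow> ('b \<Rightarrow> real) \<Rightarrow> real" where
  "avg S f = (\<Sum>x\<in>S. f x) / real (card S)"

lemma avg_cong: "(\<And>x. x \<in> S \<Longrightarrow> f x = g x) \<Longrightarrow> avg S f = avg S g"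
  by (simp add: avg_def)

lemma avg_add: "avg S (\<lambda>x. f x + g x) = avg S f + avg S g"
  by (simp add: avg_def sum.distrib add_divide_distrib)

lemma avg_diff: "avg S (\<lambda>x. f x - g x) = avg S f - avg S g"
  by (simp add: avg_def sum_subtractf diff_divide_distrib)

lemma avg_cmult: "avg S (\<lambda>x. c * f x) = c * avg S f"
  by (simp add: avg_def sum_distrib_left)

lemma avg_const: "finite S \<Longrightarrow> S \<noteq> {} \<Longrightarrow> avg S (\<lambda>x. c) = c"
  by (simp add: avg_def)

lemma avg_sum: "avg S (\<lambda>x. \<Sum>i\<in>I. f i x) = (\<Sum>i\<in>I. avg S (f i))"
  unfolding avg_def by (subst sum.swap) (simp add: sum_divide_distrib)

lemma avg_swap: "avg S (\<lambda>x. avg I (\<lambda>i. f i x)) = avg I (\<lambda>i. avg S (f i))"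
  unfolding avg_def by (simp add: sum_divide_distrib mult.commute sum.swap[of _ I S])

lemma avg_mono: "(\<And>x. x \<in> S \<Longrightarrow> f x \<le> g x) \<Longrightarrow> avg S f \<le> avg S g"
  by (simp add: avg_def sum_mono divide_right_mono)

lemma avg_nonneg: "(\<And>x. x \<in> S \<Longrightarrow> 0 \<le> f x) \<Longrightarrow> 0 \<le> avg S f"
  by (simp add: avg_def sum_nonneg)

lemma abs_avg_le: "\<bar>avg S f\<bar> \<le> avg S (\<lambda>x. \<bar>f x\<bar>)"
  by (simp add: avg_def divide_right_mono)

lemma avg_restrict:
  assumes "finite S" "T \<subseteq> S"
  shows "avg S (\<lambda>x. of_bool (x \<in> T) * f x) = avg S (\<lambda>x. of_bool (x \<in> T)) * avg T f"
  using assms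
  by (cases "T = {}") (auto simp: avg_def Int_absorb1 card_gt_0_iff dest: finite_subset)

lemma avg_power_even_le:
  assumes "even m" "finite S" "S \<noteq> {}"
  shows "avg S f ^ m \<le> avg S (\<lambda>x. f x ^ m)"
proof -
  have "(\<Sum>x\<in>S. (1 / real (card S)) *\<^sub>R f x) ^ m \<le> (\<Sum>x\<in>S. (1 / real (card S)) * f x ^ m)"
    using assms by (intro convex_on_sum[OF _ _ convex_power_even]) auto
  then show ?thesis by (simp add: avg_def sum_divide_distrib)
qed

lemma exists_le_avg:
  assumes "finite S" "S \<noteq> {}" shows "\<exists>x\<in>S. f x \<le> avg S f"
proof (rule ccontr)
  assume "\<not> ?thesis"
  then have "(\<Sum>x\<in>S. avg S f) < (\<Sum>x\<in>S. f x)" using assms by (intro sum_strict_mono) auto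
  then show False using assms by (simp add: avg_def)
qed

subsection \<open>Orders of magnitude\<close>

text \<open>The scale of all error terms: \<open>r\<close> stands for the square root of \<open>n\<close>, and \<open>\<theta>\<close> for a small
  power of \<open>n\<close> that absorbs constants, logarithms and the factors \<open>n powr \<epsilon>\<close> of the hypotheses.
  Only the exponent of \<open>r\<close> matters in \<open>has_order\<close>; those of \<open>\<theta>\<close> merely have to stay bounded, and
  are chosen generously.\<close>

named_theorems has_order_intros

locale scale =
  fixes \<theta> r :: real
  assumes theta_ge: "\<theta> \<ge> 100" and r_ge: "r \<ge> \<theta> ^ 200"
begin

lemma theta_pos: "\<theta> > 0" "\<theta> \<ge> 1" "\<theta> \<noteq> 0"
  using theta_ge by auto

lemma theta_power_le_r: "k \<le> 200 \<Longrightarrow> \<theta> ^ k \<le> r"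
  using power_increasing[of k 200 \<theta>] theta_pos r_ge by linarith

lemma mult_theta_power_le_r:
  assumes "k < 200" "c \<le> 100"
  shows "c * \<theta> ^ k \<le> r"
proof -
  have "c * \<theta> ^ k \<le> \<theta> * \<theta> ^ k" using assms(2) theta_ge by (intro mult_right_mono) auto
  also have "\<dots> = \<theta> ^ Suc k" by simp
  also have "\<dots> \<le> r" using assms(1) by (intro theta_power_le_r) simp
  finally show ?thesis .
qed

lemma r_ge_10000: "r \<ge> 10000"
proof -
  have "100 ^ 2 \<le> \<theta> ^ 2" using theta_ge by (intro power_mono) auto
  then show ?thesis using theta_power_le_r[of 2] by simp
qed

lemma r_pos: "r > 0" "r \<ge> 1" "r \<noteq> 0"
  using r_ge_10000 by auto

definition has_order :: "nat \<Rightarrow> int \<Rightarrow> real \<Rightarrow> bool" where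
  "has_order k j x \<longleftrightarrow> \<bar>x\<bar> \<le> \<theta> ^ k * r powi j"

lemma has_orderD: "has_order k j x \<Longrightarrow> \<bar>x\<bar> \<le> \<theta> ^ k * r powi j"
  by (simp add: has_order_def)

lemma has_order_mono:
  assumes "has_order k j x" "k \<le> k'" "j \<le> j'"
  shows "has_order k' j' x"
proof -
  have "\<theta> ^ k * r powi j \<le> \<theta> ^ k' * r powi j'"
    using assms theta_pos r_pos by (intro mult_mono power_increasing power_int_increasing) auto
  then show ?thesis using assms by (simp add: has_order_def)
qed

lemma has_order_absorb:
  assumes "has_order k j x" "k \<le> k' + 200" "j < j'"
  shows "has_order k' j' x"
proof -
  have "\<bar>x\<bar> \<le> \<theta> ^ (k' + 200) * r powi (j' - 1)"
    using has_order_mono[OF assms(1,2), of "j' - 1"] assms(3) by (simp add: has_order_def)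
  also have "\<dots> = \<theta> ^ k' * (\<theta> ^ 200 * r powi (j' - 1))" by (simp add: power_add)
  also have "\<dots> \<le> \<theta> ^ k' * (r * r powi (j' - 1))"
    using r_ge theta_pos r_pos by (intro mult_left_mono mult_right_mono) auto
  also have "r * r powi (j' - 1) = r powi j'" using r_pos by (simp add: power_int_diff)
  finally show ?thesis by (simp add: has_order_def)
qed

lemma has_order_small:
  assumes "has_order k j x" "k < 200" "j < 0"
  shows "\<bar>x\<bar> \<le> 1 / 100"
proof -
  have "\<bar>x\<bar> \<le> \<theta> ^ k / r"
    using has_orderD[OF has_order_mono[OF assms(1), of k "-1"]] assms(3)
    by (simp add: power_int_minus field_simps)
  also have "\<dots> \<le> 1 / 100"
    using mult_theta_power_le_r[OF assms(2), of 100] r_pos by (simp add: field_simps)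
  finally show ?thesis .
qed

lemma has_order_dominated: "has_order k j x \<Longrightarrow> \<bar>y\<bar> \<le> x \<Longrightarrow> has_order k j y"
  by (auto simp: has_order_def)

lemma has_order_mult [has_order_intros]:
  "has_order k j x \<Longrightarrow> has_order k' j' y \<Longrightarrow> has_order (k + k') (j + j') (x * y)"
  using mult_mono[of "\<bar>x\<bar>" "\<theta> ^ k * r powi j" "\<bar>y\<bar>" "\<theta> ^ k' * r powi j'"] theta_pos r_pos
  by (simp add: has_order_def abs_mult power_add power_int_add mult_ac)

lemma has_order_add [has_order_intros]:
  assumes "has_order k j x" "has_order k' j' y"
  shows "has_order (Suc (max k k')) (max j j') (x + y)"
proof -
  have "\<bar>x + y\<bar> \<le> 2 * (\<theta> ^ max k k' * r powi max j j')"
    using has_orderD[OF has_order_mono[OF assms(1), of "max k k'" "max j j'"]]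
      has_orderD[OF has_order_mono[OF assms(2), of "max k k'" "max j j'"]] by simp
  also have "\<dots> \<le> \<theta> * (\<theta> ^ max k k' * r powi max j j')"
    using theta_ge r_pos by (intro mult_right_mono) auto
  finally show ?thesis by (simp add: has_order_def mult_ac)
qed

lemma has_order_minus [has_order_intros]: "has_order k j x \<Longrightarrow> has_order k j (- x)"
  by (simp add: has_order_def)

lemma has_order_diff [has_order_intros]:
  "has_order k j x \<Longrightarrow> has_order k' j' y \<Longrightarrow> has_order (Suc (max k k')) (max j j') (x - y)"
  using has_order_add[OF _ has_order_minus, of k j x k' j' y] by simp

lemma has_order_abs [has_order_intros]: "has_order k j x \<Longrightarrow> has_order k j \<bar>x\<bar>"
  by (simp add: has_order_def)

lemma has_order_power [has_order_intros]: "has_order k j x \<Longrightarrow> has_order (k * m) (j * int m) (x ^ m)"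
  using power_mono[of "\<bar>x\<bar>" "\<theta> ^ k * r powi j" m]
  by (simp add: has_order_def power_mult_distrib power_abs power_mult power_int_mult)

lemma has_order_of_power:
  assumes "has_order (k * m) (j * int m) (x ^ m)" "m > 0"
  shows "has_order k j x"
proof -
  have "\<bar>x\<bar> ^ m \<le> (\<theta> ^ k * r powi j) ^ m"
    using assms by (simp add: has_order_def power_mult_distrib power_abs power_mult power_int_mult)
  then show ?thesis
    using assms(2) theta_pos r_pos by (simp add: has_order_def power_mono_iff)
qed

lemma has_order_bounded: "\<bar>c\<bar> \<le> 100 \<Longrightarrow> has_order 1 0 c"
  using theta_ge by (simp add: has_order_def)

lemma has_order_unit: "\<bar>c\<bar> \<le> 1 \<Longrightarrow> has_order 0 0 c"
  by (simp add: has_order_def)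

lemma has_order_numeral [has_order_intros]: "numeral w \<le> (100::real) \<Longrightarrow> has_order 1 0 (numeral w)"
  by (rule has_order_bounded) simp

lemma has_order_inverse_numeral [has_order_intros]: "has_order 0 0 (inverse (numeral w))"
  by (rule has_order_unit) (simp add: inverse_le_1_iff)

lemma has_order_divide [has_order_intros]:
  "has_order k j x \<Longrightarrow> has_order k' j' (inverse y) \<Longrightarrow> has_order (k + k') (j + j') (x / y)"
  unfolding divide_inverse by (rule has_order_mult)

lemma has_order_inverse_mult [has_order_intros]:
  "has_order k j (inverse x) \<Longrightarrow> has_order k' j' (inverse y) \<Longrightarrow> has_order (k + k') (j + j') (inverse (x * y))"
  unfolding inverse_mult_distrib by (rule has_order_mult)

lemma has_order_inverse_power [has_order_intros]:
  "has_order k j (inverse x) \<Longrightarrow> has_order (k * m) (j * int m) (inverse (x ^ m))"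
  unfolding power_inverse[symmetric] by (rule has_order_power)

lemma has_order_1 [has_order_intros]: "has_order 0 0 1"
  by (simp add: has_order_def)

lemma has_order_theta [has_order_intros]: "has_order 1 0 \<theta>"
  using theta_ge by (simp add: has_order_def)

lemma has_order_r [has_order_intros]: "has_order 0 1 r"
  using r_pos by (simp add: has_order_def)

lemma has_order_sum:
  assumes "\<And>i. i \<in> I \<Longrightarrow> has_order k j (f i)" "has_order k' j' (real (card I))"
  shows "has_order (k + k') (j + j') (\<Sum>i\<in>I. f i)"
proof (rule has_order_dominated)
  show "has_order (k + k') (j + j') ((\<theta> ^ k * r powi j) * real (card I))"
    using theta_pos r_pos by (intro has_order_mult assms(2)) (simp add: has_order_def)
  have "\<bar>\<Sum>i\<in>I. f i\<bar> \<le> (\<Sum>i\<in>I. \<theta> ^ k * r powi j)"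
    using assms(1) by (intro order_trans[OF sum_abs] sum_mono) (simp add: has_order_def)
  then show "\<bar>\<Sum>i\<in>I. f i\<bar> \<le> (\<theta> ^ k * r powi j) * real (card I)" by (simp add: mult.commute)
qed

lemma has_order_avg_dominated:
  "has_order k j (avg S g) \<Longrightarrow> (\<And>x. x \<in> S \<Longrightarrow> \<bar>f x\<bar> \<le> g x) \<Longrightarrow> has_order k j (avg S f)"
  by (rule has_order_dominated[OF _ order_trans[OF abs_avg_le avg_mono]])

lemma has_order_avg:
  assumes "\<And>x. x \<in> S \<Longrightarrow> has_order k j (f x)" shows "has_order k j (avg S f)"
proof (cases "finite S \<and> S \<noteq> {}")
  case True
  have "has_order k j (avg S (\<lambda>_. \<theta> ^ k * r powi j))"
    using True theta_pos r_pos by (simp add: avg_const has_order_def)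
  then show ?thesis by (rule has_order_avg_dominated) (use assms in \<open>simp add: has_order_def\<close>)
next
  case False
  then have "avg S f = 0" by (auto simp: avg_def)
  then show ?thesis using theta_pos r_pos by (simp add: has_order_def)
qed

end

subsection \<open>Matrices with prescribed row and column sums\<close>

text \<open>A digraph is read as a 0-1 matrix. \<open>matrices n s t F Q\<close> consists of the matrices with the
  given row and column sums whose entries in the frozen cells \<open>F\<close> are prescribed, namely 1 exactly
  on \<open>Q\<close>. Conditioning on the value of a cell amounts to freezing it.\<close>

definition row :: "(nat \<times> nat) set \<Rightarrow> nat \<Rightarrow> nat set" where
  "row G a = {v. (a,v) \<in> G}"

abbreviation col :: "(nat \<times> nat) set \<Rightarrow> nat \<Rightarrow> nat set" where
  "col G v \<equiv> row (G\<inverse>) v"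

abbreviation row_card :: "(nat \<times> nat) set \<Rightarrow> nat \<Rightarrow> real" where
  "row_card G a \<equiv> real (card (row G a))"

abbreviation col_card :: "(nat \<times> nat) set \<Rightarrow> nat \<Rightarrow> real" where
  "col_card G v \<equiv> real (card (col G v))"

definition matrices ::
    "nat \<Rightarrow> (nat \<Rightarrow> nat) \<Rightarrow> (nat \<Rightarrow> nat) \<Rightarrow> (nat \<times> nat) set \<Rightarrow> (nat \<times> nat) set \<Rightarrow> (nat \<times> nat) set set" where
  "matrices n s t F Q = {G. G \<subseteq> {..<n} \<times> {..<n} \<and> G \<inter> F = Q \<and>
     (\<forall>a<n. card (row G a) = s a) \<and> (\<forall>v<n. card (col G v) = t v)}"

lemma mem_row [simp]: "v \<in> row G a \<longleftrightarrow> (a,v) \<in> G"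
  by (simp add: row_def)

lemma finite_row: "finite G \<Longrightarrow> finite (row G a)"
  by (rule finite_subset[of _ "snd ` G"]) force+

lemma card_row_le: "finite G \<Longrightarrow> card (row G a) \<le> card G"
  by (rule surj_card_le[of _ _ snd]) force+

lemma row_insert: "row (insert (b,w) G) a = (if a = b then insert w (row G a) else row G a)"
  and col_insert: "col (insert (b,w) G) v = (if v = w then insert b (col G v) else col G v)"
  by auto

lemma sum_card_row:
  assumes "F \<subseteq> {..<n} \<times> {..<n}" shows "(\<Sum>a<n. card (row F a)) = card F"
proof -
  have "F = (SIGMA a:{..<n}. row F a)" using assms by auto
  moreover have "finite F" by (rule finite_subset[OF assms]) simp
  ultimately show ?thesis by (metis card_SigmaI finite_lessThan finite_row)
qed

lemma matricesD:
  assumes "G \<in> matrices n s t F Q"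
  shows "G \<subseteq> {..<n} \<times> {..<n}" "G \<inter> F = Q" "finite G"
    "a < n \<Longrightarrow> card (row G a) = s a" "v < n \<Longrightarrow> card (col G v) = t v"
  using assms by (auto simp: matrices_def intro: finite_subset[of G "{..<n} \<times> {..<n}"])

lemma finite_matrices: "finite (matrices n s t F Q)"
  by (rule finite_subset[of _ "Pow ({..<n} \<times> {..<n})"]) (auto simp: matrices_def)

lemma matrices_cong: "(\<And>a. a < n \<Longrightarrow> s a = s' a) \<Longrightarrow> matrices n s t F Q = matrices n s' t F Q"
  by (simp add: matrices_def)

lemma matrices_insert_mem:
  assumes "e \<notin> F" "Q \<subseteq> F"
  shows "matrices n s t (insert e F) (insert e Q) = {G \<in> matrices n s t F Q. e \<in> G}"
proof -
  have "e \<notin> Q" using assms by blast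
  then have "G \<inter> insert e F = insert e Q \<longleftrightarrow> G \<inter> F = Q \<and> e \<in> G" for G
    using assms(1) by (auto simp: Int_insert_right insert_ident)
  then show ?thesis by (auto simp: matrices_def)
qed

lemma matrices_insert_notin:
  assumes "e \<notin> F" "Q \<subseteq> F"
  shows "matrices n s t (insert e F) Q = {G \<in> matrices n s t F Q. e \<notin> G}"
proof -
  have "G \<inter> insert e F = Q \<longleftrightarrow> G \<inter> F = Q \<and> e \<notin> G" for G
    using assms by blast
  then show ?thesis by (auto simp: matrices_def)
qed

subsection \<open>Switchings in two rows\<close>

abbreviation frozen_cols :: "(nat \<times> nat) set \<Rightarrow> nat \<Rightarrow> nat \<Rightarrow> nat set" where
  "frozen_cols F a b \<equiv> row F a \<union> row F b"

definition free_cols :: "nat \<Rightarrow> (nat \<times> nat) set \<Rightarrow> nat \<Rightarrow> nat \<Rightarrow> nat set" where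
  "free_cols n F a b = {..<n} - frozen_cols F a b"

definition surplus :: "nat \<Rightarrow> (nat \<times> nat) set \<Rightarrow> nat \<Rightarrow> nat \<Rightarrow> (nat \<times> nat) set \<Rightarrow> nat set" where
  "surplus n F a b G = (row G a - row G b) \<inter> free_cols n F a b"

abbreviation imbalance :: "nat \<Rightarrow> (nat \<times> nat) set \<Rightarrow> nat \<Rightarrow> nat \<Rightarrow> (nat \<times> nat) set \<Rightarrow> real" where
  "imbalance n F a b G \<equiv> real (card (surplus n F a b G)) - real (card (surplus n F b a G))"

abbreviation discordance :: "nat \<Rightarrow> (nat \<times> nat) set \<Rightarrow> nat \<Rightarrow> nat \<Rightarrow> (nat \<times> nat) set \<Rightarrow> real" where
  "discordance n F a b G \<equiv> real (card (surplus n F a b G)) + real (card (surplus n F b a G))"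

abbreviation differ :: "nat \<Rightarrow> nat \<Rightarrow> nat \<Rightarrow> (nat \<times> nat) set \<Rightarrow> real" where
  "differ a b v G \<equiv> of_bool (((a,v) \<in> G) \<noteq> ((b,v) \<in> G))"

abbreviation codegree :: "(nat \<times> nat) set \<Rightarrow> nat \<Rightarrow> nat \<Rightarrow> real" where
  "codegree G a b \<equiv> real (card (row G a \<inter> row G b))"

definition switch :: "nat \<Rightarrow> nat \<Rightarrow> (nat \<times> nat) set \<Rightarrow> nat \<Rightarrow> nat \<Rightarrow> (nat \<times> nat) set" where
  "switch a b G v w = (G - {(a,v),(b,w)}) \<union> {(b,v),(a,w)}"

lemma free_cols_commute: "free_cols n F b a = free_cols n F a b"
  by (auto simp: free_cols_def)

lemma mem_surplus:
  "v \<in> surplus n F a b G \<longleftrightarrow> v < n \<and> (a,v) \<notin> F \<and> (b,v) \<notin> F \<and> (a,v) \<in> G \<and> (b,v) \<notin> G"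
  by (auto simp: surplus_def free_cols_def)

lemma surplus_subset: "surplus n F a b G \<subseteq> {..<n}"
  by (auto simp: mem_surplus)

lemma finite_free_cols [simp]: "finite (free_cols n F a b)"
  by (simp add: free_cols_def)

lemma finite_surplus [simp]: "finite (surplus n F a b G)"
  by (simp add: surplus_def)

lemma discordance_pos:
  assumes "v < n" "(a,v) \<notin> F" "(b,v) \<notin> F" "((a,v) \<in> G) \<noteq> ((b,v) \<in> G)"
  shows "discordance n F a b G > 0"
proof -
  have "v \<in> surplus n F a b G \<or> v \<in> surplus n F b a G" using assms by (auto simp: mem_surplus)
  then have "card (surplus n F a b G) > 0 \<or> card (surplus n F b a G) > 0"
    by (auto simp: card_gt_0_iff)
  then show ?thesis by auto
qed

lemma card_exchange: "x \<in> A \<Longrightarrow> y \<notin> A \<Longrightarrow> finite A \<Longrightarrow> card (insert y (A - {x})) = card A"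
  using card_Suc_Diff1[of A x] by (simp add: card.insert_remove)

context
  fixes a b n F G v w
  assumes ab: "a \<noteq> b" and v: "v \<in> surplus n F a b G" and w: "w \<in> surplus n F b a G"
begin

lemma surplus_switch:
  "surplus n F a b (switch a b G v w) = insert w (surplus n F a b G - {v})"
  "surplus n F b a (switch a b G v w) = insert v (surplus n F b a G - {w})"
  using ab v w by (auto simp: mem_surplus switch_def)

lemma card_surplus_switch:
  "card (surplus n F a b (switch a b G v w)) = card (surplus n F a b G)"
  "card (surplus n F b a (switch a b G v w)) = card (surplus n F b a G)"
  unfolding surplus_switch by (intro card_exchange; use v w in \<open>simp add: mem_surplus\<close>)+

lemma switch_switch: "switch a b (switch a b G v w) w v = G"
  using ab v w by (auto simp: mem_surplus switch_def)

lemma card_row_switch: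
  assumes "finite G" shows "card (row (switch a b G v w) c) = card (row G c)"
proof -
  consider (first) "c = a" | (second) "c = b" | (other) "c \<noteq> a" "c \<noteq> b" by blast
  then show ?thesis
  proof cases
    case first
    have "row (switch a b G v w) a = insert w (row G a - {v})"
      using ab v w by (auto simp: mem_surplus switch_def)
    then show ?thesis using first v w card_exchange[of v "row G a" w] finite_row[OF assms]
      by (simp add: mem_surplus)
  next
    case second
    have "row (switch a b G v w) b = insert v (row G b - {w})"
      using ab v w by (auto simp: mem_surplus switch_def)
    then show ?thesis using second v w card_exchange[of w "row G b" v] finite_row[OF assms]
      by (simp add: mem_surplus)
  next
    case other
    then have "row (switch a b G v w) c = row G c" by (auto simp: switch_def)
    then show ?thesis by simp
  qed
qed

end

lemma converse_switch: "(switch a b G v w)\<inverse> = switch v w (G\<inverse>) a b"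
  by (auto simp: switch_def)

lemma switch_matrices:
  assumes ab: "a \<noteq> b" "a < n" "b < n" and G: "G \<in> matrices n s t F Q"
    and v: "v \<in> surplus n F a b G" and w: "w \<in> surplus n F b a G"
  shows "switch a b G v w \<in> matrices n s t F Q"
proof -
  note G' = matricesD[OF G]
  have vw: "v \<noteq> w" "a \<in> surplus n (F\<inverse>) v w (G\<inverse>)" "b \<in> surplus n (F\<inverse>) w v (G\<inverse>)"
    using ab v w by (auto simp: mem_surplus)
  have "card (row (switch a b G v w) c) = card (row G c)" for c
    by (rule card_row_switch[OF ab(1) v w G'(3)])
  moreover have "card (col (switch a b G v w) c) = card (col G c)" for c
    unfolding converse_switch using G'(3) by (intro card_row_switch[OF vw]) simp
  moreover have "switch a b G v w \<subseteq> {..<n} \<times> {..<n}"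
    using G'(1) v w ab by (auto simp: switch_def mem_surplus)
  moreover have "switch a b G v w \<inter> F = G \<inter> F"
    using v w by (auto simp: switch_def mem_surplus)
  ultimately show ?thesis using G by (simp add: matrices_def)
qed

lemma sum_switch:
  fixes f :: "(nat \<times> nat) set \<Rightarrow> nat \<Rightarrow> nat \<Rightarrow> real"
  assumes ab: "a \<noteq> b" "a < n" "b < n"
  shows "(\<Sum>G\<in>matrices n s t F Q. \<Sum>v\<in>surplus n F a b G. \<Sum>w\<in>surplus n F b a G. f G v w)
    = (\<Sum>G\<in>matrices n s t F Q. \<Sum>v\<in>surplus n F a b G. \<Sum>w\<in>surplus n F b a G. f (switch a b G v w) w v)"
proof -
  let ?T = "SIGMA G:matrices n s t F Q. surplus n F a b G \<times> surplus n F b a G"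
  have triple_sum: "(\<Sum>G\<in>matrices n s t F Q. \<Sum>v\<in>surplus n F a b G. \<Sum>w\<in>surplus n F b a G. g G v w)
     = (\<Sum>(G,v,w)\<in>?T. g G v w)" for g :: "(nat \<times> nat) set \<Rightarrow> nat \<Rightarrow> nat \<Rightarrow> real"
    by (subst sum.Sigma[symmetric]) (auto simp: finite_matrices sum.cartesian_product)
  define swap where "swap = (\<lambda>(G,v,w). (switch a b G v w, w, v))"
  have swap_in: "swap x \<in> ?T" if "x \<in> ?T" for x
    using that ab switch_matrices[OF ab] surplus_switch[OF ab(1)] by (auto simp: swap_def)
  have swap_swap: "swap (swap x) = x" if "x \<in> ?T" for x
    using that switch_switch[OF ab(1)] by (auto simp: swap_def)
  have "(\<Sum>(G,v,w)\<in>?T. f G v w) = (\<Sum>(G,v,w)\<in>?T. f (switch a b G v w) w v)"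
    by (rule sum.reindex_bij_witness[of _ swap swap]) (use swap_in swap_swap in \<open>auto simp: swap_def\<close>)
  then show ?thesis by (simp only: triple_sum)
qed

lemma sum_switch_antisymmetric:
  fixes f :: "(nat \<times> nat) set \<Rightarrow> nat \<Rightarrow> nat \<Rightarrow> real"
  assumes ab: "a \<noteq> b" "a < n" "b < n"
    and anti: "\<And>G v w. v \<in> surplus n F a b G \<Longrightarrow> w \<in> surplus n F b a G \<Longrightarrow> f (switch a b G v w) w v = - f G v w"
  shows "(\<Sum>G\<in>matrices n s t F Q. \<Sum>v\<in>surplus n F a b G. \<Sum>w\<in>surplus n F b a G. f G v w) = 0"
proof -
  let ?sum = "\<Sum>G\<in>matrices n s t F Q. \<Sum>v\<in>surplus n F a b G. \<Sum>w\<in>surplus n F b a G. f G v w"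
  have "?sum = (\<Sum>G\<in>matrices n s t F Q. \<Sum>v\<in>surplus n F a b G. \<Sum>w\<in>surplus n F b a G. - f G v w)"
    unfolding sum_switch[OF ab, of f] by (intro sum.cong refl anti)
  then show ?thesis by (simp add: sum_negf)
qed

lemma sum_surplus_exchange:
  assumes ab: "a \<noteq> b" "a < n" "b < n"
  shows "(\<Sum>G\<in>matrices n s t F Q. of_bool (v \<in> surplus n F a b G) * real (card (surplus n F b a G))
      / discordance n F a b G)
    = (\<Sum>G\<in>matrices n s t F Q. of_bool (v \<in> surplus n F b a G) * real (card (surplus n F a b G))
      / discordance n F a b G)"
proof -
  have eq: "(\<Sum>x\<in>surplus n F a b G. \<Sum>w\<in>surplus n F b a G. (of_bool (x = v) - of_bool (w = v)) / D)
    = of_bool (v \<in> surplus n F a b G) * real (card (surplus n F b a G)) / D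
      - of_bool (v \<in> surplus n F b a G) * real (card (surplus n F a b G)) / D" for G and D :: real
    by (simp add: sum_subtractf diff_divide_distrib flip: sum_divide_distrib)
  have "(\<Sum>G\<in>matrices n s t F Q. \<Sum>x\<in>surplus n F a b G. \<Sum>w\<in>surplus n F b a G.
      (of_bool (x = v) - of_bool (w = v)) / discordance n F a b G) = 0"
    by (rule sum_switch_antisymmetric[OF ab])
      (simp add: card_surplus_switch[OF ab(1)] flip: minus_divide_left)
  then show ?thesis unfolding eq by (simp add: sum_subtractf)
qed

lemma avg_row_difference:
  assumes ab: "a \<noteq> b" "a < n" "b < n" and v: "v < n" "(a,v) \<notin> F" "(b,v) \<notin> F"
  shows "avg (matrices n s t F Q) (\<lambda>G. of_bool ((a,v) \<in> G)) - avg (matrices n s t F Q) (\<lambda>G. of_bool ((b,v) \<in> G))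
    = avg (matrices n s t F Q) (\<lambda>G. differ a b v G * (imbalance n F a b G / discordance n F a b G))"
proof -
  let ?\<Omega> = "matrices n s t F Q"
  let ?A = "surplus n F a b" and ?B = "surplus n F b a"
  define D where "D G = discordance n F a b G" for G
  have pointwise: "of_bool ((a,v) \<in> G) - of_bool ((b,v) \<in> G) = differ a b v G * (imbalance n F a b G / D G)
      + 2 * (of_bool (v \<in> ?A G) * real (card (?B G)) / D G - of_bool (v \<in> ?B G) * real (card (?A G)) / D G)" for G
  proof (cases "((a,v) \<in> G) = ((b,v) \<in> G)")
    case False
    then have "D G > 0" using discordance_pos[OF v] by (simp add: D_def)
    then show ?thesis using False v by (auto simp: mem_surplus field_simps) (simp_all add: D_def algebra_simps)
  qed (auto simp: mem_surplus)
  have "(\<Sum>G\<in>?\<Omega>. of_bool ((a,v) \<in> G)) - (\<Sum>G\<in>?\<Omega>. of_bool ((b,v) \<in> G))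
    = (\<Sum>G\<in>?\<Omega>. of_bool ((a,v) \<in> G) - of_bool ((b,v) \<in> G) :: real)"
    by (rule sum_subtractf[symmetric])
  also have "\<dots> = (\<Sum>G\<in>?\<Omega>. differ a b v G * (imbalance n F a b G / D G))"
    unfolding pointwise sum.distrib sum_distrib_left[symmetric] sum_subtractf
    using sum_surplus_exchange[OF ab, where s = s and t = t and F = F and Q = Q and v = v] by (simp add: D_def)
  finally show ?thesis unfolding avg_def D_def by (simp only: flip: diff_divide_distrib)
qed

subsection \<open>Sizes of row differences\<close>

lemma card_split_frozen:
  assumes "X \<subseteq> {..<n}"
  shows "real (card X) = real (card (X \<inter> free_cols n F a b)) + real (card (X \<inter> frozen_cols F a b))"
proof -
  have "X \<inter> free_cols n F a b = X - frozen_cols F a b" using assms by (auto simp: free_cols_def)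
  then show ?thesis
    using card_Int_Diff[of X "frozen_cols F a b"] finite_subset[OF assms] by simp
qed

lemma card_surplus_Int:
  assumes "finite G"
  shows "real (card (surplus n F a b G \<inter> C)) =
    real (card (row G a \<inter> C \<inter> free_cols n F a b)) - real (card (row G a \<inter> row G b \<inter> C \<inter> free_cols n F a b))"
proof -
  let ?X = "row G a \<inter> C \<inter> free_cols n F a b"
  have "surplus n F a b G \<inter> C = ?X - row G b" "row G a \<inter> row G b \<inter> C \<inter> free_cols n F a b = ?X \<inter> row G b"
    by (auto simp: surplus_def)
  then show ?thesis using card_Int_Diff[of ?X "row G b"] by simp
qed

lemma card_surplus:
  assumes "G \<in> matrices n s t F' Q'" "a < n"
  shows "real (card (surplus n F a b G)) = real (s a) - real (card (row G a \<inter> frozen_cols F a b))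
     - real (card (row G a \<inter> row G b \<inter> free_cols n F a b))"
proof -
  have "row G a \<subseteq> {..<n}" using matricesD(1)[OF assms(1)] by auto
  then show ?thesis
    using card_surplus_Int[OF matricesD(3)[OF assms(1)], of n F a b UNIV] matricesD(4)[OF assms]
      card_split_frozen[of "row G a" n F a b] by simp
qed

lemma imbalance_eq:
  assumes "G \<in> matrices n s t F' Q'" "a < n" "b < n"
  shows "imbalance n F a b G = real (s a) - real (s b)
    - real (card (row G a \<inter> frozen_cols F a b)) + real (card (row G b \<inter> frozen_cols F a b))"
  using card_surplus[OF assms(1,2), of F b] card_surplus[OF assms(1,3), of F a]
  by (simp add: free_cols_commute[of n F a b] Un_commute[of "row F b" "row F a"] Int_commute[of "row G b" "row G a"])

lemma discordance_eq:
  assumes "G \<in> matrices n s t F' Q'" "a < n" "b < n"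
  shows "discordance n F a b G = real (s a) + real (s b)
    - real (card (row G a \<inter> frozen_cols F a b)) - real (card (row G b \<inter> frozen_cols F a b))
    - 2 * real (card (row G a \<inter> row G b \<inter> free_cols n F a b))"
  using card_surplus[OF assms(1,2), of F b] card_surplus[OF assms(1,3), of F a]
  by (simp add: free_cols_commute[of n F a b] Un_commute[of "row F b" "row F a"] Int_commute[of "row G b" "row G a"])

lemma card_Int_frozen_cols_le:
  assumes "finite F" shows "real (card (X \<inter> frozen_cols F a b)) \<le> real (card (frozen_cols F a b))"
  using assms by (simp add: card_mono finite_row)

lemma discordance_le:
  assumes "G \<in> matrices n s t F Q"
  shows "discordance n F a b G \<le> real n"
proof -
  have "card (surplus n F a b G) + card (surplus n F b a G) = card (surplus n F a b G \<union> surplus n F b a G)"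
    by (intro card_Un_disjoint[symmetric]) (auto simp: mem_surplus)
  also have "\<dots> \<le> card {..<n}" using surplus_subset by (intro card_mono) auto
  finally show ?thesis by simp
qed

lemma abs_imbalance_le:
  assumes "G \<in> matrices n s t F Q" "a < n" "b < n" "finite F"
  shows "\<bar>imbalance n F a b G\<bar> \<le> \<bar>real (s a) - real (s b)\<bar> + real (card (frozen_cols F a b))"
  using imbalance_eq[OF assms(1-3), of F] card_Int_frozen_cols_le[OF assms(4), of "row G a" a b]
    card_Int_frozen_cols_le[OF assms(4), of "row G b" a b] by linarith

subsection \<open>The fourth moment of a codegree difference\<close>

abbreviation imbalance_on :: "nat \<Rightarrow> (nat \<times> nat) set \<Rightarrow> nat \<Rightarrow> nat \<Rightarrow> nat set \<Rightarrow> (nat \<times> nat) set \<Rightarrow> real" where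
  "imbalance_on n F a b C G \<equiv> real (card (surplus n F a b G \<inter> C)) - real (card (surplus n F b a G \<inter> C))"

lemma codegree_diff_le:
  assumes G: "G \<in> matrices n s t F Q" and F: "finite F"
  shows "\<bar>(codegree G a c - codegree G b c) - imbalance_on n F a b (row G c) G\<bar>
    \<le> real (card (frozen_cols F a b))"
proof -
  let ?free = "free_cols n F a b"
  have sub: "row G a \<inter> row G c \<subseteq> {..<n}" "row G b \<inter> row G c \<subseteq> {..<n}"
    using matricesD(1)[OF G] by auto
  have "imbalance_on n F a b (row G c) G
    = real (card (row G a \<inter> row G c \<inter> ?free)) - real (card (row G b \<inter> row G c \<inter> ?free))"
    using card_surplus_Int[OF matricesD(3)[OF G]]
    by (simp add: free_cols_commute[of n F a b] Int_commute[of "row G b" "row G a"])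
  then show ?thesis
    using card_split_frozen[OF sub(1), of F a b] card_split_frozen[OF sub(2), of F a b]
      card_Int_frozen_cols_le[OF F, of "row G a \<inter> row G c" a b]
      card_Int_frozen_cols_le[OF F, of "row G b \<inter> row G c" a b] by linarith
qed

lemma card_exchange_Int:
  assumes "x \<in> A" "y \<notin> A" "finite A"
  shows "real (card (insert y (A - {x}) \<inter> C)) = real (card (A \<inter> C)) - of_bool (x \<in> C) + of_bool (y \<in> C)"
proof -
  have "insert y (A - {x}) \<inter> C = (if y \<in> C then insert y ((A \<inter> C) - {x}) else (A \<inter> C) - {x})"
    by auto
  moreover have "real (card ((A \<inter> C) - {x})) = real (card (A \<inter> C)) - of_bool (x \<in> C)"
    using assms card_Suc_Diff1[of "A \<inter> C" x] by (cases "x \<in> C") auto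
  ultimately show ?thesis using assms by auto
qed

lemma imbalance_on_switch:
  assumes "a \<noteq> b" "v \<in> surplus n F a b G" "w \<in> surplus n F b a G"
  shows "imbalance_on n F a b C (switch a b G v w)
    = imbalance_on n F a b C G - 2 * (of_bool (v \<in> C) - of_bool (w \<in> C))"
proof -
  have "v \<notin> surplus n F b a G" "w \<notin> surplus n F a b G" using assms by (auto simp: mem_surplus)
  then show ?thesis unfolding surplus_switch[OF assms] using assms by (simp add: card_exchange_Int)
qed

lemma cube_mult_le:
  fixes x u :: real
  assumes "x \<ge> 0" "u \<ge> 0"
  shows "x * u ^ 3 \<le> u ^ 4 / 4 + 7 * x ^ 4"
proof -
  have "u ^ 4 / 4 + 27 / 4 * x ^ 4 - x * u ^ 3 = (u - 3 * x)\<^sup>2 * ((u + x)\<^sup>2 + 2 * x\<^sup>2) / 4"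
    by (simp add: power2_eq_square power3_eq_cube power4_eq_xxxx algebra_simps)
  moreover have "\<dots> \<ge> 0" "x ^ 4 \<ge> 0" by simp_all
  ultimately show ?thesis by linarith
qed

lemma harmonic_mean_mult_quadratic_le:
  fixes \<alpha> \<beta> m u :: real
  assumes pos: "\<alpha> + \<beta> > 0" and m: "\<alpha> + \<beta> \<le> m" "1 \<le> m"
  shows "2 / (\<alpha> + \<beta>) * (\<alpha> * \<beta>) * (24 * u\<^sup>2 + 28) \<le> u ^ 4 + 50 * m\<^sup>2"
proof -
  have "4 * (\<alpha> * \<beta>) \<le> (\<alpha> + \<beta>) * (\<alpha> + \<beta>)"
    using sum_squares_bound[of \<alpha> \<beta>] by (simp add: power2_eq_square algebra_simps)
  also have "\<dots> \<le> m * (\<alpha> + \<beta>)" using m pos by (intro mult_right_mono) auto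
  finally have "2 / (\<alpha> + \<beta>) * (\<alpha> * \<beta>) \<le> m / 2" using pos by (simp add: field_simps)
  then have "2 / (\<alpha> + \<beta>) * (\<alpha> * \<beta>) * (24 * u\<^sup>2 + 28) \<le> m / 2 * (24 * u\<^sup>2 + 28)"
    by (rule mult_right_mono) simp
  also have "\<dots> \<le> u ^ 4 + 50 * m\<^sup>2"
  proof -
    have "m \<le> m\<^sup>2" using m(2) by (simp add: power2_eq_square)
    moreover have "12 * m * u\<^sup>2 \<le> u ^ 4 + 36 * m\<^sup>2"
      using zero_le_power2[of "u\<^sup>2 - 6 * m"] by (simp add: power2_eq_square power4_eq_xxxx algebra_simps)
    ultimately show ?thesis by (simp add: distrib_left)
  qed
  finally show ?thesis .
qed

lemma fourth_power_drift:
  fixes \<alpha> \<beta> p q N m :: real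
  assumes pq: "0 \<le> p" "p \<le> \<alpha>" "0 \<le> q" "q \<le> \<beta>" and m: "\<alpha> + \<beta> \<le> m" "1 \<le> m" and N: "\<bar>\<alpha> - \<beta>\<bar> \<le> N"
  defines "U \<equiv> p - q"
  shows "2 * U ^ 4 - 28 * N ^ 4 - 50 * m\<^sup>2
    \<le> 2 / (\<alpha> + \<beta>) * (4 * U ^ 3 * (\<beta> * p - \<alpha> * q) - \<alpha> * \<beta> * (24 * U\<^sup>2 + 28))"
proof (cases "\<alpha> + \<beta> = 0")
  case True
  then have "p = 0" "q = 0" using pq by linarith+
  then have "2 * U ^ 4 = 0" by (simp add: U_def)
  moreover have "0 \<le> N ^ 4" "0 \<le> m\<^sup>2" by simp_all
  ultimately have "2 * U ^ 4 - 28 * N ^ 4 - 50 * m\<^sup>2 \<le> 0" by linarith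
  then show ?thesis using True by simp
next
  case False
  then have pos: "\<alpha> + \<beta> > 0" using pq by linarith
  define y where "y = (\<alpha> - \<beta>) * ((p + q) / (\<alpha> + \<beta>))"
  have "\<bar>\<alpha> - \<beta>\<bar> * \<bar>(p + q) / (\<alpha> + \<beta>)\<bar> \<le> N * 1"
    using N pq pos by (intro mult_mono) (auto simp: abs_divide)
  then have "\<bar>y\<bar> \<le> N" by (simp add: y_def abs_mult)
  then have "U ^ 3 * y \<le> N * \<bar>U\<bar> ^ 3"
    using mult_mono[of "\<bar>U\<bar> ^ 3" "\<bar>U\<bar> ^ 3" "\<bar>y\<bar>" N] abs_ge_self[of "U ^ 3 * y"]
    by (simp add: abs_mult power_abs mult.commute)
  moreover have "N * \<bar>U\<bar> ^ 3 \<le> U ^ 4 / 4 + 7 * N ^ 4"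
    using cube_mult_le[of N "\<bar>U\<bar>"] N by simp
  ultimately have cubic: "4 * (U ^ 3 * y) \<le> U ^ 4 + 28 * N ^ 4" by linarith
  have quadratic: "2 / (\<alpha> + \<beta>) * (\<alpha> * \<beta>) * (24 * U\<^sup>2 + 28) \<le> U ^ 4 + 50 * m\<^sup>2"
    using pos m by (rule harmonic_mean_mult_quadratic_le)
  have linear: "2 / (\<alpha> + \<beta>) * (\<beta> * p - \<alpha> * q) = U - y"
    using pos by (simp add: y_def U_def field_simps)
  have distrib: "h * (k * z - w * e) = k * (h * z) - h * w * e" for h k z w e :: real
    by (simp add: algebra_simps)
  have "4 * U ^ 3 * (U - y) = 4 * U ^ 4 - 4 * (U ^ 3 * y)"
    by (simp add: power4_eq_xxxx power3_eq_cube algebra_simps)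
  then show ?thesis unfolding distrib[of _ "4 * U ^ 3" "\<beta> * p - \<alpha> * q" "\<alpha> * \<beta>"] linear
    using cubic quadratic by linarith
qed

lemma sum_of_bool_difference:
  fixes h k e :: real
  assumes "finite A" "finite B"
  shows "(\<Sum>v\<in>A. \<Sum>w\<in>B. h * (k * (of_bool (v \<in> C) - of_bool (w \<in> C)) - e))
    = h * (k * (real (card B) * real (card (A \<inter> C)) - real (card A) * real (card (B \<inter> C)))
        - real (card A) * real (card B) * e)"
proof -
  have "(\<Sum>v\<in>A. of_bool (v \<in> C)) = real (card (A \<inter> C))" "(\<Sum>w\<in>B. of_bool (w \<in> C)) = real (card (B \<inter> C))"
    using assms by simp_all
  then show ?thesis
    by (simp only: sum_subtractf sum_distrib_left[symmetric] sum_constant)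
      (simp add: sum_distrib_right[symmetric] algebra_simps)
qed

lemma switched_power4_ge:
  fixes u y :: real
  assumes "y = 1 \<or> y = 0 \<or> y = -1"
  shows "4 * u ^ 3 * y - (24 * u\<^sup>2 + 28) \<le> (u - (u - 2 * y)) * (u ^ 3 + (u - 2 * y) ^ 3)"
proof -
  have "12 * (u - 1)\<^sup>2 \<ge> 0" "12 * (u + 1)\<^sup>2 \<ge> 0" by simp_all
  then show ?thesis using assms by (auto simp: power2_eq_square power3_eq_cube algebra_simps)
qed

context
  fixes n :: nat and F :: "(nat \<times> nat) set" and a b c :: nat
  assumes ab: "a \<noteq> b" "a < n" "b < n" and c: "c \<noteq> a" "c \<noteq> b"
begin

abbreviation (input) U where "U G \<equiv> imbalance_on n F a b (row G c) G"

text \<open>Being antisymmetric under the switch, \<open>flow\<close> has mean zero; its sum over the switches of one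
  matrix is about \<open>2 * U^4\<close>, up to terms of order \<open>n * U^2\<close>.\<close>

abbreviation (input) flow where
  "flow G v w \<equiv> 2 / discordance n F a b G
    * ((U G - U (switch a b G v w)) * (U G ^ 3 + U (switch a b G v w) ^ 3))"

lemma sum_flow_ge:
  assumes G: "G \<in> matrices n s t F Q" and N: "\<bar>imbalance n F a b G\<bar> \<le> N"
  shows "2 * U G ^ 4 - 28 * N ^ 4 - 50 * (real n)\<^sup>2
    \<le> (\<Sum>v\<in>surplus n F a b G. \<Sum>w\<in>surplus n F b a G. flow G v w)"
proof -
  let ?A = "surplus n F a b G" and ?B = "surplus n F b a G"
  let ?\<alpha> = "real (card ?A)" and ?\<beta> = "real (card ?B)"
  let ?p = "real (card (?A \<inter> row G c))" and ?q = "real (card (?B \<inter> row G c))"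
  define x where "x v w = (of_bool (v \<in> row G c) - of_bool (w \<in> row G c) :: real)" for v w
  have "2 * U G ^ 4 - 28 * N ^ 4 - 50 * (real n)\<^sup>2
    \<le> 2 / discordance n F a b G * (4 * U G ^ 3 * (?\<beta> * ?p - ?\<alpha> * ?q) - ?\<alpha> * ?\<beta> * (24 * (U G)\<^sup>2 + 28))"
    using discordance_le[OF G] N ab by (intro fourth_power_drift) (auto intro: card_mono)
  also have "\<dots> = (\<Sum>v\<in>?A. \<Sum>w\<in>?B. 2 / discordance n F a b G * (4 * U G ^ 3 * x v w - (24 * (U G)\<^sup>2 + 28)))"
    by (simp only: x_def sum_of_bool_difference finite_surplus)
  also have "\<dots> \<le> (\<Sum>v\<in>?A. \<Sum>w\<in>?B. flow G v w)"
  proof (intro sum_mono)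
    fix v w assume vw: "v \<in> ?A" "w \<in> ?B"
    have "row (switch a b G v w) c = row G c" using c by (auto simp: switch_def)
    then have U_switch: "U (switch a b G v w) = U G - 2 * x v w"
      using imbalance_on_switch[OF ab(1) vw] by (simp add: x_def)
    show "2 / discordance n F a b G * (4 * U G ^ 3 * x v w - (24 * (U G)\<^sup>2 + 28)) \<le> flow G v w"
      unfolding U_switch by (intro mult_left_mono switched_power4_ge) (auto simp: x_def)
  qed
  finally show ?thesis .
qed

lemma avg_imbalance_on_power4_le:
  assumes nonempty: "matrices n s t F Q \<noteq> {}"
    and N: "\<And>G. G \<in> matrices n s t F Q \<Longrightarrow> \<bar>imbalance n F a b G\<bar> \<le> N"
  shows "avg (matrices n s t F Q) (\<lambda>G. imbalance_on n F a b (row G c) G ^ 4) \<le> 14 * N ^ 4 + 25 * (real n)\<^sup>2"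
proof -
  let ?\<Omega> = "matrices n s t F Q"
  have "(\<Sum>G\<in>?\<Omega>. 2 * U G ^ 4 - 28 * N ^ 4 - 50 * (real n)\<^sup>2)
    \<le> (\<Sum>G\<in>?\<Omega>. \<Sum>v\<in>surplus n F a b G. \<Sum>w\<in>surplus n F b a G. flow G v w)"
    by (rule sum_mono) (rule sum_flow_ge[OF _ N])
  also have "\<dots> = 0"
    by (rule sum_switch_antisymmetric[OF ab])
      (simp add: card_surplus_switch[OF ab(1)] switch_switch[OF ab(1)] algebra_simps)
  finally have "(\<Sum>G\<in>?\<Omega>. 2 * U G ^ 4 - 28 * N ^ 4 - 50 * (real n)\<^sup>2) \<le> 0" .
  then have "avg ?\<Omega> (\<lambda>G. 2 * U G ^ 4 - 28 * N ^ 4 - 50 * (real n)\<^sup>2) \<le> 0"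
    by (simp add: avg_def divide_nonpos_nonneg)
  then show ?thesis
    using nonempty by (simp add: avg_diff avg_cmult avg_const finite_matrices)
qed

end

subsection \<open>Concentration of codegrees\<close>

lemma power4_add_le: "(x + y) ^ 4 \<le> 8 * x ^ 4 + 8 * (y::real) ^ 4"
  using convex_onD[OF convex_power_even[of 4], of "1/2" x y]
  by (simp add: power_divide flip: add_divide_distrib)

lemma power4_le_of_abs:
  fixes x y z :: real
  assumes "\<bar>x\<bar> \<le> y + \<bar>z\<bar>" shows "x ^ 4 \<le> 8 * y ^ 4 + 8 * z ^ 4"
  using power_mono[OF assms, of 4] power4_add_le[of y "\<bar>z\<bar>"] by simp

lemma sum_codegree:
  assumes G: "G \<in> matrices n s t F Q" and c: "c < n"
  shows "(\<Sum>b\<in>{..<n}-{c}. codegree G b c) = (\<Sum>v\<in>row G c. real (t v)) - real (s c)"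
proof -
  define H where "H = {(b,v). (b,v) \<in> G \<and> (c,v) \<in> G}"
  note G' = matricesD[OF G]
  have H: "H \<subseteq> {..<n} \<times> {..<n}" using G'(1) by (auto simp: H_def)
  then have H_converse: "H\<inverse> \<subseteq> {..<n} \<times> {..<n}" by auto
  have row_H: "row H b = row G b \<inter> row G c" for b
    by (auto simp: H_def)
  have col_H: "card (col H v) = (if v \<in> row G c then t v else 0)" if "v < n" for v
  proof -
    have "col H v = (if v \<in> row G c then col G v else {})" by (auto simp: H_def)
    then show ?thesis using G'(5)[OF that] by simp
  qed
  have "(\<Sum>b<n. card (row G b \<inter> row G c)) = (\<Sum>v<n. card (col H v))"
    unfolding row_H[symmetric] using sum_card_row[OF H] sum_card_row[OF H_converse] by simp
  also have "\<dots> = (\<Sum>v<n. if v \<in> row G c then t v else 0)"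
    by (intro sum.cong) (auto simp: col_H)
  also have "\<dots> = (\<Sum>v\<in>row G c. t v)"
    using G'(1) by (subst sum.inter_restrict[symmetric]) (auto intro!: sum.cong)
  finally have "(\<Sum>b<n. codegree G b c) = (\<Sum>v\<in>row G c. real (t v))"
    by (simp flip: of_nat_sum)
  then show ?thesis using c G'(4)[OF c] by (simp add: sum_diff1)
qed

locale near_regular = scale \<theta> r for \<theta> r :: real +
  fixes n :: nat and s t :: "nat \<Rightarrow> nat" and l :: real
  assumes n_eq: "real n = r\<^sup>2"
    and l_ge: "1 / \<theta> \<le> l" and l_le: "l \<le> 1 - 1 / \<theta>"
    and s_dev: "a < n \<Longrightarrow> \<bar>real (s a) - l * real n\<bar> \<le> \<theta> * r"
    and t_dev: "a < n \<Longrightarrow> \<bar>real (t a) - l * real n\<bar> \<le> \<theta> * r"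
    and total_dev: "\<bar>(\<Sum>a<n. real (s a)) - l * (real n)\<^sup>2\<bar> \<le> \<theta> * real n"
    and sum_eq: "(\<Sum>a<n. s a) = (\<Sum>a<n. t a)"
begin

abbreviation Omega ("\<Omega>") where
  "\<Omega> \<equiv> matrices n s t"

abbreviation cell_prob where
  "cell_prob F Q a v \<equiv> avg (\<Omega> F Q) (\<lambda>G. of_bool ((a,v) \<in> G))"

abbreviation variance where
  "variance \<equiv> l * (1 - l)"

definition sparse :: "nat \<Rightarrow> (nat \<times> nat) set \<Rightarrow> bool" where
  "sparse m F \<longleftrightarrow> F \<subseteq> {..<n} \<times> {..<n} \<and> real (card F) \<le> \<theta> * real n + real m
    \<and> (\<forall>a<n. row_card F a \<le> \<theta> * r + real m \<and> col_card F a \<le> \<theta> * r + real m)"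

text \<open>The parameter \<open>k\<close> is the number of cells that have been frozen by conditioning; no argument
  conditions on more than ten cells.\<close>

definition admissible :: "nat \<Rightarrow> (nat \<times> nat) set \<Rightarrow> (nat \<times> nat) set \<Rightarrow> bool" where
  "admissible k F Q \<longleftrightarrow> k \<le> 10 \<and> sparse k F \<and> Q \<subseteq> F \<and> card Q \<le> k \<and> \<Omega> F Q \<noteq> {}"

lemma l_bounds: "0 < l" "l < 1"
proof -
  have "1 / \<theta> > 0" using theta_pos by simp
  then show "0 < l" "l < 1" using l_ge l_le by linarith+
qed

lemma n_ge: "real n \<ge> 10000 * r" "real n \<ge> 10000"
proof -
  show "real n \<ge> 10000 * r"
    using mult_right_mono[OF r_ge_10000, of r] r_pos by (simp add: n_eq power2_eq_square)
  then show "real n \<ge> 10000" using r_ge_10000 by linarith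
qed

lemma n_pos: "real n > 0" "real n \<noteq> 0" "n > 0"
  using n_ge by auto

lemma variance_ge: "variance \<ge> 1 / \<theta> / 2"
proof -
  have "variance - 1/\<theta> * (1 - 1/\<theta>) = (l - 1/\<theta>) * ((1 - 1/\<theta>) - l)" by (simp add: algebra_simps)
  also have "\<dots> \<ge> 0" using l_ge l_le by (intro mult_nonneg_nonneg) auto
  finally have "variance \<ge> 1/\<theta> * (1 - 1/\<theta>)" by linarith
  moreover have "1/\<theta> * (1/2) \<le> 1/\<theta> * (1 - 1/\<theta>)"
    using theta_ge by (intro mult_left_mono) (auto simp: field_simps)
  ultimately show ?thesis by simp
qed

lemma variance_pos: "variance > 0" "variance \<noteq> 0"
  using l_bounds by auto

lemma has_order_l [has_order_intros]:
  "has_order 0 0 l" "has_order 0 0 (1 - l)" "has_order 0 0 (1 - 2 * l)"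
  by (rule has_order_unit, use l_bounds in linarith)+

lemma has_order_inverse_l [has_order_intros]: "has_order 1 0 (inverse l)" "has_order 1 0 (inverse (1 - l))"
  using l_bounds l_ge l_le theta_pos by (auto simp: has_order_def field_simps)

lemma has_order_n [has_order_intros]: "has_order 0 2 (real n)"
  by (simp add: has_order_def n_eq)

lemma has_order_less_variance_n:
  assumes "has_order k 1 x" "k < 199"
  shows "\<bar>x\<bar> < variance * real n"
proof -
  have "4 * \<theta> ^ Suc k * r \<le> r * r" using assms(2) r_pos by (intro mult_right_mono mult_theta_power_le_r) auto
  then have "\<theta> * (4 * (\<theta> ^ k * r)) \<le> real n" by (simp add: n_eq power2_eq_square mult_ac)
  also have "\<dots> \<le> \<theta> * (2 * (variance * real n))"
    using mult_right_mono[OF variance_ge, of "real n"] theta_pos by (simp add: field_simps)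
  finally have "4 * (\<theta> ^ k * r) \<le> 2 * (variance * real n)"
    by (simp only: mult_le_cancel_left_pos[OF theta_pos(1)])
  moreover have "variance * real n > 0" using variance_pos n_pos by simp
  ultimately show ?thesis using has_orderD[OF assms(1)] unfolding power_int_1_right by linarith
qed

lemma has_order_less_complement_n:
  assumes "has_order k 1 x" "k < 199"
  shows "\<bar>x\<bar> < (1 - l) * real n"
proof -
  have "\<bar>x\<bar> < variance * real n" by (rule has_order_less_variance_n[OF assms])
  also have "\<dots> \<le> (1 - l) * real n" using l_bounds by (intro mult_right_mono) (auto simp: mult_left_le_one_le)
  finally show ?thesis .
qed

lemma has_order_inverse_n [has_order_intros]: "has_order 0 (-2) (inverse (real n))"
  using r_pos by (simp add: has_order_def n_eq power_int_minus)

lemma has_order_inverse_n_minus_1: "has_order 1 (-2) (inverse (real n - 1))"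
proof (rule has_order_dominated)
  show "has_order 1 (-2) (2 / real n)"
    by (rule has_order_mono, (rule has_order_intros | simp)+)
  show "\<bar>inverse (real n - 1)\<bar> \<le> 2 / real n" using n_ge by (simp add: field_simps)
qed

lemma has_order_s_dev: "a < n \<Longrightarrow> has_order 1 1 (real (s a) - l * real n)"
  and has_order_t_dev: "a < n \<Longrightarrow> has_order 1 1 (real (t a) - l * real n)"
  using s_dev t_dev by (simp_all add: has_order_def)

lemma has_order_s_diff:
  assumes "a < n" "b < n" shows "has_order 2 1 (real (s a) - real (s b))"
proof -
  have "has_order 2 1 ((real (s a) - l * real n) - (real (s b) - l * real n))"
    by (rule has_order_mono, (rule has_order_s_dev assms has_order_intros | simp)+)
  then show ?thesis by simp
qed

lemma sparseD:
  assumes "sparse m F"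
  shows "F \<subseteq> {..<n} \<times> {..<n}" "finite F" "real (card F) \<le> \<theta> * real n + real m"
    "a < n \<Longrightarrow> row_card F a \<le> \<theta> * r + real m" "a < n \<Longrightarrow> col_card F a \<le> \<theta> * r + real m"
  using assms by (auto simp: sparse_def intro: finite_subset[of F "{..<n} \<times> {..<n}"])

lemma admissibleD:
  assumes "admissible k F Q"
  shows "k \<le> 10" "sparse k F" "Q \<subseteq> F" "card Q \<le> k" "\<Omega> F Q \<noteq> {}" "sparse 10 F" "finite F" "finite Q"
proof -
  show adm: "k \<le> 10" "sparse k F" "Q \<subseteq> F" "card Q \<le> k" "\<Omega> F Q \<noteq> {}"
    using assms by (auto simp: admissible_def)
  show "sparse 10 F" using adm by (fastforce simp: sparse_def)
  show "finite F" "finite Q" using sparseD(2)[OF adm(2)] adm(3) finite_subset by auto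
qed

lemma has_order_row_card:
  assumes "sparse 10 F" "a < n"
  shows "has_order 2 1 (row_card F a)" "has_order 2 1 (col_card F a)"
proof -
  have bound: "has_order 2 1 (\<theta> * r + 10)"
    by (rule has_order_mono, (rule has_order_intros | simp)+)
  show "has_order 2 1 (row_card F a)" "has_order 2 1 (col_card F a)"
    using sparseD(4,5)[OF assms] by (auto intro: has_order_dominated[OF bound])
qed

lemma has_order_card:
  assumes "sparse 10 F" shows "has_order 2 2 (real (card F))"
proof (rule has_order_dominated)
  show "has_order 2 2 (\<theta> * real n + 10)"
    by (rule has_order_mono, (rule has_order_intros | simp)+)
qed (use sparseD(3)[OF assms] in simp)

lemma has_order_card_frozen_cols:
  assumes "sparse 10 F" "a < n" "b < n"
  shows "has_order 3 1 (real (card (frozen_cols F a b)))"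
proof (rule has_order_dominated)
  show "has_order 3 1 (row_card F a + row_card F b)"
    by (rule has_order_mono, (rule has_order_row_card assms has_order_intros | simp)+)
  show "\<bar>real (card (frozen_cols F a b))\<bar> \<le> row_card F a + row_card F b"
    using card_Un_le[of "row F a" "row F b"] by linarith
qed

lemma has_order_imbalance:
  assumes "admissible k F Q" "a < n" "b < n" "G \<in> \<Omega> F Q"
  shows "has_order 4 1 (imbalance n F a b G)"
proof (rule has_order_dominated[OF _ abs_imbalance_le[OF assms(4,2,3) admissibleD(7)[OF assms(1)]]])
  show "has_order 4 1 (\<bar>real (s a) - real (s b)\<bar> + real (card (frozen_cols F a b)))"
    by (rule has_order_mono, (rule has_order_s_diff assms has_order_card_frozen_cols[OF admissibleD(6)[OF assms(1)]]
        has_order_intros | simp)+)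
qed

lemma has_order_codegree_diff_power4:
  assumes adm: "admissible k F Q" and ab: "a < n" "b < n" and c: "c \<noteq> a" "c \<noteq> b"
  shows "has_order 22 4 (avg (\<Omega> F Q) (\<lambda>G. (codegree G a c - codegree G b c) ^ 4))"
proof (cases "a = b")
  case True
  then show ?thesis using theta_pos r_pos by (simp add: avg_def has_order_def)
next
  case False
  note adm' = admissibleD[OF adm]
  let ?U = "imbalance_on n F a b"
  let ?u = "real (card (frozen_cols F a b))"
  have "has_order 19 4 (14 * (\<theta> ^ 4 * r) ^ 4 + 25 * (real n)\<^sup>2)"
    by (rule has_order_mono, (rule has_order_intros | simp)+)
  then have U4: "has_order 19 4 (avg (\<Omega> F Q) (\<lambda>G. ?U (row G c) G ^ 4))"
  proof (rule has_order_dominated)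
    have "avg (\<Omega> F Q) (\<lambda>G. ?U (row G c) G ^ 4) \<le> 14 * (\<theta> ^ 4 * r) ^ 4 + 25 * (real n)\<^sup>2"
      using ab c False adm'(5) has_orderD[OF has_order_imbalance[OF adm ab]]
      by (intro avg_imbalance_on_power4_le) auto
    then show "\<bar>avg (\<Omega> F Q) (\<lambda>G. ?U (row G c) G ^ 4)\<bar> \<le> 14 * (\<theta> ^ 4 * r) ^ 4 + 25 * (real n)\<^sup>2"
      by (simp add: avg_nonneg)
  qed
  show ?thesis
  proof (rule has_order_avg_dominated)
    fix G assume G: "G \<in> \<Omega> F Q"
    show "\<bar>(codegree G a c - codegree G b c) ^ 4\<bar> \<le> 8 * ?u ^ 4 + 8 * ?U (row G c) G ^ 4"
      using power4_le_of_abs[of "codegree G a c - codegree G b c" ?u "?U (row G c) G"]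
        codegree_diff_le[OF G adm'(7), of a c b] by simp
  next
    show "has_order 22 4 (avg (\<Omega> F Q) (\<lambda>G. 8 * ?u ^ 4 + 8 * ?U (row G c) G ^ 4))"
      unfolding avg_add avg_cmult avg_const[OF finite_matrices adm'(5)]
      by (rule has_order_mono, (rule U4 has_order_card_frozen_cols[OF adm'(6) ab] has_order_intros | simp)+)
  qed
qed

lemma has_order_avg_codegree:
  assumes G: "G \<in> \<Omega> F Q" and c: "c < n"
  shows "has_order 4 1 (avg ({..<n} - {c}) (\<lambda>b. codegree G b c) - l\<^sup>2 * real n)"
proof -
  note G' = matricesD[OF G]
  have row: "row G c \<subseteq> {..<n}" "card (row G c) = s c" using G' c by auto
  then have "s c \<le> n" using card_mono[of "{..<n}" "row G c"] by simp
  then have s_order: "has_order 0 2 (real (s c))" by (intro has_order_dominated[OF has_order_n]) simp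
  have "avg ({..<n} - {c}) (\<lambda>b. codegree G b c) - l\<^sup>2 * real n
    = ((\<Sum>v\<in>row G c. real (t v)) - real (s c)) / (real n - 1) - l\<^sup>2 * real n"
    unfolding avg_def sum_codegree[OF G c] using c by (simp add: of_nat_diff)
  also have "\<dots> = ((\<Sum>v\<in>row G c. real (t v) - l * real n) + l * real n * (real (s c) - l * real n)
      + (l * l * real n - real (s c))) / (real n - 1)"
    using n_ge row(2) by (simp add: sum_subtractf field_simps power2_eq_square)
  finally have eq: "avg ({..<n} - {c}) (\<lambda>b. codegree G b c) - l\<^sup>2 * real n = \<dots>" .
  have sum_order: "has_order (1 + 0) (1 + 2) (\<Sum>v\<in>row G c. real (t v) - l * real n)"
    using row s_order by (intro has_order_sum has_order_t_dev) auto
  show ?thesis unfolding eq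
    by (rule has_order_mono, (rule sum_order has_order_s_dev has_order_inverse_n_minus_1 s_order c
      has_order_intros | simp)+)
qed

lemma has_order_codegree_power4:
  assumes adm: "admissible k F Q" and a: "a < n" and c: "c < n" "c \<noteq> a"
  shows "has_order 24 4 (avg (\<Omega> F Q) (\<lambda>G. (codegree G a c - l\<^sup>2 * real n) ^ 4))"
proof -
  let ?I = "{..<n} - {c}"
  have I: "finite ?I" "?I \<noteq> {}" using a c by auto
  show ?thesis
  proof (rule has_order_avg_dominated)
    fix G assume G: "G \<in> \<Omega> F Q"
    define x where "x = avg ?I (\<lambda>b. codegree G a c - codegree G b c)"
    have "codegree G a c - l\<^sup>2 * real n = x + (avg ?I (\<lambda>b. codegree G b c) - l\<^sup>2 * real n)"
      unfolding x_def avg_diff by (subst avg_const[OF I]) simp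
    then have "\<bar>codegree G a c - l\<^sup>2 * real n\<bar> \<le> \<theta> ^ 4 * r + \<bar>x\<bar>"
      using has_orderD[OF has_order_avg_codegree[OF G c(1)]] by simp
    then have "(codegree G a c - l\<^sup>2 * real n) ^ 4 \<le> 8 * (\<theta> ^ 4 * r) ^ 4 + 8 * x ^ 4"
      by (rule power4_le_of_abs)
    also have "x ^ 4 \<le> avg ?I (\<lambda>b. (codegree G a c - codegree G b c) ^ 4)"
      unfolding x_def using I by (intro avg_power_even_le) auto
    finally show "\<bar>(codegree G a c - l\<^sup>2 * real n) ^ 4\<bar>
      \<le> 8 * (\<theta> ^ 4 * r) ^ 4 + 8 * avg ?I (\<lambda>b. (codegree G a c - codegree G b c) ^ 4)" by simp
  next
    have moments: "has_order 22 4 (avg ?I (\<lambda>b. avg (\<Omega> F Q) (\<lambda>G. (codegree G a c - codegree G b c) ^ 4)))"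
      using a c by (intro has_order_avg has_order_codegree_diff_power4[OF adm]) auto
    show "has_order 24 4 (avg (\<Omega> F Q) (\<lambda>G. 8 * (\<theta> ^ 4 * r) ^ 4
        + 8 * avg ?I (\<lambda>b. (codegree G a c - codegree G b c) ^ 4)))"
      unfolding avg_add avg_cmult avg_const[OF finite_matrices admissibleD(5)[OF adm]] avg_swap[of "\<Omega> F Q" ?I]
      by (rule has_order_mono, (rule moments has_order_intros | simp)+)
  qed
qed

lemma discordance_dev_le:
  assumes "G \<in> \<Omega> F Q" "a < n" "b < n" "finite F"
  shows "\<bar>discordance n F a b G - 2 * variance * real n\<bar>
    \<le> \<bar>real (s a) - l * real n\<bar> + \<bar>real (s b) - l * real n\<bar> + 2 * real (card (frozen_cols F a b))
      + \<bar>2 * (codegree G a b - l\<^sup>2 * real n)\<bar>"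
proof -
  let ?U = "frozen_cols F a b"
  have "row G a \<inter> row G b \<subseteq> {..<n}" using matricesD(1)[OF assms(1)] by auto
  from card_split_frozen[OF this, of F a b]
  have "discordance n F a b G - 2 * variance * real n = (real (s a) - l * real n) + (real (s b) - l * real n)
    - 2 * (codegree G a b - l\<^sup>2 * real n) + (2 * real (card (row G a \<inter> row G b \<inter> ?U))
      - real (card (row G a \<inter> ?U)) - real (card (row G b \<inter> ?U)))"
    unfolding discordance_eq[OF assms(1-3)] by (simp add: power2_eq_square algebra_simps)
  moreover have "real (card (X \<inter> ?U)) \<le> real (card ?U)" for X
    by (rule card_Int_frozen_cols_le[OF assms(4)])
  note this[of "row G a"] this[of "row G b"] this[of "row G a \<inter> row G b"]
  ultimately show ?thesis by linarith
qed

lemma has_order_discordance_power4: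
  assumes adm: "admissible k F Q" and ab: "a < n" "b < n" "a \<noteq> b" and D: "has_order 6 1 (D - 2 * variance * real n)"
  shows "has_order 40 4 (avg (\<Omega> F Q) (\<lambda>G. (D - discordance n F a b G) ^ 4))"
proof (rule has_order_avg_dominated)
  note adm' = admissibleD[OF adm]
  let ?e = "\<bar>D - 2 * variance * real n\<bar> + \<bar>real (s a) - l * real n\<bar> + \<bar>real (s b) - l * real n\<bar>
    + 2 * real (card (frozen_cols F a b))"
  show "\<bar>(D - discordance n F a b G) ^ 4\<bar> \<le> 8 * ?e ^ 4 + 8 * 16 * (codegree G a b - l\<^sup>2 * real n) ^ 4"
    if G: "G \<in> \<Omega> F Q" for G
  proof -
    have "(D - discordance n F a b G) ^ 4 \<le> 8 * ?e ^ 4 + 8 * (2 * (codegree G a b - l\<^sup>2 * real n)) ^ 4"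
      using discordance_dev_le[OF G ab(1,2) adm'(7)] by (intro power4_le_of_abs) linarith
    then show ?thesis unfolding power_mult_distrib by simp
  qed
  have E: "has_order 9 1 ?e"
    by (rule has_order_mono, (rule D has_order_s_dev ab has_order_card_frozen_cols[OF adm'(6) ab(1,2)]
      has_order_intros | simp)+)
  have M: "has_order 24 4 (avg (\<Omega> F Q) (\<lambda>G. (codegree G a b - l\<^sup>2 * real n) ^ 4))"
    using has_order_codegree_power4[OF adm ab(1,2)] ab(3) by simp
  show "has_order 40 4 (avg (\<Omega> F Q) (\<lambda>G. 8 * ?e ^ 4 + 8 * 16 * (codegree G a b - l\<^sup>2 * real n) ^ 4))"
    unfolding avg_add avg_cmult avg_const[OF finite_matrices adm'(5)]
    by (rule has_order_mono, (rule E M has_order_intros | simp)+)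
qed

end

subsection \<open>Expansion of the row difference\<close>

lemma ratio_expansion_le:
  fixes \<alpha> \<beta> B D :: real
  assumes nonneg: "\<alpha> \<ge> 0" "\<beta> \<ge> 0" and pos: "\<alpha> + \<beta> > 0" and B: "\<bar>\<alpha> - \<beta>\<bar> \<le> B" and D: "D > 0"
  shows "\<bar>(\<alpha> - \<beta>) / (\<alpha> + \<beta>) - ((\<alpha> - \<beta>) / D + (\<alpha> - \<beta>) * (D - (\<alpha> + \<beta>)) / D\<^sup>2)\<bar>
    \<le> 2 * B / D ^ 3 * (D - (\<alpha> + \<beta>))\<^sup>2 + 4 / D ^ 4 * (D - (\<alpha> + \<beta>)) ^ 4"
proof -
  define W where "W = D - (\<alpha> + \<beta>)"
  have remainder: "(\<alpha> - \<beta>) / (\<alpha> + \<beta>) - ((\<alpha> - \<beta>) / D + (\<alpha> - \<beta>) * W / D\<^sup>2) = ((\<alpha> - \<beta>) / (\<alpha> + \<beta>)) * (W\<^sup>2 / D\<^sup>2)"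
  proof -
    have "x / y - (x / D + x * (D - y) / D\<^sup>2) = (x / y) * ((D - y)\<^sup>2 / D\<^sup>2)" if "y > 0" for x y
      using that D by (simp add: field_simps power2_eq_square)
    then show ?thesis unfolding W_def using pos by blast
  qed
  have terms_nonneg: "0 \<le> 2 * B / D ^ 3 * W\<^sup>2" "0 \<le> 4 / D ^ 4 * W ^ 4" using B D by simp_all
  have "\<bar>(\<alpha> - \<beta>) / (\<alpha> + \<beta>)\<bar> * (W\<^sup>2 / D\<^sup>2) \<le> 2 * B / D ^ 3 * W\<^sup>2 + 4 / D ^ 4 * W ^ 4"
  proof (cases "\<alpha> + \<beta> \<ge> D / 2")
    case True
    have "\<bar>\<alpha> - \<beta>\<bar> / (\<alpha> + \<beta>) \<le> B / (D / 2)" using B D True by (intro frac_le) auto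
    then have "\<bar>(\<alpha> - \<beta>) / (\<alpha> + \<beta>)\<bar> * (W\<^sup>2 / D\<^sup>2) \<le> B / (D / 2) * (W\<^sup>2 / D\<^sup>2)"
      using pos by (intro mult_right_mono) (auto simp: abs_divide)
    also have "\<dots> = 2 * B / D ^ 3 * W\<^sup>2" by (simp add: power3_eq_cube power2_eq_square mult_ac)
    finally show ?thesis using terms_nonneg by linarith
  next
    case False
    have "\<bar>(\<alpha> - \<beta>) / (\<alpha> + \<beta>)\<bar> \<le> 1" using nonneg pos by (auto simp: abs_divide divide_simps)
    moreover have "1 \<le> (2 * W / D)\<^sup>2" using False D by (intro one_le_power) (auto simp: W_def field_simps)
    ultimately have "\<bar>(\<alpha> - \<beta>) / (\<alpha> + \<beta>)\<bar> * (W\<^sup>2 / D\<^sup>2) \<le> (2 * W / D)\<^sup>2 * (W\<^sup>2 / D\<^sup>2)"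
      by (intro mult_right_mono) auto
    also have "\<dots> = 4 / D ^ 4 * W ^ 4"
      by (simp add: power_divide power_mult_distrib power4_eq_xxxx power2_eq_square)
    finally show ?thesis using terms_nonneg by linarith
  qed
  then show ?thesis unfolding W_def[symmetric] remainder by (simp add: abs_mult)
qed

context near_regular begin

context
  fixes k :: nat and F Q :: "(nat \<times> nat) set" and a b :: nat and D :: real
  assumes adm: "admissible k F Q" and ab: "a < n" "b < n" "a \<noteq> b"
    and D: "has_order 6 1 (D - 2 * variance * real n)"
begin

lemma denominator_pos: "D > 0"
  and has_order_inverse_denominator: "has_order 2 (-2) (inverse D)"
proof -
  have "\<bar>D - 2 * variance * real n\<bar> < variance * real n" by (rule has_order_less_variance_n[OF D]) simp
  moreover have "real n / \<theta> / 2 \<le> variance * real n"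
    using mult_right_mono[OF variance_ge, of "real n"] by simp
  ultimately have D_ge: "D \<ge> real n / \<theta> / 2" by linarith
  have pos: "real n / \<theta> / 2 > 0" using n_pos theta_pos by simp
  then show D_pos: "D > 0" using D_ge by linarith
  have "inverse D \<le> inverse (real n / \<theta> / 2)" using D_ge pos by (intro le_imp_inverse_le)
  then have "\<bar>inverse D\<bar> \<le> 2 * \<theta> / real n" using D_pos by (simp add: mult.commute)
  moreover have "has_order 2 (-2) (2 * \<theta> / real n)"
    by (rule has_order_mono, (rule has_order_intros | simp)+)
  ultimately show "has_order 2 (-2) (inverse D)" using has_order_dominated by blast
qed

lemma has_order_discordance_power2: "has_order 20 2 (avg (\<Omega> F Q) (\<lambda>G. (D - discordance n F a b G)\<^sup>2))"
proof (rule has_order_of_power)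
  show "has_order (20 * 2) (2 * int 2) ((avg (\<Omega> F Q) (\<lambda>G. (D - discordance n F a b G)\<^sup>2))\<^sup>2)"
  proof (rule has_order_dominated)
    show "has_order (20 * 2) (2 * int 2) (avg (\<Omega> F Q) (\<lambda>G. (D - discordance n F a b G) ^ 4))"
      using has_order_discordance_power4[OF adm ab D] by simp
    show "\<bar>(avg (\<Omega> F Q) (\<lambda>G. (D - discordance n F a b G)\<^sup>2))\<^sup>2\<bar>
      \<le> avg (\<Omega> F Q) (\<lambda>G. (D - discordance n F a b G) ^ 4)"
      using avg_power_even_le[of 2 "\<Omega> F Q" "\<lambda>G. (D - discordance n F a b G)\<^sup>2"] admissibleD(5)[OF adm]
      by (simp add: finite_matrices)
  qed
qed simp

lemma has_order_discordance_abs: "has_order 10 1 (avg (\<Omega> F Q) (\<lambda>G. \<bar>D - discordance n F a b G\<bar>))"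
proof (rule has_order_of_power)
  show "has_order (10 * 2) (1 * int 2) ((avg (\<Omega> F Q) (\<lambda>G. \<bar>D - discordance n F a b G\<bar>))\<^sup>2)"
  proof (rule has_order_dominated)
    show "has_order (10 * 2) (1 * int 2) (avg (\<Omega> F Q) (\<lambda>G. (D - discordance n F a b G)\<^sup>2))"
      using has_order_discordance_power2 by simp
    show "\<bar>(avg (\<Omega> F Q) (\<lambda>G. \<bar>D - discordance n F a b G\<bar>))\<^sup>2\<bar>
      \<le> avg (\<Omega> F Q) (\<lambda>G. (D - discordance n F a b G)\<^sup>2)"
      using avg_power_even_le[of 2 "\<Omega> F Q" "\<lambda>G. \<bar>D - discordance n F a b G\<bar>"] admissibleD(5)[OF adm]
      by (simp add: finite_matrices)
  qed
qed simp

lemma has_order_avg_differ_imbalance: "has_order 4 1 (avg (\<Omega> F Q) (\<lambda>G. differ a b v G * imbalance n F a b G))"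
proof (rule has_order_avg)
  fix G assume "G \<in> \<Omega> F Q"
  then have "has_order 4 1 (imbalance n F a b G)" by (rule has_order_imbalance[OF adm ab(1,2)])
  then show "has_order 4 1 (differ a b v G * imbalance n F a b G)"
    using theta_pos r_pos by (auto simp: has_order_def)
qed

lemma has_order_avg_differ_imbalance_deviation:
  "has_order 14 2 (avg (\<Omega> F Q) (\<lambda>G. differ a b v G * (imbalance n F a b G * (D - discordance n F a b G))))"
proof (rule has_order_avg_dominated)
  show "has_order 14 2 (avg (\<Omega> F Q) (\<lambda>G. \<theta> ^ 4 * r * \<bar>D - discordance n F a b G\<bar>))"
    unfolding avg_cmult by (rule has_order_mono, (rule has_order_discordance_abs has_order_intros | simp)+)
  fix G assume G: "G \<in> \<Omega> F Q"
  have "\<bar>differ a b v G * (imbalance n F a b G * (D - discordance n F a b G))\<bar>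
    \<le> \<bar>imbalance n F a b G\<bar> * \<bar>D - discordance n F a b G\<bar>" by (simp add: abs_mult)
  also have "\<dots> \<le> \<theta> ^ 4 * r * \<bar>D - discordance n F a b G\<bar>"
    using has_orderD[OF has_order_imbalance[OF adm ab(1,2) G]] by (intro mult_right_mono) auto
  finally show "\<bar>differ a b v G * (imbalance n F a b G * (D - discordance n F a b G))\<bar>
    \<le> \<theta> ^ 4 * r * \<bar>D - discordance n F a b G\<bar>" .
qed

lemma cell_prob_diff_expansion:
  assumes v: "v < n" "(a,v) \<notin> F" "(b,v) \<notin> F"
  shows "has_order 50 (-3) (cell_prob F Q a v - cell_prob F Q b v
    - (avg (\<Omega> F Q) (\<lambda>G. differ a b v G * imbalance n F a b G) / D
      + avg (\<Omega> F Q) (\<lambda>G. differ a b v G * (imbalance n F a b G * (D - discordance n F a b G))) / D\<^sup>2))"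
proof -
  let ?B = "\<theta> ^ 4 * r"
  define T where "T G = (imbalance n F a b G / D
    + imbalance n F a b G * (D - discordance n F a b G) / D\<^sup>2)" for G
  have "cell_prob F Q a v - cell_prob F Q b v
    - (avg (\<Omega> F Q) (\<lambda>G. differ a b v G * imbalance n F a b G) / D
      + avg (\<Omega> F Q) (\<lambda>G. differ a b v G * (imbalance n F a b G * (D - discordance n F a b G))) / D\<^sup>2)
    = avg (\<Omega> F Q) (\<lambda>G. differ a b v G * (imbalance n F a b G / discordance n F a b G - T G))"
    unfolding avg_row_difference[OF ab(3,1,2) v] T_def divide_inverse
    by (simp only: mult.commute[of _ "inverse D"] mult.commute[of _ "inverse (D\<^sup>2)"] avg_cmult[symmetric]
        avg_add[symmetric] avg_diff[symmetric]) (simp add: algebra_simps)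
  moreover have "has_order 50 (-3) \<dots>"
  proof (rule has_order_avg_dominated)
    show "has_order 50 (-3) (avg (\<Omega> F Q) (\<lambda>G. 2 * ?B / D ^ 3 * (D - discordance n F a b G)\<^sup>2
        + 4 / D ^ 4 * (D - discordance n F a b G) ^ 4))"
      unfolding avg_add avg_cmult
      by (rule has_order_mono, (rule has_order_discordance_power2 has_order_discordance_power4[OF adm ab D]
          has_order_inverse_denominator has_order_intros | simp)+)
    fix G assume G: "G \<in> \<Omega> F Q"
    show "\<bar>differ a b v G * (imbalance n F a b G / discordance n F a b G - T G)\<bar>
      \<le> 2 * ?B / D ^ 3 * (D - discordance n F a b G)\<^sup>2 + 4 / D ^ 4 * (D - discordance n F a b G) ^ 4"
    proof (cases "((a,v) \<in> G) \<noteq> ((b,v) \<in> G)")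
      case True
      have "\<bar>imbalance n F a b G / discordance n F a b G - T G\<bar>
        \<le> 2 * ?B / D ^ 3 * (D - discordance n F a b G)\<^sup>2 + 4 / D ^ 4 * (D - discordance n F a b G) ^ 4"
        unfolding T_def using discordance_pos[OF v True] has_orderD[OF has_order_imbalance[OF adm ab(1,2) G]]
        by (intro ratio_expansion_le denominator_pos) auto
      then show ?thesis using True by simp
    next
      case False
      then show ?thesis using theta_pos r_pos denominator_pos by simp
    qed
  qed
  ultimately show ?thesis by (simp only:)
qed

end

lemma cell_prob_diff_rough:
  assumes adm: "admissible k F Q" and ab: "a < n" "b < n" and v: "v < n" "(a,v) \<notin> F" "(b,v) \<notin> F"
  shows "has_order 8 (-1) (cell_prob F Q a v - cell_prob F Q b v)"
proof (cases "a = b")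
  case False
  let ?D = "2 * variance * real n"
  let ?main = "avg (\<Omega> F Q) (\<lambda>G. differ a b v G * imbalance n F a b G)"
  let ?deviation = "avg (\<Omega> F Q) (\<lambda>G. differ a b v G * (imbalance n F a b G * (?D - discordance n F a b G)))"
  let ?error = "cell_prob F Q a v - cell_prob F Q b v - (?main / ?D + ?deviation / ?D\<^sup>2)"
  have D: "has_order 6 1 (?D - ?D)" using theta_pos r_pos by (simp add: has_order_def)
  note ctxt = adm ab False D
  have "has_order 6 (-1) (?main / ?D)"
    by (rule has_order_mono, (rule has_order_avg_differ_imbalance[OF ctxt]
      has_order_inverse_denominator[OF ctxt] has_order_intros | simp)+)
  moreover have "has_order 22 (-2) (?deviation / ?D\<^sup>2)"
    by (rule has_order_mono, (rule has_order_avg_differ_imbalance_deviation[OF ctxt]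
      has_order_inverse_denominator[OF ctxt] has_order_intros | simp)+)
  then have "has_order 6 (-1) (?deviation / ?D\<^sup>2)" by (rule has_order_absorb) simp_all
  moreover have "has_order 6 (-1) ?error"
    by (rule has_order_absorb[OF cell_prob_diff_expansion[OF ctxt v]]) simp_all
  ultimately have "has_order 8 (-1) (?error + (?main / ?D + ?deviation / ?D\<^sup>2))"
    by - (rule has_order_mono, (rule has_order_add | assumption | simp)+)
  then show ?thesis by simp
qed (use theta_pos r_pos in \<open>simp add: has_order_def\<close>)

subsection \<open>Averaging over a column\<close>

text \<open>For \<open>F\<close> the diagonal together with \<open>H\<close>, these are the deviations \<open>\<delta>\<close> and \<open>\<eta>\<close> of the theorem,
  up to the contribution of the diagonal.\<close>

definition row_excess :: "(nat \<times> nat) set \<Rightarrow> nat \<Rightarrow> real" where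
  "row_excess F a = real (s a) - l * real n + l * row_card F a"

definition col_excess :: "(nat \<times> nat) set \<Rightarrow> nat \<Rightarrow> real" where
  "col_excess F v = real (t v) - l * real n + l * col_card F v"

definition total_excess :: "(nat \<times> nat) set \<Rightarrow> real" where
  "total_excess F = (\<Sum>a<n. real (s a)) - l * (real n)\<^sup>2 + l * real (card F)"

definition free_rows :: "(nat \<times> nat) set \<Rightarrow> nat \<Rightarrow> nat set" where
  "free_rows F v = {..<n} - col F v"

lemma has_order_row_excess: "sparse 10 F \<Longrightarrow> a < n \<Longrightarrow> has_order 3 1 (row_excess F a)"
  unfolding row_excess_def
  by (rule has_order_mono, (rule has_order_s_dev has_order_row_card has_order_intros | simp)+)

lemma has_order_col_excess: "sparse 10 F \<Longrightarrow> v < n \<Longrightarrow> has_order 3 1 (col_excess F v)"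
  unfolding col_excess_def
  by (rule has_order_mono, (rule has_order_t_dev has_order_row_card has_order_intros | simp)+)

lemma has_order_total_excess:
  assumes "sparse 10 F" shows "has_order 3 2 (total_excess F)"
proof -
  have "has_order 1 2 ((\<Sum>a<n. real (s a)) - l * (real n)\<^sup>2)"
    using total_dev by (simp add: has_order_def n_eq)
  then show ?thesis unfolding total_excess_def
    by - (rule has_order_mono, (assumption | rule has_order_card[OF assms] has_order_intros | simp)+)
qed

lemma sum_excess:
  assumes "F \<subseteq> {..<n} \<times> {..<n}"
  shows "(\<Sum>a<n. row_excess F a) = total_excess F" "(\<Sum>v<n. col_excess F v) = total_excess F"
proof -
  have "F\<inverse> \<subseteq> {..<n} \<times> {..<n}" using assms by auto
  then have "(\<Sum>a<n. row_card F a) = real (card F)" "(\<Sum>v<n. col_card F v) = real (card F)"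
    using sum_card_row[OF assms] sum_card_row[of "F\<inverse>" n] by (simp_all flip: of_nat_sum)
  moreover have "(\<Sum>a<n. real (t a)) = (\<Sum>a<n. real (s a))"
    using sum_eq by (simp flip: of_nat_sum)
  ultimately show "(\<Sum>a<n. row_excess F a) = total_excess F" "(\<Sum>v<n. col_excess F v) = total_excess F"
    by (simp_all add: row_excess_def col_excess_def total_excess_def sum.distrib sum_subtractf
        power2_eq_square mult_ac flip: sum_distrib_left)
qed

lemma card_free_rows:
  assumes "F \<subseteq> {..<n} \<times> {..<n}"
  shows "real (card (free_rows F v)) = real n - col_card F v"
proof -
  have sub: "col F v \<subseteq> {..<n}" using assms by auto
  then have "card (col F v) \<le> n" using card_mono[of "{..<n}" "col F v"] by simp
  then show ?thesis
    using sub by (simp add: free_rows_def card_Diff_subset finite_subset of_nat_diff)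
qed

lemma has_order_card_free_rows:
  assumes "sparse 10 F" "v < n"
  shows "real (card (free_rows F v)) > 0" "has_order 0 2 (real (card (free_rows F v)))"
    "has_order 1 (-2) (inverse (real (card (free_rows F v))))"
proof -
  let ?m = "real (card (free_rows F v))"
  have m: "?m = real n - col_card F v" using sparseD(1)[OF assms(1)] by (rule card_free_rows)
  have "4 * \<theta> ^ 1 * r \<le> r * r" using r_pos by (intro mult_right_mono mult_theta_power_le_r) auto
  then have "4 * (\<theta> * r) \<le> real n" by (simp add: n_eq power2_eq_square)
  then have m_ge: "?m \<ge> real n / 2"
    using m sparseD(5)[OF assms] n_ge by linarith
  then show m_pos: "?m > 0" using n_ge by linarith
  then have "\<bar>inverse ?m\<bar> \<le> 2 / real n" using m_ge n_pos by (simp add: field_simps)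
  moreover have "has_order 1 (-2) (2 / real n)" by (rule has_order_mono, (rule has_order_intros | simp)+)
  ultimately show "has_order 1 (-2) (inverse ?m)" using has_order_dominated by blast
  show "has_order 0 2 ?m" using m m_pos by (intro has_order_dominated[OF has_order_n]) simp
qed

lemma card_fixed_le:
  assumes "admissible k F Q" shows "row_card Q a \<le> 10" "col_card Q v \<le> 10"
  using card_row_le[of Q a] card_row_le[of "Q\<inverse>" v] admissibleD(1,4,8)[OF assms] by simp_all

lemma sum_cell_prob_free_rows:
  assumes adm: "admissible k F Q" and v: "v < n"
  shows "(\<Sum>b\<in>free_rows F v. cell_prob F Q b v) = real (t v) - col_card Q v"
proof -
  have "(\<Sum>b\<in>free_rows F v. cell_prob F Q b v) = avg (\<Omega> F Q) (\<lambda>G. \<Sum>b\<in>free_rows F v. of_bool ((b,v) \<in> G))"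
    by (simp add: avg_sum)
  also have "\<dots> = avg (\<Omega> F Q) (\<lambda>G. real (t v) - col_card Q v)"
  proof (rule avg_cong)
    fix G assume "G \<in> \<Omega> F Q"
    note G = matricesD[OF this]
    have "free_rows F v \<inter> {b. (b,v) \<in> G} = col G v - col Q v" and sub: "col Q v \<subseteq> col G v"
      using G(1,2) by (auto simp: free_rows_def)
    then have "(\<Sum>b\<in>free_rows F v. of_bool ((b,v) \<in> G) :: real) = real (card (col G v - col Q v))"
      by (simp add: free_rows_def)
    also have "\<dots> = real (t v) - col_card Q v"
      using sub G(3) G(5)[OF v] card_mono[OF _ sub]
      by (simp add: card_Diff_subset finite_row finite_subset[OF sub] of_nat_diff)
    finally show "(\<Sum>b\<in>free_rows F v. of_bool ((b,v) \<in> G)) = real (t v) - col_card Q v" .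
  qed
  finally show ?thesis using admissibleD(5)[OF adm] by (simp add: avg_const finite_matrices)
qed

lemma cell_prob_eq_mean:
  assumes adm: "admissible k F Q" and v: "v < n"
  shows "cell_prob F Q a v - l = ((\<Sum>b\<in>free_rows F v. cell_prob F Q a v - cell_prob F Q b v)
    + (col_excess F v - col_card Q v)) / real (card (free_rows F v))"
proof -
  note sparse = admissibleD(6)[OF adm]
  let ?m = "real (card (free_rows F v))"
  have "(\<Sum>b\<in>free_rows F v. cell_prob F Q a v - cell_prob F Q b v) = ?m * cell_prob F Q a v
    - (real (t v) - col_card Q v)"
    using sum_cell_prob_free_rows[OF adm v] by (simp add: sum_subtractf)
  moreover have "col_excess F v = real (t v) - ?m * l"
    unfolding card_free_rows[OF sparseD(1)[OF sparse]] by (simp add: col_excess_def algebra_simps)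
  ultimately show ?thesis using has_order_card_free_rows(1)[OF sparse v] by (simp add: field_simps)
qed

lemma cell_prob_rough:
  assumes adm: "admissible k F Q" and a: "a < n" "v < n" "(a,v) \<notin> F"
  shows "has_order 10 (-1) (cell_prob F Q a v - l)"
proof -
  note sparse = admissibleD(6)[OF adm]
  have sum_order: "has_order (8 + 0) (-1 + 2) (\<Sum>b\<in>free_rows F v. cell_prob F Q a v - cell_prob F Q b v)"
    using a by (intro has_order_sum cell_prob_diff_rough[OF adm] has_order_card_free_rows(2)[OF sparse])
      (auto simp: free_rows_def)
  have fixed: "has_order 1 0 (col_card Q v)" using card_fixed_le(2)[OF adm, of v] by (intro has_order_bounded) simp
  show ?thesis unfolding cell_prob_eq_mean[OF adm a(2)]
    by (rule has_order_mono, (rule sum_order fixed has_order_col_excess[OF sparse a(2)]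
        has_order_card_free_rows(3)[OF sparse a(2)] has_order_intros | simp)+)
qed

lemma cell_prob_strict:
  assumes "admissible k F Q" "a < n" "v < n" "(a,v) \<notin> F"
  shows "0 < cell_prob F Q a v" "cell_prob F Q a v < 1"
proof -
  have "has_order 11 (-1) (\<theta> * (cell_prob F Q a v - l))"
    by (rule has_order_mono, (rule cell_prob_rough[OF assms] has_order_intros | simp)+)
  then have "\<bar>\<theta> * (cell_prob F Q a v - l)\<bar> \<le> 1 / 100" by (rule has_order_small) simp_all
  then have "\<theta> * \<bar>cell_prob F Q a v - l\<bar> < 1" using theta_pos by (simp add: abs_mult)
  then have "\<bar>cell_prob F Q a v - l\<bar> < 1 / \<theta>" using theta_pos by (simp add: field_simps)
  then show "0 < cell_prob F Q a v" "cell_prob F Q a v < 1" using l_ge l_le by linarith+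
qed

lemma cell_prob_bounds: "0 \<le> cell_prob F Q a v" "cell_prob F Q a v \<le> 1"
proof -
  show "0 \<le> cell_prob F Q a v" by (rule avg_nonneg) simp
  have "cell_prob F Q a v \<le> avg (\<Omega> F Q) (\<lambda>_. 1)" by (rule avg_mono) simp
  also have "\<dots> \<le> 1" by (simp add: avg_def)
  finally show "cell_prob F Q a v \<le> 1" .
qed

lemma has_order_cell_prob [has_order_intros]:
  "has_order 0 0 (cell_prob F Q a v)" "has_order 0 0 (1 - cell_prob F Q a v)"
  using cell_prob_bounds by (simp_all add: has_order_def)

subsection \<open>Conditioning on further cells\<close>

lemma avg_cell_mem:
  assumes "(a,v) \<notin> F" "Q \<subseteq> F"
  shows "avg (\<Omega> F Q) (\<lambda>G. of_bool ((a,v) \<in> G) * f G)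
    = cell_prob F Q a v * avg (\<Omega> (insert (a,v) F) (insert (a,v) Q)) f"
proof -
  let ?T = "\<Omega> (insert (a,v) F) (insert (a,v) Q)"
  have T: "?T = {G \<in> \<Omega> F Q. (a,v) \<in> G}" by (rule matrices_insert_mem[OF assms])
  have "avg (\<Omega> F Q) (\<lambda>G. of_bool ((a,v) \<in> G) * f G) = avg (\<Omega> F Q) (\<lambda>G. of_bool (G \<in> ?T) * f G)"
    by (rule avg_cong) (simp add: T)
  also have "\<dots> = avg (\<Omega> F Q) (\<lambda>G. of_bool (G \<in> ?T)) * avg ?T f"
    by (rule avg_restrict) (auto simp: finite_matrices T)
  also have "avg (\<Omega> F Q) (\<lambda>G. of_bool (G \<in> ?T)) = cell_prob F Q a v"
    by (rule avg_cong) (simp add: T)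
  finally show ?thesis .
qed

lemma cell_prob_frozen:
  assumes "admissible k F Q" "(a,v) \<in> F"
  shows "cell_prob F Q a v = of_bool ((a,v) \<in> Q)"
proof -
  have "cell_prob F Q a v = avg (\<Omega> F Q) (\<lambda>G. of_bool ((a,v) \<in> Q))"
    using assms(2) by (intro avg_cong) (auto simp: matrices_def)
  then show ?thesis using admissibleD(5)[OF assms(1)] by (simp add: avg_const finite_matrices)
qed

lemma sparse_insert:
  assumes "sparse m F" "a < n" "v < n"
  shows "sparse (Suc m) (insert (a,v) F)"
  using assms sparseD(2)[OF assms(1)]
  by (fastforce simp: sparse_def row_insert col_insert card_insert_if finite_row)

lemma admissible_insert:
  assumes adm: "admissible k F Q" and k: "k < 10" and a: "a < n" "v < n" "(a,v) \<notin> F"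
  shows "admissible (Suc k) (insert (a,v) F) (insert (a,v) Q)" "admissible (Suc k) (insert (a,v) F) Q"
proof -
  note adm' = admissibleD[OF adm]
  have "\<exists>G\<in>\<Omega> F Q. (a,v) \<in> G" "\<exists>G\<in>\<Omega> F Q. (a,v) \<notin> G"
  proof -
    show "\<exists>G\<in>\<Omega> F Q. (a,v) \<in> G"
    proof (rule ccontr)
      assume "\<not> ?thesis"
      then have "cell_prob F Q a v = avg (\<Omega> F Q) (\<lambda>G. 0)" by (intro avg_cong) auto
      then show False using cell_prob_strict(1)[OF adm a] unfolding avg_const[OF finite_matrices adm'(5)] by linarith
    qed
    show "\<exists>G\<in>\<Omega> F Q. (a,v) \<notin> G"
    proof (rule ccontr)
      assume "\<not> ?thesis"
      then have "cell_prob F Q a v = avg (\<Omega> F Q) (\<lambda>G. 1)" by (intro avg_cong) auto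
      then show False
        using cell_prob_strict(2)[OF adm a] unfolding avg_const[OF finite_matrices adm'(5)] by linarith
    qed
  qed
  then have "\<Omega> (insert (a,v) F) (insert (a,v) Q) \<noteq> {}" "\<Omega> (insert (a,v) F) Q \<noteq> {}"
    unfolding matrices_insert_mem[OF a(3) adm'(3)] matrices_insert_notin[OF a(3) adm'(3)] by auto
  then show "admissible (Suc k) (insert (a,v) F) (insert (a,v) Q)" "admissible (Suc k) (insert (a,v) F) Q"
    using adm' k sparse_insert[OF adm'(2) a(1,2)] by (auto simp: admissible_def card_insert_if)
qed

definition refines :: "nat \<Rightarrow> (nat \<times> nat) set \<Rightarrow> (nat \<times> nat) set \<Rightarrow> (nat \<times> nat) set \<Rightarrow> bool" where
  "refines k F F' Q \<longleftrightarrow> admissible k F' Q \<and> F \<subseteq> F' \<and> card (F' - F) \<le> k"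

lemma refines_refl: "admissible k F Q \<Longrightarrow> refines k F F Q"
  by (simp add: refines_def)

lemma refinesD:
  assumes "refines k F F' Q"
  shows "admissible k F' Q" "F \<subseteq> F'" "card (F' - F) \<le> 10" "finite F'" "sparse 10 F"
proof -
  show ref: "admissible k F' Q" "F \<subseteq> F'" "card (F' - F) \<le> 10"
    using assms admissibleD(1)[of k F' Q] by (auto simp: refines_def)
  note adm' = admissibleD[OF ref(1)]
  show fin: "finite F'" by (rule adm'(7))
  have "row F a \<subseteq> row F' a" "col F a \<subseteq> col F' a" for a using ref(2) by auto
  then have "row_card F a \<le> row_card F' a" "col_card F a \<le> col_card F' a" "card F \<le> card F'" for a
    using fin ref(2) by (auto intro!: card_mono finite_row)
  then show "sparse 10 F" using adm'(6) ref(2) unfolding sparse_def by (smt (verit) of_nat_mono order_trans)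
qed

lemma refines_insert:
  assumes ref: "refines k F F' Q" and k: "k < 10" and a: "a < n" "v < n" "(a,v) \<notin> F'"
  shows "refines (Suc k) F (insert (a,v) F') (insert (a,v) Q)" "refines (Suc k) F (insert (a,v) F') Q"
proof -
  have "insert (a,v) F' - F = insert (a,v) (F' - F)" using a refinesD(2)[OF ref] by auto
  then have "card (insert (a,v) F' - F) \<le> Suc k"
    using ref refinesD(4)[OF ref] by (simp add: refines_def card_insert_if)
  then show "refines (Suc k) F (insert (a,v) F') (insert (a,v) Q)" "refines (Suc k) F (insert (a,v) F') Q"
    using ref admissible_insert[OF refinesD(1)[OF ref] k a] by (auto simp: refines_def)
qed

lemma refines_insert_two:
  assumes adm: "admissible k F Q" and k: "k < 9" and ab: "a \<noteq> b" "a < n" "b < n"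
    and v: "v < n" "(a,v) \<notin> F" "(b,v) \<notin> F"
  shows "refines (Suc (Suc k)) F (insert (a,v) (insert (b,v) F)) (insert (a,v) Q)"
    "refines (Suc (Suc k)) F (insert (a,v) (insert (b,v) F)) (insert (b,v) Q)"
proof -
  have k': "k < 10" "Suc k < 10" using k by auto
  have new: "(a,v) \<notin> insert (b,v) F" using ab v by auto
  note first = refines_insert[OF refines_refl[OF adm] k'(1) ab(3) v(1,3)]
  show "refines (Suc (Suc k)) F (insert (a,v) (insert (b,v) F)) (insert (a,v) Q)"
    "refines (Suc (Suc k)) F (insert (a,v) (insert (b,v) F)) (insert (b,v) Q)"
    by (rule refines_insert(1)[OF first(2) k'(2) ab(2) v(1) new],
        rule refines_insert(2)[OF first(1) k'(2) ab(2) v(1) new])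
qed

lemma card_row_new_le:
  assumes "refines k F F' Q"
  shows "row_card (F' - F) a \<le> 10" "col_card (F' - F) v \<le> 10"
  using card_row_le[of "F' - F" a] card_row_le[of "(F' - F)\<inverse>" v] refinesD(3,4)[OF assms] by simp_all

lemma row_card_refines:
  assumes ref: "refines k F F' Q"
  shows "\<bar>row_card F' a - row_card F a\<bar> \<le> 10" "\<bar>col_card F' v - col_card F v\<bar> \<le> 10"
proof -
  note fin = refinesD(4)[OF ref]
  have rows: "row F' a = row F a \<union> row (F' - F) a" "row F a \<inter> row (F' - F) a = {}"
    and cols: "col F' v = col F v \<union> col (F' - F) v" "col F v \<inter> col (F' - F) v = {}"
    using refinesD(2)[OF ref] by auto
  have "finite F" using fin refinesD(2)[OF ref] finite_subset by blast
  then have "row_card F' a = row_card F a + row_card (F' - F) a" "col_card F' v = col_card F v + col_card (F' - F) v"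
    unfolding rows(1) cols(1) using rows(2) cols(2) fin by (simp_all add: card_Un_disjoint finite_row)
  then show "\<bar>row_card F' a - row_card F a\<bar> \<le> 10" "\<bar>col_card F' v - col_card F v\<bar> \<le> 10"
    using card_row_new_le[OF ref] by simp_all
qed

lemma has_order_excess_refines:
  assumes "refines k F F' Q"
  shows "has_order 1 0 (row_excess F' a - row_excess F a)" "has_order 1 0 (col_excess F' v - col_excess F v)"
proof -
  have "has_order (0 + 1) (0 + 0) (l * (row_card F' a - row_card F a))"
    "has_order (0 + 1) (0 + 0) (l * (col_card F' v - col_card F v))"
    using row_card_refines(1)[OF assms, of a] row_card_refines(2)[OF assms, of v]
    by (intro has_order_mult has_order_l has_order_bounded; simp)+
  then show "has_order 1 0 (row_excess F' a - row_excess F a)" "has_order 1 0 (col_excess F' v - col_excess F v)"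
    by (simp_all add: row_excess_def col_excess_def right_diff_distrib)
qed

lemma matrices_insert_two:
  assumes "(a,v) \<notin> F" "(b,v) \<notin> F" "a \<noteq> b" "Q \<subseteq> F"
  shows "\<Omega> (insert (a,v) (insert (b,v) F)) (insert (a,v) Q) = {G \<in> \<Omega> F Q. (a,v) \<in> G \<and> (b,v) \<notin> G}"
proof -
  have "\<Omega> (insert (b,v) F) Q = {G \<in> \<Omega> F Q. (b,v) \<notin> G}"
    using assms by (intro matrices_insert_notin)
  moreover have "\<Omega> (insert (a,v) (insert (b,v) F)) (insert (a,v) Q) = {G \<in> \<Omega> (insert (b,v) F) Q. (a,v) \<in> G}"
    using assms by (intro matrices_insert_mem) auto
  ultimately show ?thesis by auto
qed

lemma avg_differ:
  assumes adm: "admissible k F Q" and v: "(a,v) \<notin> F" "(b,v) \<notin> F"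
    and insert_a: "\<Omega> (insert (a,v) F) (insert (a,v) Q) \<noteq> {}" and insert_b: "\<Omega> (insert (b,v) F) (insert (b,v) Q) \<noteq> {}"
  shows "avg (\<Omega> F Q) (differ a b v) = cell_prob F Q a v * (1 - cell_prob (insert (a,v) F) (insert (a,v) Q) b v)
    + cell_prob F Q b v * (1 - cell_prob (insert (b,v) F) (insert (b,v) Q) a v)"
proof -
  have "avg (\<Omega> F Q) (differ a b v) = avg (\<Omega> F Q) (\<lambda>G. of_bool ((a,v) \<in> G) * (1 - of_bool ((b,v) \<in> G))
      + of_bool ((b,v) \<in> G) * (1 - of_bool ((a,v) \<in> G)))"
    by (rule avg_cong) auto
  then show ?thesis
    unfolding avg_add avg_cell_mem[OF v(1) admissibleD(3)[OF adm]] avg_cell_mem[OF v(2) admissibleD(3)[OF adm]]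
    using insert_a insert_b by (simp add: avg_diff avg_const finite_matrices)
qed

lemma has_order_avg_differ:
  assumes adm: "admissible k F Q" and k: "k < 9" and ab: "a \<noteq> b" "a < n" "b < n"
    and v: "v < n" "(a,v) \<notin> F" "(b,v) \<notin> F"
    and avgs: "\<And>Q'. Q' \<in> {insert (a,v) Q, insert (b,v) Q} \<Longrightarrow>
      has_order m j (avg (\<Omega> (insert (a,v) (insert (b,v) F)) Q') f - x)"
  shows "has_order (Suc m) j (avg (\<Omega> F Q) (\<lambda>G. differ a b v G * f G) - avg (\<Omega> F Q) (differ a b v) * x)"
proof -
  let ?F = "insert (a,v) (insert (b,v) F)"
  let ?\<Omega>a = "\<Omega> ?F (insert (a,v) Q)" and ?\<Omega>b = "\<Omega> ?F (insert (b,v) Q)"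
  note QF = admissibleD(3)[OF adm]
  have eq: "?\<Omega>a = {G \<in> \<Omega> F Q. (a,v) \<in> G \<and> (b,v) \<notin> G}" "?\<Omega>b = {G \<in> \<Omega> F Q. (b,v) \<in> G \<and> (a,v) \<notin> G}"
    using matrices_insert_two[OF v(2,3) ab(1) QF] matrices_insert_two[OF v(3,2) ab(1)[symmetric] QF]
    by (simp_all add: insert_commute)
  have nonempty: "?\<Omega>a \<noteq> {}" "?\<Omega>b \<noteq> {}"
    using refines_insert_two[OF adm k ab v] by (auto dest!: refinesD(1) admissibleD(5))
  have sub: "?\<Omega>a \<subseteq> \<Omega> F Q" "?\<Omega>b \<subseteq> \<Omega> F Q" unfolding eq by auto
  have "avg (\<Omega> F Q) (\<lambda>G. differ a b v G * f G) - avg (\<Omega> F Q) (differ a b v) * x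
    = avg (\<Omega> F Q) (\<lambda>G. differ a b v G * (f G - x))"
    by (simp add: right_diff_distrib avg_diff mult.commute[of _ x] avg_cmult)
  also have "\<dots> = avg (\<Omega> F Q) (\<lambda>G. of_bool (G \<in> ?\<Omega>a) * (f G - x) + of_bool (G \<in> ?\<Omega>b) * (f G - x))"
    unfolding eq by (rule avg_cong) auto
  also have "\<dots> = avg (\<Omega> F Q) (\<lambda>G. of_bool (G \<in> ?\<Omega>a)) * (avg ?\<Omega>a f - x)
    + avg (\<Omega> F Q) (\<lambda>G. of_bool (G \<in> ?\<Omega>b)) * (avg ?\<Omega>b f - x)"
    unfolding avg_add avg_restrict[OF finite_matrices sub(1)] avg_restrict[OF finite_matrices sub(2)]
    using nonempty by (simp add: avg_diff avg_const finite_matrices)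
  finally have split: "avg (\<Omega> F Q) (\<lambda>G. differ a b v G * f G) - avg (\<Omega> F Q) (differ a b v) * x = \<dots>" .
  have weight: "has_order 0 0 (avg (\<Omega> F Q) (\<lambda>G. of_bool (G \<in> T)))" for T
    by (intro has_order_avg has_order_unit) simp
  show ?thesis unfolding split
    by (rule has_order_mono, (rule weight avgs has_order_intros | simp)+)
qed

subsection \<open>Cell probabilities to first order\<close>

lemma sum_cell_prob_row:
  assumes ref: "refines k F F' Q" and a: "a < n" and W: "W \<subseteq> {..<n}" "has_order 3 1 (real (card W))"
  shows "has_order 15 0 ((\<Sum>w\<in>W. cell_prob F' Q a w) - l * real (card (W - row F a)))"
proof -
  note adm = refinesD(1)[OF ref] and fin = refinesD(4)[OF ref]
  note adm' = admissibleD[OF adm]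
  have finW: "finite W" using W(1) finite_subset by blast
  have "(\<Sum>w\<in>W. cell_prob F' Q a w) = (\<Sum>w\<in>W - row F' a. cell_prob F' Q a w) + (\<Sum>w\<in>W \<inter> row F' a. cell_prob F' Q a w)"
    using finW by (simp add: sum.Int_Diff[of W _ "row F' a"])
  also have "(\<Sum>w\<in>W \<inter> row F' a. cell_prob F' Q a w) = real (card (W \<inter> row F' a \<inter> row Q a))"
    using finW by (simp add: cell_prob_frozen[OF adm] row_def)
  finally have eq: "(\<Sum>w\<in>W. cell_prob F' Q a w) - l * real (card (W - row F a))
    = (\<Sum>w\<in>W - row F' a. cell_prob F' Q a w - l) + (real (card (W \<inter> row F' a \<inter> row Q a))
      - l * (real (card (W - row F a)) - real (card (W - row F' a))))"
    by (simp add: sum_subtractf algebra_simps)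
  have "has_order 3 1 (real (card (W - row F' a)))"
    using finW card_mono[of W "W - row F' a"] by (intro has_order_dominated[OF W(2)]) auto
  then have free: "has_order (10 + 3) (-1 + 1) (\<Sum>w\<in>W - row F' a. cell_prob F' Q a w - l)"
    using a W(1) by (intro has_order_sum cell_prob_rough[OF adm]) auto
  have "card (W \<inter> row F' a \<inter> row Q a) \<le> card (row Q a)"
    using adm'(8) by (intro card_mono finite_row) auto
  then have fixed: "has_order 1 0 (real (card (W \<inter> row F' a \<inter> row Q a)))"
    using card_fixed_le(1)[OF adm, of a] by (intro has_order_bounded) simp
  have "card (W - row F' a) \<le> card (W - row F a)"
    using finW refinesD(2)[OF ref] by (intro card_mono) auto
  moreover have "card (W - row F a) \<le> card (W - row F' a) + card (row (F' - F) a)"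
    using finW fin by (intro order_trans[OF card_mono card_Un_le]) (auto intro: finite_row)
  ultimately have new: "has_order 1 0 (real (card (W - row F a)) - real (card (W - row F' a)))"
    using card_row_new_le(1)[OF ref, of a] by (intro has_order_bounded) linarith
  show ?thesis unfolding eq
    by (rule has_order_mono, (rule free fixed new has_order_intros | simp)+)
qed

lemma frozen_cols_subset: "sparse m F \<Longrightarrow> frozen_cols F a b \<subseteq> {..<n}"
  using sparseD(1) by fastforce

lemma finite_frozen_cols: "sparse m F \<Longrightarrow> finite (frozen_cols F a b)"
  by (rule finite_subset[OF frozen_cols_subset]) auto

lemma card_frozen_cols_Diff:
  assumes "sparse m F" "c = a \<or> c = b"
  shows "real (card (frozen_cols F a b - row F c)) = real (card (frozen_cols F a b)) - row_card F c"
proof -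
  have sub: "row F c \<subseteq> frozen_cols F a b" using assms(2) by auto
  then show ?thesis
    using card_mono[OF finite_frozen_cols[OF assms(1)] sub] finite_subset[OF sub finite_frozen_cols[OF assms(1)]]
    by (simp add: card_Diff_subset of_nat_diff)
qed

lemma avg_card_row_Int:
  assumes "finite W"
  shows "avg (\<Omega> F Q) (\<lambda>G. real (card (row G a \<inter> W))) = (\<Sum>w\<in>W. cell_prob F Q a w)"
proof -
  have "real (card (row G a \<inter> W)) = (\<Sum>w\<in>W. of_bool ((a,w) \<in> G))" for G
    using assms by (simp add: row_def Int_commute)
  then show ?thesis by (simp add: avg_sum)
qed

lemma avg_imbalance:
  assumes ref: "refines k F F' Q" and ab: "a < n" "b < n"
  shows "avg (\<Omega> F' Q) (imbalance n F a b) = real (s a) - real (s b)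
    - (\<Sum>w\<in>frozen_cols F a b. cell_prob F' Q a w) + (\<Sum>w\<in>frozen_cols F a b. cell_prob F' Q b w)"
proof -
  have "avg (\<Omega> F' Q) (imbalance n F a b) = avg (\<Omega> F' Q) (\<lambda>G. real (s a) - real (s b)
      - real (card (row G a \<inter> frozen_cols F a b)) + real (card (row G b \<inter> frozen_cols F a b)))"
    using ab by (intro avg_cong imbalance_eq)
  then show ?thesis
    using admissibleD(5)[OF refinesD(1)[OF ref]] finite_frozen_cols[OF refinesD(5)[OF ref]]
    by (simp add: avg_add avg_diff avg_const finite_matrices avg_card_row_Int)
qed

lemma avg_imbalance_first_order:
  assumes ref: "refines k F F' Q" and ab: "a < n" "b < n"
  shows "has_order 16 0 (avg (\<Omega> F' Q) (imbalance n F a b) - (row_excess F a - row_excess F b))"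
proof -
  let ?U = "frozen_cols F a b"
  note sparse = refinesD(5)[OF ref]
  note row = sum_cell_prob_row[OF ref _ frozen_cols_subset[OF sparse] has_order_card_frozen_cols[OF sparse ab]]
  have eq: "avg (\<Omega> F' Q) (imbalance n F a b) - (row_excess F a - row_excess F b)
    = ((\<Sum>w\<in>?U. cell_prob F' Q b w) - l * real (card (?U - row F b)))
      - ((\<Sum>w\<in>?U. cell_prob F' Q a w) - l * real (card (?U - row F a)))"
    unfolding avg_imbalance[OF assms] card_frozen_cols_Diff[OF sparse disjI1[OF refl]]
      card_frozen_cols_Diff[OF sparse disjI2[OF refl]] row_excess_def by (simp add: algebra_simps)
  show ?thesis unfolding eq
    by (rule has_order_mono, (rule row[OF ab(1)] row[OF ab(2)] has_order_diff | simp)+)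
qed

lemma avg_differ_zeroth_order:
  assumes adm: "admissible k F Q" and k: "k < 9" and ab: "a \<noteq> b" "a < n" "b < n"
    and v: "v < n" "(a,v) \<notin> F" "(b,v) \<notin> F"
  shows "has_order 13 (-1) (avg (\<Omega> F Q) (differ a b v) - 2 * variance)"
proof -
  have k': "k < 10" using k by simp
  note adm_a = admissible_insert(1)[OF adm k' ab(2) v(1,2)]
  note adm_b = admissible_insert(1)[OF adm k' ab(3) v(1,3)]
  let ?x = "cell_prob F Q a v" and ?x' = "cell_prob (insert (b,v) F) (insert (b,v) Q) a v"
  let ?y = "cell_prob F Q b v" and ?y' = "cell_prob (insert (a,v) F) (insert (a,v) Q) b v"
  have eq: "avg (\<Omega> F Q) (differ a b v) - 2 * variance
    = ((?x - l) * (1 - ?y') - l * (?y' - l)) + ((?y - l) * (1 - ?x') - l * (?x' - l))"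
    unfolding avg_differ[OF adm v(2,3) admissibleD(5)[OF adm_a] admissibleD(5)[OF adm_b]]
    by (simp add: algebra_simps)
  have new: "(b,v) \<notin> insert (a,v) F" "(a,v) \<notin> insert (b,v) F" using ab v by auto
  note rough = cell_prob_rough[OF adm ab(2) v(1,2)] cell_prob_rough[OF adm ab(3) v(1,3)]
    cell_prob_rough[OF adm_a ab(3) v(1) new(1)] cell_prob_rough[OF adm_b ab(2) v(1) new(2)]
  show ?thesis unfolding eq
    by (rule has_order_mono, (rule rough has_order_cell_prob has_order_intros | simp)+)
qed

lemma cell_prob_diff_first_order:
  assumes adm: "admissible k F Q" and k: "k < 9" and ab: "a < n" "b < n"
    and v: "v < n" "(a,v) \<notin> F" "(b,v) \<notin> F"
  shows "has_order 25 (-2) (cell_prob F Q a v - cell_prob F Q b v - (row_excess F a - row_excess F b) / real n)"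
proof (cases "a = b")
  case True
  then show ?thesis using theta_pos r_pos by (simp add: has_order_def)
next
  case False
  note sparse = admissibleD(6)[OF adm]
  let ?D = "2 * variance * real n"
  let ?x = "row_excess F a - row_excess F b"
  let ?\<mu> = "avg (\<Omega> F Q) (differ a b v)"
  let ?main = "avg (\<Omega> F Q) (\<lambda>G. differ a b v G * imbalance n F a b G)"
  let ?deviation = "avg (\<Omega> F Q) (\<lambda>G. differ a b v G * (imbalance n F a b G * (?D - discordance n F a b G)))"
  let ?error = "cell_prob F Q a v - cell_prob F Q b v - (?main / ?D + ?deviation / ?D\<^sup>2)"
  have D: "has_order 6 1 (?D - ?D)" using theta_pos r_pos by (simp add: has_order_def)
  note ctxt = adm ab False D
  have "has_order (Suc 16) 0 (?main - ?\<mu> * ?x)"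
    by (rule has_order_avg_differ[OF adm k False ab v])
      (auto intro: avg_imbalance_first_order[OF _ ab] refines_insert_two[OF adm k False ab v])
  note orders = this avg_differ_zeroth_order[OF adm k False ab v]
    has_order_avg_differ_imbalance_deviation[OF ctxt, of v]
    has_order_inverse_denominator[OF ctxt] has_order_row_excess[OF sparse ab(1)] has_order_row_excess[OF sparse ab(2)]
  have error: "has_order 20 (-2) ?error"
    by (rule has_order_absorb[OF cell_prob_diff_expansion[OF ctxt v]]) simp_all
  have "2 * variance * ?x / ?D = ?x / real n" using variance_pos by simp
  then have eq: "cell_prob F Q a v - cell_prob F Q b v - ?x / real n
    = ?error + ((?main - ?\<mu> * ?x) / ?D + (?\<mu> - 2 * variance) * ?x / ?D + ?deviation / ?D\<^sup>2)"
    by (simp add: left_diff_distrib diff_divide_distrib)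
  show ?thesis unfolding eq
    by (rule has_order_mono, (rule error orders has_order_intros | simp)+)
qed

definition excess_along_col :: "(nat \<times> nat) set \<Rightarrow> nat \<Rightarrow> real" where
  "excess_along_col F v = (\<Sum>b\<in>col F v. row_excess F b)"

lemma has_order_excess_along_col:
  assumes "sparse 10 F" "v < n" shows "has_order 5 2 (excess_along_col F v)"
proof -
  have "has_order (3 + 2) (1 + 1) (excess_along_col F v)"
    unfolding excess_along_col_def using sparseD(1)[OF assms(1)] assms
    by (intro has_order_sum has_order_row_excess has_order_row_card(2)) auto
  then show ?thesis by simp
qed

lemma sum_row_excess_free_rows:
  assumes "sparse m F"
  shows "(\<Sum>b\<in>free_rows F v. row_excess F b) = total_excess F - excess_along_col F v"
proof -
  have "col F v \<subseteq> {..<n}" using sparseD(1)[OF assms] by auto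
  then show ?thesis
    using sum_excess(1)[OF sparseD(1)[OF assms]]
    by (simp add: free_rows_def excess_along_col_def sum_diff finite_subset)
qed

lemma cell_prob_first_order:
  assumes adm: "admissible k F Q" and k: "k < 9" and a: "a < n" "v < n" "(a,v) \<notin> F"
  shows "has_order 30 (-2) (cell_prob F Q a v - (l + (row_excess F a + col_excess F v) / real n))"
proof -
  note sparse = admissibleD(6)[OF adm]
  define m where "m = real (card (free_rows F v))"
  define X where "X = (\<Sum>b\<in>free_rows F v. cell_prob F Q a v - cell_prob F Q b v
    - (row_excess F a - row_excess F b) / real n)"
  have m: "m > 0" "m = real n - col_card F v" "has_order 0 2 m" "has_order 1 (-2) (inverse m)"
    using has_order_card_free_rows[OF sparse a(2)] card_free_rows[OF sparseD(1)[OF sparse]] by (simp_all add: m_def)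
  have X_order: "has_order (25 + 0) (-2 + 2) X"
    unfolding X_def using a m(3)
    by (intro has_order_sum cell_prob_diff_first_order[OF adm k]) (auto simp: free_rows_def m_def)
  have "(\<Sum>b\<in>free_rows F v. cell_prob F Q a v - cell_prob F Q b v)
    = X + (m * row_excess F a - (total_excess F - excess_along_col F v)) / real n"
    unfolding X_def by (simp add: sum_subtractf m_def sum_row_excess_free_rows[OF sparse] flip: sum_divide_distrib)
  then have "cell_prob F Q a v - l = (X + (m * row_excess F a - (total_excess F - excess_along_col F v)) / real n
    + (col_excess F v - col_card Q v)) / m"
    unfolding cell_prob_eq_mean[OF adm a(2)] m_def by simp
  moreover have "(row_excess F a + col_excess F v) / real n
    = (m * row_excess F a / real n + col_excess F v - col_excess F v * col_card F v / real n) / m"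
    using m(1) n_pos unfolding m(2) by (simp add: field_simps)
  ultimately have eq: "cell_prob F Q a v - (l + (row_excess F a + col_excess F v) / real n)
    = (X - col_card Q v - (total_excess F - excess_along_col F v) / real n
      + col_excess F v * col_card F v / real n) / m"
    by (simp add: diff_divide_distrib add_divide_distrib)
  have fixed: "has_order 1 0 (col_card Q v)"
    using card_fixed_le(2)[OF adm, of v] by (intro has_order_bounded) simp
  show ?thesis unfolding eq
    by (rule has_order_mono, (rule X_order fixed m(4) has_order_total_excess[OF sparse]
        has_order_excess_along_col[OF sparse a(2)] has_order_col_excess[OF sparse a(2)]
        has_order_row_card(2)[OF sparse a(2)] has_order_intros | simp)+)
qed

lemma cell_prob_first_order_refines:
  assumes ref: "refines k F F' Q" and k: "k < 9" and a: "a < n" "v < n" "(a,v) \<notin> F'"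
  shows "has_order 31 (-2) (cell_prob F' Q a v - (l + (row_excess F a + col_excess F v) / real n))"
proof -
  have eq: "cell_prob F' Q a v - (l + (row_excess F a + col_excess F v) / real n)
    = (cell_prob F' Q a v - (l + (row_excess F' a + col_excess F' v) / real n))
      + ((row_excess F' a - row_excess F a) + (col_excess F' v - col_excess F v)) / real n"
    by (simp add: algebra_simps add_divide_distrib diff_divide_distrib)
  show ?thesis unfolding eq
    by (rule has_order_mono, (rule cell_prob_first_order[OF refinesD(1)[OF ref] k a]
        has_order_excess_refines[OF ref] has_order_intros | simp)+)
qed

subsection \<open>The mean discordance\<close>

lemma has_order_excess_quotient:
  assumes "sparse 10 F" "a < n" "v < n"
  shows "has_order 4 (-1) ((row_excess F a + col_excess F v) / real n)"
  by (rule has_order_mono, (rule has_order_row_excess[OF assms(1,2)] has_order_col_excess[OF assms(1,3)]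
      has_order_intros | simp)+)

definition joint_prob_estimate :: "(nat \<times> nat) set \<Rightarrow> nat \<Rightarrow> nat \<Rightarrow> nat \<Rightarrow> real" where
  "joint_prob_estimate F a b u
    = l\<^sup>2 + l * ((row_excess F a + col_excess F u) / real n + (row_excess F b + col_excess F u) / real n)"

lemma has_order_joint_prob_estimate:
  assumes "sparse 10 F" "a < n" "b < n" "u < n"
  shows "has_order 6 0 (joint_prob_estimate F a b u)"
  unfolding joint_prob_estimate_def
  by (rule has_order_mono, (rule has_order_excess_quotient assms has_order_intros | simp)+)

lemma avg_common_neighbour:
  assumes ref: "refines k F F' Q" and k: "k < 8" and ab: "a \<noteq> b" "a < n" "b < n"
    and u: "u < n" "(a,u) \<notin> F'" "(b,u) \<notin> F'"
  shows "has_order 40 (-2) (avg (\<Omega> F' Q) (\<lambda>G. of_bool ((a,u) \<in> G) * of_bool ((b,u) \<in> G))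
    - joint_prob_estimate F a b u)"
proof -
  have k': "k < 9" "k < 10" "Suc k < 9" using k by auto
  note adm = refinesD(1)[OF ref] and sparse = refinesD(5)[OF ref]
  note ref' = refines_insert(1)[OF ref k'(2) ab(2) u(1,2)]
  define x y where "x = cell_prob F' Q a u" and "y = cell_prob (insert (a,u) F') (insert (a,u) Q) b u"
  define za zb where "za = (row_excess F a + col_excess F u) / real n"
    and "zb = (row_excess F b + col_excess F u) / real n"
  have "has_order 31 (-2) (x - (l + za))" "has_order 31 (-2) (y - (l + zb))"
    unfolding x_def y_def za_def zb_def using ab u
    by (auto intro!: cell_prob_first_order_refines[OF ref k'(1)] cell_prob_first_order_refines[OF ref' k'(3)])
  moreover have "has_order 4 (-1) za" "has_order 4 (-1) zb"
    unfolding za_def zb_def by (intro has_order_excess_quotient[OF sparse] ab u)+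
  moreover have "has_order 0 0 x" unfolding x_def by (rule has_order_cell_prob)
  moreover note orders = calculation
  have eq: "x * y - (l\<^sup>2 + l * (za + zb)) = x * (y - (l + zb)) + (x - (l + za)) * (l + zb) + za * zb"
    by (simp add: algebra_simps power2_eq_square)
  have "avg (\<Omega> F' Q) (\<lambda>G. of_bool ((a,u) \<in> G) * of_bool ((b,u) \<in> G)) = x * y"
    unfolding x_def y_def by (rule avg_cell_mem[OF u(2) admissibleD(3)[OF adm]])
  then show ?thesis
    unfolding joint_prob_estimate_def za_def[symmetric] zb_def[symmetric]
    by - (simp only: eq, rule has_order_mono, (rule orders has_order_intros | simp)+)
qed

lemma card_free_cols:
  assumes "sparse m F" shows "real (card (free_cols n F a b)) = real n - real (card (frozen_cols F a b))"
  using card_split_frozen[of "{..<n}" n F a b] frozen_cols_subset[OF assms, of a b]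
  by (simp add: Int_absorb1 free_cols_def Diff_subset)

lemma sum_col_excess_free_cols:
  assumes "sparse m F"
  shows "(\<Sum>u\<in>free_cols n F a b. col_excess F u) = total_excess F - (\<Sum>u\<in>frozen_cols F a b. col_excess F u)"
  unfolding free_cols_def sum_diff[OF finite_lessThan frozen_cols_subset[OF assms]]
    sum_excess(2)[OF sparseD(1)[OF assms]] ..

lemma has_order_sum_col_excess_frozen_cols:
  assumes "sparse 10 F" "a < n" "b < n"
  shows "has_order 6 2 (\<Sum>u\<in>frozen_cols F a b. col_excess F u)"
proof -
  have "has_order (3 + 3) (1 + 1) (\<Sum>u\<in>frozen_cols F a b. col_excess F u)"
    using sparseD(1)[OF assms(1)]
    by (intro has_order_sum has_order_col_excess[OF assms(1)] has_order_card_frozen_cols assms) auto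
  then show ?thesis by simp
qed

lemma has_order_card_free_cols_Diff:
  assumes ref: "refines k F F' Q"
  shows "has_order 1 0 (real (card (free_cols n F a b - free_cols n F' a b)))"
proof -
  have "free_cols n F a b - free_cols n F' a b \<subseteq> row (F' - F) a \<union> row (F' - F) b"
    by (auto simp: free_cols_def)
  then have "card (free_cols n F a b - free_cols n F' a b) \<le> card (row (F' - F) a \<union> row (F' - F) b)"
    using refinesD(4)[OF ref] by (intro card_mono) (auto intro: finite_row)
  also have "\<dots> \<le> card (row (F' - F) a) + card (row (F' - F) b)" by (rule card_Un_le)
  finally show ?thesis
    using card_row_new_le(1)[OF ref, of a] card_row_new_le(1)[OF ref, of b] by (intro has_order_bounded) simp
qed

lemma sum_joint_prob_estimate_free_cols:
  assumes "sparse m F"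
  shows "(\<Sum>u\<in>free_cols n F a b. joint_prob_estimate F a b u)
    = l\<^sup>2 * real (card (free_cols n F a b)) + l * (row_excess F a + row_excess F b)
      - l * (row_excess F a + row_excess F b) * real (card (frozen_cols F a b)) / real n
      + 2 * l * (total_excess F - (\<Sum>u\<in>frozen_cols F a b. col_excess F u)) / real n"
proof -
  let ?M = "free_cols n F a b"
  have sum: "(\<Sum>u\<in>?M. joint_prob_estimate F a b u) = l\<^sup>2 * real (card ?M)
    + l * (row_excess F a + row_excess F b) * (real (card ?M) / real n) + 2 * l * (\<Sum>u\<in>?M. col_excess F u) / real n"
    unfolding joint_prob_estimate_def
    by (simp add: sum.distrib sum_distrib_left sum_divide_distrib add_divide_distrib algebra_simps)
  have card_quotient: "real (card ?M) / real n = 1 - real (card (frozen_cols F a b)) / real n"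
    using card_free_cols[OF assms, of a b] n_pos by (simp add: field_simps)
  show ?thesis unfolding sum card_quotient sum_col_excess_free_cols[OF assms]
    by (simp add: right_diff_distrib)
qed

lemma has_order_avg_codegree_free_cols:
  assumes ref: "refines k F F' Q" and k: "k < 8" and ab: "a \<noteq> b" "a < n" "b < n"
  shows "has_order 43 0 (avg (\<Omega> F' Q) (\<lambda>G. real (card (row G a \<inter> row G b \<inter> free_cols n F a b)))
     - (l\<^sup>2 * real (card (free_cols n F a b)) + l * (row_excess F a + row_excess F b)))"
proof -
  note sparse = refinesD(5)[OF ref]
  let ?M = "free_cols n F a b" and ?M' = "free_cols n F' a b" and ?U = "frozen_cols F a b"
  define c where "c u = avg (\<Omega> F' Q) (\<lambda>G. of_bool ((a,u) \<in> G) * of_bool ((b,u) \<in> G))" for u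
  let ?h = "joint_prob_estimate F a b"
  have M': "?M' \<subseteq> ?M" using refinesD(2)[OF ref] by (auto simp: free_cols_def)
  have card_eq: "real (card (row G a \<inter> row G b \<inter> ?M)) = (\<Sum>u\<in>?M. of_bool ((a,u) \<in> G) * of_bool ((b,u) \<in> G))" for G
  proof -
    have "?M \<inter> {u. (a,u) \<in> G \<and> (b,u) \<in> G} = row G a \<inter> row G b \<inter> ?M" by auto
    then show ?thesis by (simp flip: of_bool_conj)
  qed
  have "avg (\<Omega> F' Q) (\<lambda>G. real (card (row G a \<inter> row G b \<inter> ?M))) = (\<Sum>u\<in>?M. c u)"
    unfolding card_eq avg_sum c_def ..
  also have "\<dots> = (\<Sum>u\<in>?M'. c u - ?h u) + (\<Sum>u\<in>?M - ?M'. c u - ?h u) + (\<Sum>u\<in>?M. ?h u)"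
    using sum.subset_diff[OF M' finite_free_cols, of "\<lambda>u. c u - ?h u"] by (simp add: sum_subtractf)
  finally have eq: "avg (\<Omega> F' Q) (\<lambda>G. real (card (row G a \<inter> row G b \<inter> ?M)))
      - (l\<^sup>2 * real (card ?M) + l * (row_excess F a + row_excess F b))
    = (\<Sum>u\<in>?M'. c u - ?h u) + (\<Sum>u\<in>?M - ?M'. c u - ?h u)
      + (2 * l * (total_excess F - (\<Sum>u\<in>?U. col_excess F u)) / real n
        - l * (row_excess F a + row_excess F b) * real (card ?U) / real n)"
    unfolding sum_joint_prob_estimate_free_cols[OF sparse] by simp
  have "card ?M' \<le> card {..<n}" by (intro card_mono) (auto simp: free_cols_def)
  then have "has_order 0 2 (real (card ?M'))" by (intro has_order_dominated[OF has_order_n]) simp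
  then have free: "has_order (40 + 0) (-2 + 2) (\<Sum>u\<in>?M'. c u - ?h u)"
    unfolding c_def by (intro has_order_sum avg_common_neighbour[OF ref k ab]) (auto simp: free_cols_def)
  have c: "has_order 0 0 (c u)" for u unfolding c_def by (intro has_order_avg has_order_unit) simp
  have "has_order 7 0 (c u - ?h u)" if "u < n" for u
    by (rule has_order_mono, (rule c has_order_joint_prob_estimate[OF sparse ab(2,3) that] has_order_diff | simp)+)
  then have new: "has_order (7 + 1) (0 + 0) (\<Sum>u\<in>?M - ?M'. c u - ?h u)"
    by (intro has_order_sum has_order_card_free_cols_Diff[OF ref]) (auto simp: free_cols_def)
  show ?thesis unfolding eq
    by (rule has_order_mono, (rule free new has_order_total_excess[OF sparse]
        has_order_sum_col_excess_frozen_cols[OF sparse ab(2,3)] has_order_row_excess[OF sparse ab(2)]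
        has_order_row_excess[OF sparse ab(3)] has_order_card_frozen_cols[OF sparse ab(2,3)] has_order_intros | simp)+)
qed

definition mean_discordance :: "(nat \<times> nat) set \<Rightarrow> nat \<Rightarrow> nat \<Rightarrow> real" where
  "mean_discordance F a b = 2 * variance * (real n - real (card (frozen_cols F a b)))
    + (1 - 2 * l) * (row_excess F a + row_excess F b)"

lemma has_order_mean_discordance:
  assumes "sparse 10 F" "a < n" "b < n"
  shows "has_order 6 1 (mean_discordance F a b - 2 * variance * real n)"
proof -
  have eq: "mean_discordance F a b - 2 * variance * real n
    = (1 - 2 * l) * (row_excess F a + row_excess F b) - 2 * variance * real (card (frozen_cols F a b))"
    by (simp add: mean_discordance_def algebra_simps)
  show ?thesis unfolding eq
    by (rule has_order_mono, (rule has_order_l has_order_row_excess[OF assms(1,2)] has_order_row_excess[OF assms(1,3)]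
        has_order_card_frozen_cols[OF assms] has_order_intros | simp)+)
qed

abbreviation discordance_defect :: "(nat \<times> nat) set \<Rightarrow> nat \<Rightarrow> nat \<Rightarrow> (nat \<times> nat) set \<Rightarrow> real" where
  "discordance_defect F a b G \<equiv> mean_discordance F a b - discordance n F a b G"

lemma has_order_avg_discordance_defect:
  assumes ref: "refines k F F' Q" and k: "k < 8" and ab: "a \<noteq> b" "a < n" "b < n"
  shows "has_order 45 0 (avg (\<Omega> F' Q) (discordance_defect F a b))"
proof -
  let ?U = "frozen_cols F a b" and ?M = "free_cols n F a b"
  note sparse = refinesD(5)[OF ref] and nonempty = admissibleD(5)[OF refinesD(1)[OF ref]]
  let ?C = "avg (\<Omega> F' Q) (\<lambda>G. real (card (row G a \<inter> row G b \<inter> ?M)))"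
  have "avg (\<Omega> F' Q) (discordance_defect F a b) = avg (\<Omega> F' Q) (\<lambda>G. mean_discordance F a b
      - (real (s a) + real (s b) - real (card (row G a \<inter> ?U)) - real (card (row G b \<inter> ?U))
        - 2 * real (card (row G a \<inter> row G b \<inter> ?M))))"
    using ab by (intro avg_cong) (simp only: discordance_eq[of _ n s t F' Q a b F])
  also have "\<dots> = mean_discordance F a b
      - (real (s a) + real (s b) - (\<Sum>w\<in>?U. cell_prob F' Q a w) - (\<Sum>w\<in>?U. cell_prob F' Q b w) - 2 * ?C)"
    unfolding avg_diff avg_add avg_cmult avg_const[OF finite_matrices nonempty]
      avg_card_row_Int[OF finite_frozen_cols[OF sparse]] ..
  also have "\<dots> = ((\<Sum>w\<in>?U. cell_prob F' Q a w) - l * real (card (?U - row F a)))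
    + ((\<Sum>w\<in>?U. cell_prob F' Q b w) - l * real (card (?U - row F b)))
    + 2 * (?C - (l\<^sup>2 * real (card ?M) + l * (row_excess F a + row_excess F b)))"
    unfolding card_frozen_cols_Diff[OF sparse disjI1[OF refl]] card_frozen_cols_Diff[OF sparse disjI2[OF refl]]
      card_free_cols[OF sparse] mean_discordance_def row_excess_def
    by (simp add: algebra_simps power2_eq_square)
  finally have eq: "avg (\<Omega> F' Q) (discordance_defect F a b) = \<dots>" .
  note row = sum_cell_prob_row[OF ref _ frozen_cols_subset[OF sparse] has_order_card_frozen_cols[OF sparse ab(2,3)]]
  show ?thesis unfolding eq
    by (rule has_order_mono, (rule row[OF ab(2)] row[OF ab(3)]
      has_order_avg_codegree_free_cols[OF ref k ab] has_order_intros | simp)+)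
qed

lemma has_order_avg_mem_discordance_defect:
  assumes ref: "refines k F F' Q" and k: "k < 7" and ab: "a \<noteq> b" "a < n" "b < n" and c: "c < n" "w < n"
  shows "has_order 45 0 (avg (\<Omega> F' Q) (\<lambda>G. of_bool ((c,w) \<in> G) * discordance_defect F a b G))"
proof (cases "(c,w) \<in> F'")
  case True
  have "avg (\<Omega> F' Q) (\<lambda>G. of_bool ((c,w) \<in> G) * discordance_defect F a b G)
    = of_bool ((c,w) \<in> Q) * avg (\<Omega> F' Q) (discordance_defect F a b)"
    unfolding avg_cmult[symmetric] using True by (intro avg_cong) (auto simp: matrices_def)
  moreover have "has_order 45 0 (avg (\<Omega> F' Q) (discordance_defect F a b))"
    using k by (intro has_order_avg_discordance_defect[OF ref _ ab]) simp
  ultimately show ?thesis using theta_pos by (auto simp: has_order_def)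
next
  case False
  have k': "k < 10" "Suc k < 8" using k by auto
  have "has_order (0 + 45) (0 + 0) (cell_prob F' Q c w
      * avg (\<Omega> (insert (c,w) F') (insert (c,w) Q)) (discordance_defect F a b))"
    by (intro has_order_mult has_order_cell_prob
        has_order_avg_discordance_defect[OF refines_insert(1)[OF ref k'(1) c False] k'(2) ab])
  then show ?thesis
    unfolding avg_cell_mem[OF False admissibleD(3)[OF refinesD(1)[OF ref]]] by simp
qed

lemma has_order_avg_imbalance_discordance_defect:
  assumes ref: "refines k F F' Q" and k: "k < 7" and ab: "a \<noteq> b" "a < n" "b < n"
  shows "has_order 51 1 (avg (\<Omega> F' Q) (\<lambda>G. imbalance n F a b G * discordance_defect F a b G))"
proof -
  let ?U = "frozen_cols F a b"
  let ?W = "discordance_defect F a b"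
  let ?A = "\<lambda>c. \<Sum>w\<in>?U. avg (\<Omega> F' Q) (\<lambda>G. of_bool ((c,w) \<in> G) * ?W G)"
  note sparse = refinesD(5)[OF ref]
  have card_eq: "real (card (row G c \<inter> ?U)) = (\<Sum>w\<in>?U. of_bool ((c,w) \<in> G))" for G c
    using finite_frozen_cols[OF sparse] by (simp add: row_def Int_commute)
  have "avg (\<Omega> F' Q) (\<lambda>G. imbalance n F a b G * ?W G)
     = avg (\<Omega> F' Q) (\<lambda>G. (real (s a) - real (s b)) * ?W G - (\<Sum>w\<in>?U. of_bool ((a,w) \<in> G) * ?W G)
        + (\<Sum>w\<in>?U. of_bool ((b,w) \<in> G) * ?W G))"
    using ab unfolding sum_distrib_right[symmetric] card_eq[symmetric]
      left_diff_distrib[symmetric] distrib_right[symmetric]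
    by (intro avg_cong) (simp only: imbalance_eq[of _ n s t F' Q a b F])
  also have "\<dots> = (real (s a) - real (s b)) * avg (\<Omega> F' Q) ?W - ?A a + ?A b"
    unfolding avg_add avg_diff[of _ "\<lambda>G. (real (s a) - real (s b)) * ?W G"] avg_cmult avg_sum ..
  finally have eq: "avg (\<Omega> F' Q) (\<lambda>G. imbalance n F a b G * ?W G) = \<dots>" .
  have A: "has_order (45 + 3) (0 + 1) (?A c)" if "c < n" for c
    using frozen_cols_subset[OF sparse, of a b] that
    by (intro has_order_sum has_order_avg_mem_discordance_defect[OF ref k ab]
      has_order_card_frozen_cols[OF sparse ab(2,3)]) auto
  have W: "has_order 45 0 (avg (\<Omega> F' Q) ?W)"
    using k by (intro has_order_avg_discordance_defect[OF ref _ ab]) simp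
  show ?thesis unfolding eq
    by (rule has_order_mono, (rule has_order_s_diff[OF ab(2,3)] W A[OF ab(2)] A[OF ab(3)] has_order_intros | simp)+)
qed

end

subsection \<open>Cell probabilities to second order\<close>

lemma second_order_identity:
  fixes x T u e e1 e2 \<tau> N K V D :: real
  assumes nz: "N \<noteq> 0" "V \<noteq> 0" "D \<noteq> 0" and D: "D = 2 * V * N * (1 + e1)"
    and e12: "e2 - e1 = (K * e + u) / N" and \<tau>: "\<tau> = (T - x * u) / N"
  shows "2 * V * (1 + e2) * (x + \<tau>) / D - (x / N * (1 + K * e / N) + T / N\<^sup>2)
    = (x * (e1\<^sup>2 - e1 * e2) + \<tau> * (e2 - e1)) * (2 * V) / D"
proof -
  have "1 + e2 - e1 = 1 + K * e / N + u / N" using e12 by (simp add: add_divide_distrib)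
  then have "x * (1 + e2 - e1) + \<tau> = x * (1 + K * e / N) + T / N"
    by (simp add: \<tau> algebra_simps diff_divide_distrib)
  then have "x / N * (1 + K * e / N) + T / N\<^sup>2 = (x * (1 + e2 - e1) + \<tau>) / N"
    by (simp add: add_divide_distrib power2_eq_square)
  also have "\<dots> = (x * (1 + e2 - e1) + \<tau>) * (1 + e1) * (2 * V) / D"
    using nz by (simp add: D field_simps)
  finally have main_term: "x / N * (1 + K * e / N) + T / N\<^sup>2 = \<dots>" .
  show ?thesis unfolding main_term diff_divide_distrib[symmetric]
    by (simp add: algebra_simps power2_eq_square)
qed

lemma column_average_identity:
  fixes X Z e g m N s \<psi> :: real
  assumes "m \<noteq> 0" "N \<noteq> 0" "N = m + \<psi>"
  shows "(X + (m * g - (s + Z)) / N + e) / m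
    = g / N + e / N + e * \<psi> / N\<^sup>2 - s / N\<^sup>2
      + (X / m - Z / (N * m) + e * \<psi>\<^sup>2 / (N\<^sup>2 * m) - s * \<psi> / (N\<^sup>2 * m))"
proof -
  have "1 / N + \<psi> / (N * m) = (m + \<psi>) / (N * m)" using assms(1,2) by (simp add: add_divide_distrib)
  then have inverse_m: "1 / m = 1 / N + \<psi> / (N * m)" using assms(2) by (simp flip: assms(3))
  have e: "e / m = e / N + e * \<psi> / N\<^sup>2 + e * \<psi>\<^sup>2 / (N\<^sup>2 * m)"
    using assms(1,2) arg_cong[OF inverse_m, of "\<lambda>y. e * (1 / N + \<psi> / N * y)"] arg_cong[OF inverse_m, of "\<lambda>y. e * y"]
    by (simp add: distrib_left power2_eq_square)
  have s: "s / (N * m) = s / N\<^sup>2 + s * \<psi> / (N\<^sup>2 * m)"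
    using arg_cong[OF inverse_m, of "\<lambda>y. s / N * y"] by (simp add: distrib_left power2_eq_square)
  have "(X + (m * g - (s + Z)) / N + e) / m = X / m + g / N - s / (N * m) - Z / (N * m) + e / m"
    using assms(1,2) by (simp add: field_simps)
  then show ?thesis unfolding e s by simp
qed

context near_regular begin

definition excess_along_row :: "(nat \<times> nat) set \<Rightarrow> nat \<Rightarrow> real" where
  "excess_along_row F a = (\<Sum>w\<in>row F a. col_excess F w)"

definition row_correction :: "(nat \<times> nat) set \<Rightarrow> nat \<Rightarrow> real" where
  "row_correction F a = row_card F a * row_excess F a + excess_along_row F a"

definition col_correction :: "(nat \<times> nat) set \<Rightarrow> nat \<Rightarrow> real" where
  "col_correction F v = col_card F v * col_excess F v + excess_along_col F v"

abbreviation skewness :: real where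
  "skewness \<equiv> (1 - 2 * l) / variance"

lemma has_order_inverse_variance [has_order_intros]: "has_order 2 0 (inverse variance)"
proof (rule has_order_dominated)
  show "has_order 2 0 (2 * \<theta>)" by (rule has_order_mono, (rule has_order_intros | simp)+)
  have "inverse variance \<le> inverse (1 / \<theta> / 2)"
    using variance_ge theta_pos by (intro le_imp_inverse_le) auto
  moreover have "inverse (1 / \<theta> / 2) = 2 * \<theta>" by simp
  moreover have "inverse variance > 0" using variance_pos(1) by (rule positive_imp_inverse_positive)
  ultimately show "\<bar>inverse variance\<bar> \<le> 2 * \<theta>" by linarith
qed

lemma has_order_excess_along_row:
  assumes "sparse 10 F" "a < n" shows "has_order 5 2 (excess_along_row F a)"
proof -
  have "has_order (3 + 2) (1 + 1) (excess_along_row F a)"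
    unfolding excess_along_row_def using sparseD(1)[OF assms(1)] assms
    by (intro has_order_sum has_order_col_excess has_order_row_card(1)) auto
  then show ?thesis by simp
qed

lemma has_order_row_correction: "sparse 10 F \<Longrightarrow> a < n \<Longrightarrow> has_order 6 2 (row_correction F a)"
  unfolding row_correction_def
  by (rule has_order_mono, (rule has_order_row_card has_order_row_excess has_order_excess_along_row
    has_order_intros | simp)+)

text \<open>Corrections to the main terms of the mean discordance, of the probability that two rows differ in
  a column and of the mean imbalance: the first two are relative and of order \<open>n powr (-1/2)\<close>, the last
  is absolute and of order \<open>1\<close>. Products of two of them turn out to be negligible.\<close>

definition discordance_correction :: "(nat \<times> nat) set \<Rightarrow> nat \<Rightarrow> nat \<Rightarrow> real" where
  "discordance_correction F a b
    = (skewness * (row_excess F a + row_excess F b) / 2 - real (card (frozen_cols F a b))) / real n"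

definition differ_correction :: "(nat \<times> nat) set \<Rightarrow> nat \<Rightarrow> nat \<Rightarrow> nat \<Rightarrow> real" where
  "differ_correction F a b v = skewness * (row_excess F a + row_excess F b + 2 * col_excess F v) / 2 / real n"

definition imbalance_correction :: "(nat \<times> nat) set \<Rightarrow> nat \<Rightarrow> nat \<Rightarrow> real" where
  "imbalance_correction F a b = (row_correction F a - row_correction F b
    - (row_excess F a - row_excess F b) * real (card (frozen_cols F a b))) / real n"

lemma has_order_corrections:
  assumes "sparse 10 F" "a < n" "b < n" "v < n"
  shows "has_order 8 (-1) (discordance_correction F a b)" "has_order 8 (-1) (differ_correction F a b v)"
    "has_order 8 0 (imbalance_correction F a b)"
proof -
  note orders = has_order_row_excess has_order_col_excess has_order_row_correction has_order_card_frozen_cols assms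
  show "has_order 8 (-1) (discordance_correction F a b)" unfolding discordance_correction_def
    by (rule has_order_mono, (rule orders has_order_intros | simp)+)
  show "has_order 8 (-1) (differ_correction F a b v)" unfolding differ_correction_def
    by (rule has_order_mono, (rule orders has_order_intros | simp)+)
  show "has_order 8 0 (imbalance_correction F a b)" unfolding imbalance_correction_def
    by (rule has_order_mono, (rule orders has_order_intros | simp)+)
qed

lemma mean_discordance_eq: "mean_discordance F a b = 2 * variance * real n * (1 + discordance_correction F a b)"
  using n_pos variance_pos by (simp add: mean_discordance_def discordance_correction_def field_simps)

lemma sum_cell_prob_row_second_order:
  assumes ref: "refines k F F' Q" and k: "k < 9" and ab: "a < n" "b < n" and c: "c = a \<or> c = b"
    and new: "row F' c \<inter> frozen_cols F a b \<subseteq> row F c" and fixed: "row Q c \<inter> frozen_cols F a b = {}"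
  shows "has_order 34 (-1) ((\<Sum>w\<in>frozen_cols F a b. cell_prob F' Q c w)
    - (l * (real (card (frozen_cols F a b)) - row_card F c)
      + (row_excess F c * (real (card (frozen_cols F a b)) - row_card F c)
        + (\<Sum>w\<in>frozen_cols F a b. col_excess F w) - excess_along_row F c) / real n))"
proof -
  let ?U = "frozen_cols F a b"
  note sparse = refinesD(5)[OF ref]
  note U = finite_frozen_cols[OF sparse, of a b] frozen_cols_subset[OF sparse, of a b]
  have sub: "row F c \<subseteq> ?U" using c by auto
  have cn: "c < n" using ab c by auto
  note card_Diff = card_frozen_cols_Diff[OF sparse c]
  have "(\<Sum>w\<in>row F c. cell_prob F' Q c w) = 0"
  proof (intro sum.neutral ballI)
    fix w assume w: "w \<in> row F c"
    then have "w \<notin> row Q c" using sub fixed by blast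
    moreover have "(c,w) \<in> F'" using w refinesD(2)[OF ref] by auto
    ultimately show "cell_prob F' Q c w = 0" using cell_prob_frozen[OF refinesD(1)[OF ref]] by simp
  qed
  then have free: "(\<Sum>w\<in>?U. cell_prob F' Q c w) = (\<Sum>w\<in>?U - row F c. cell_prob F' Q c w)"
    using sum.subset_diff[OF sub U(1), of "cell_prob F' Q c"] by simp
  have "(\<Sum>w\<in>?U - row F c. l + (row_excess F c + col_excess F w) / real n)
    = l * (real (card ?U) - row_card F c)
      + (row_excess F c * (real (card ?U) - row_card F c) + (\<Sum>w\<in>?U. col_excess F w) - excess_along_row F c) / real n"
    using sum_diff[OF U(1) sub, of "col_excess F"]
    by (simp add: sum.distrib card_Diff excess_along_row_def algebra_simps flip: sum_divide_distrib)
  then have eq: "(\<Sum>w\<in>?U. cell_prob F' Q c w) - (l * (real (card ?U) - row_card F c)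
      + (row_excess F c * (real (card ?U) - row_card F c) + (\<Sum>w\<in>?U. col_excess F w) - excess_along_row F c) / real n)
    = (\<Sum>w\<in>?U - row F c. cell_prob F' Q c w - (l + (row_excess F c + col_excess F w) / real n))"
    unfolding free by (simp add: sum_subtractf)
  have "has_order 3 1 (real (card (?U - row F c)))"
    using card_mono[OF U(1), of "?U - row F c"]
    by (intro has_order_dominated[OF has_order_card_frozen_cols[OF sparse ab]]) simp
  then have "has_order (31 + 3) (-2 + 1)
      (\<Sum>w\<in>?U - row F c. cell_prob F' Q c w - (l + (row_excess F c + col_excess F w) / real n))"
    using U(2) new by (intro has_order_sum cell_prob_first_order_refines[OF ref k cn]) auto
  then show ?thesis unfolding eq by simp
qed

lemma avg_imbalance_second_order:
  assumes ref: "refines k F F' Q" and k: "k < 9" and ab: "a < n" "b < n"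
    and F': "F' = insert (a,v) (insert (b,v) F)" and Q: "Q \<subseteq> {(a,v),(b,v)}" and v: "(a,v) \<notin> F" "(b,v) \<notin> F"
  shows "has_order 35 (-1) (avg (\<Omega> F' Q) (imbalance n F a b)
    - (row_excess F a - row_excess F b + imbalance_correction F a b))"
proof -
  let ?U = "frozen_cols F a b"
  define e where "e c = (\<Sum>w\<in>?U. cell_prob F' Q c w) - (l * (real (card ?U) - row_card F c)
    + (row_excess F c * (real (card ?U) - row_card F c) + (\<Sum>w\<in>?U. col_excess F w)
      - excess_along_row F c) / real n)" for c
  have e_order: "has_order 34 (-1) (e c)" if "c = a \<or> c = b" for c
  proof -
    have "row F' c \<inter> ?U \<subseteq> row F c" "row Q c \<inter> ?U = {}" using F' Q v by auto
    then show ?thesis unfolding e_def by (rule sum_cell_prob_row_second_order[OF ref k ab that])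
  qed
  have eq: "avg (\<Omega> F' Q) (imbalance n F a b) - (row_excess F a - row_excess F b + imbalance_correction F a b)
    = e b - e a"
    unfolding avg_imbalance[OF ref ab] e_def imbalance_correction_def row_correction_def
    by (simp add: row_excess_def[of F a] row_excess_def[of F b] diff_divide_distrib add_divide_distrib algebra_simps)
  show ?thesis unfolding eq
    by (rule has_order_mono, (rule e_order disjI1 disjI2 refl has_order_diff | simp)+)
qed

lemma avg_differ_second_order:
  assumes adm: "admissible k F Q" and k: "k < 8" and ab: "a \<noteq> b" "a < n" "b < n"
    and v: "v < n" "(a,v) \<notin> F" "(b,v) \<notin> F"
  shows "has_order 40 (-2) (avg (\<Omega> F Q) (differ a b v) - 2 * variance * (1 + differ_correction F a b v))"
proof -
  have k': "k < 9" "k < 10" "Suc k < 9" using k by auto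
  note sparse = admissibleD(6)[OF adm]
  note ref_a = refines_insert(1)[OF refines_refl[OF adm] k'(2) ab(2) v(1,2)]
  note ref_b = refines_insert(1)[OF refines_refl[OF adm] k'(2) ab(3) v(1,3)]
  define x y where "x = cell_prob F Q a v" and "y = cell_prob F Q b v"
  define x' y' where "x' = cell_prob (insert (b,v) F) (insert (b,v) Q) a v"
    and "y' = cell_prob (insert (a,v) F) (insert (a,v) Q) b v"
  define za zb where "za = (row_excess F a + col_excess F v) / real n"
    and "zb = (row_excess F b + col_excess F v) / real n"
  have "has_order 4 (-1) za" "has_order 4 (-1) zb"
    unfolding za_def zb_def by (intro has_order_excess_quotient[OF sparse] ab v)+
  moreover have "has_order 30 (-2) (x - (l + za))" "has_order 30 (-2) (y - (l + zb))"
    unfolding x_def y_def za_def zb_def by (intro cell_prob_first_order[OF adm k'(1)] ab v)+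
  moreover have "has_order 31 (-2) (x' - (l + za))" "has_order 31 (-2) (y' - (l + zb))"
    unfolding x'_def y'_def za_def zb_def using ab v
    by (auto intro!: cell_prob_first_order_refines[OF ref_a k'(3)] cell_prob_first_order_refines[OF ref_b k'(3)])
  moreover have "has_order 0 0 (1 - x')" "has_order 0 0 (1 - y')"
    unfolding x'_def y'_def by (rule has_order_cell_prob)+
  moreover note orders = calculation
  have "avg (\<Omega> F Q) (differ a b v) = x * (1 - y') + y * (1 - x')"
    unfolding x_def y_def x'_def y'_def
    by (rule avg_differ[OF adm v(2,3) admissibleD(5)[OF refinesD(1)[OF ref_a]] admissibleD(5)[OF refinesD(1)[OF ref_b]]])
  moreover have "2 * variance * (1 + differ_correction F a b v) = 2 * variance + (1 - 2 * l) * (za + zb)"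
  proof -
    have "2 * V * (1 + w / V * (p + q + 2 * e) / 2 / y) = 2 * V + w * ((p + e) / y + (q + e) / y)"
      if "V \<noteq> 0" for V w p q e y :: real
      using that by (simp add: distrib_left add_divide_distrib)
    then show ?thesis unfolding differ_correction_def za_def zb_def using variance_pos(2) by blast
  qed
  moreover have "x * (1 - y') + y * (1 - x') - (2 * variance + (1 - 2 * l) * (za + zb))
    = (x - (l + za)) * (1 - y') - (l + za) * (y' - (l + zb))
      + ((y - (l + zb)) * (1 - x') - (l + zb) * (x' - (l + za))) - 2 * (za * zb)"
    by (simp add: algebra_simps)
  ultimately have eq: "avg (\<Omega> F Q) (differ a b v) - 2 * variance * (1 + differ_correction F a b v)
    = (x - (l + za)) * (1 - y') - (l + za) * (y' - (l + zb))
      + ((y - (l + zb)) * (1 - x') - (l + zb) * (x' - (l + za))) - 2 * (za * zb)" by (simp only:)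
  show ?thesis unfolding eq
    by (rule has_order_mono, (rule orders has_order_intros | simp)+)
qed

definition row_profile :: "(nat \<times> nat) set \<Rightarrow> nat \<Rightarrow> nat \<Rightarrow> real" where
  "row_profile F v a = row_excess F a * (1 + skewness * col_excess F v / real n) + row_correction F a / real n"

lemma corrected_main_quotient:
  fixes F a b v
  defines "D \<equiv> mean_discordance F a b" and "x \<equiv> row_excess F a - row_excess F b" and "\<tau> \<equiv> imbalance_correction F a b"
    and "e1 \<equiv> discordance_correction F a b" and "e2 \<equiv> differ_correction F a b v"
  assumes D_pos: "D > 0"
  shows "2 * variance * (1 + e2) * (x + \<tau>) / D - (row_profile F v a - row_profile F v b) / real n
    = (x * (e1\<^sup>2 - e1 * e2) + \<tau> * (e2 - e1)) * (2 * variance) / D"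
proof -
  let ?u = "real (card (frozen_cols F a b))" and ?e = "col_excess F v"
  have profile: "(row_profile F v a - row_profile F v b) / real n
    = x / real n * (1 + skewness * ?e / real n) + (row_correction F a - row_correction F b) / (real n)\<^sup>2"
    unfolding row_profile_def x_def
    by (simp only: power2_eq_square diff_divide_distrib add_divide_distrib left_diff_distrib
      divide_divide_eq_left times_divide_eq_left)
  show ?thesis unfolding profile
  proof (rule second_order_identity)
    show "real n \<noteq> 0" "variance \<noteq> 0" "D \<noteq> 0" using n_pos variance_pos D_pos by auto
    show "D = 2 * variance * real n * (1 + e1)" unfolding D_def e1_def by (rule mean_discordance_eq)
    have "k * (z + 2 * e) / 2 / y - (k * z / 2 - u) / y = (k * e + u) / y" for k z e u y :: real
      by (simp add: diff_divide_distrib add_divide_distrib distrib_left)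
    then show "e2 - e1 = (skewness * ?e + ?u) / real n"
      unfolding e1_def e2_def discordance_correction_def differ_correction_def by blast
  qed (simp add: \<tau>_def x_def imbalance_correction_def)
qed

lemma cell_prob_diff_second_order:
  assumes adm: "admissible 0 F {}" and ab: "a < n" "b < n" and v: "v < n" "(a,v) \<notin> F" "(b,v) \<notin> F"
  shows "has_order 60 (-3) (cell_prob F {} a v - cell_prob F {} b v
    - (row_profile F v a - row_profile F v b) / real n)"
proof (cases "a = b")
  case True
  then show ?thesis using theta_pos r_pos by (simp add: has_order_def)
next
  case False
  note sparse = admissibleD(6)[OF adm]
  let ?D = "mean_discordance F a b" and ?x = "row_excess F a - row_excess F b"
  let ?\<tau> = "imbalance_correction F a b" and ?e1 = "discordance_correction F a b" and ?e2 = "differ_correction F a b v"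
  let ?\<mu> = "avg (\<Omega> F {}) (differ a b v)"
  let ?main = "avg (\<Omega> F {}) (\<lambda>G. differ a b v G * imbalance n F a b G)"
  let ?deviation = "avg (\<Omega> F {}) (\<lambda>G. differ a b v G * (imbalance n F a b G * (?D - discordance n F a b G)))"
  let ?error = "cell_prob F {} a v - cell_prob F {} b v - (?main / ?D + ?deviation / ?D\<^sup>2)"
  note ctxt = adm ab False has_order_mean_discordance[OF sparse ab]
  have refined: "refines 2 F (insert (a,v) (insert (b,v) F)) Q" if "Q \<in> {{(a,v)}, {(b,v)}}" for Q
    using refines_insert_two[OF adm _ False ab v] that by (auto simp: numeral_2_eq_2)
  have main: "has_order (Suc 35) (-1) (?main - ?\<mu> * (?x + ?\<tau>))"
    using avg_imbalance_second_order[OF refined _ ab refl _ v(2,3)]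
    by (intro has_order_avg_differ[OF adm _ False ab v]) auto
  have "has_order (Suc 51) 1 (?deviation - ?\<mu> * 0)"
    using has_order_avg_imbalance_discordance_defect[OF refined _ False ab]
    by (intro has_order_avg_differ[OF adm _ False ab v]) auto
  then have deviation: "has_order 52 1 ?deviation" by simp
  have \<mu>: "has_order 40 (-2) (?\<mu> - 2 * variance * (1 + ?e2))"
    using avg_differ_second_order[OF adm _ False ab v] by simp
  have x: "has_order 4 1 ?x"
    by (rule has_order_mono, (rule ab sparse has_order_row_excess has_order_diff | simp)+)
  have "y * z / D - p = q \<Longrightarrow> w - p = w - (M / D + W) + q + ((M - m * z) / D + (m - y) * z / D + W)"
    for y z D p q w M W m :: real
    by (simp add: left_diff_distrib diff_divide_distrib)
  from this[OF corrected_main_quotient[OF denominator_pos[OF ctxt]]]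
  have eq: "cell_prob F {} a v - cell_prob F {} b v - (row_profile F v a - row_profile F v b) / real n
    = ?error + (?x * (?e1\<^sup>2 - ?e1 * ?e2) + ?\<tau> * (?e2 - ?e1)) * (2 * variance) / ?D
      + ((?main - ?\<mu> * (?x + ?\<tau>)) / ?D + (?\<mu> - 2 * variance * (1 + ?e2)) * (?x + ?\<tau>) / ?D + ?deviation / ?D\<^sup>2)" .
  show ?thesis unfolding eq
    by (rule has_order_mono, (rule cell_prob_diff_expansion[OF ctxt v] main deviation \<mu> x
        has_order_corrections[OF sparse ab v(1)] has_order_inverse_denominator[OF ctxt] has_order_intros | simp)+)
qed

lemma has_order_sum_row_weighted:
  assumes "sparse 10 F" "I \<subseteq> {..<n}" and f: "\<And>b. b < n \<Longrightarrow> \<bar>f b\<bar> \<le> row_card F b * c" and c: "has_order k j c"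
  shows "has_order (2 + k) (2 + j) (\<Sum>b\<in>I. f b)"
proof (rule has_order_dominated)
  show "has_order (2 + k) (2 + j) (real (card F) * c)"
    by (intro has_order_mult has_order_card assms)
  have "\<bar>\<Sum>b\<in>I. f b\<bar> \<le> (\<Sum>b\<in>I. \<bar>f b\<bar>)" by (rule sum_abs)
  also have "\<dots> \<le> (\<Sum>b<n. \<bar>f b\<bar>)" using assms(2) by (intro sum_mono2) auto
  also have "\<dots> \<le> (\<Sum>b<n. row_card F b * c)" using f by (intro sum_mono) auto
  also have "\<dots> = real (card F) * c"
    using sum_card_row[OF sparseD(1)[OF assms(1)]] by (simp flip: sum_distrib_right of_nat_sum)
  finally show "\<bar>\<Sum>b\<in>I. f b\<bar> \<le> real (card F) * c" .
qed

lemma has_order_sum_row_correction: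
  assumes sparse: "sparse 10 F" and I: "I \<subseteq> {..<n}"
  shows "has_order 6 3 (\<Sum>b\<in>I. row_correction F b)"
proof -
  let ?c = "2 * (\<theta> ^ 3 * r)"
  have c: "has_order 4 1 ?c" by (rule has_order_mono, (rule has_order_intros | simp)+)
  have "\<bar>row_correction F b\<bar> \<le> row_card F b * ?c" if b: "b < n" for b
  proof -
    have "\<bar>row_card F b * row_excess F b\<bar> \<le> row_card F b * (\<theta> ^ 3 * r)"
      using has_orderD[OF has_order_row_excess[OF sparse b]] by (simp add: abs_mult mult_left_mono)
    moreover have "\<bar>excess_along_row F b\<bar> \<le> (\<Sum>w\<in>row F b. \<theta> ^ 3 * r)"
      unfolding excess_along_row_def
      using has_orderD[OF has_order_col_excess[OF sparse]] sparseD(1)[OF sparse]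
      by (intro order_trans[OF sum_abs] sum_mono) auto
    ultimately show ?thesis unfolding row_correction_def by (simp add: algebra_simps)
  qed
  from has_order_sum_row_weighted[OF sparse I this c] show ?thesis by simp
qed

lemma sum_row_profile_free_rows:
  assumes "sparse m F"
  shows "(\<Sum>b\<in>free_rows F v. row_profile F v b) = (total_excess F - excess_along_col F v)
    + ((total_excess F - excess_along_col F v) * (skewness * col_excess F v / real n)
      + (\<Sum>b\<in>free_rows F v. row_correction F b) / real n)"
  unfolding row_profile_def sum.distrib sum_distrib_right[symmetric] sum_row_excess_free_rows[OF assms]
    sum_divide_distrib[symmetric] by (simp only: distrib_left mult_1_right add.assoc)

theorem cell_prob_second_order:
  assumes adm: "admissible 0 F {}" and a: "a < n" "v < n" "(a,v) \<notin> F"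
  shows "has_order 65 (-3) (cell_prob F {} a v - (l + (row_excess F a + col_excess F v) / real n
    - total_excess F / (real n)\<^sup>2 + (row_correction F a + col_correction F v) / (real n)\<^sup>2
    + skewness * row_excess F a * col_excess F v / (real n)\<^sup>2))"
proof -
  note sparse = admissibleD(6)[OF adm]
  let ?free = "free_rows F v" and ?g = "row_profile F v"
  define m where "m = real (card ?free)"
  define K e \<psi> S where "K = skewness" and "e = col_excess F v" and "\<psi> = col_card F v"
    and "S = total_excess F - excess_along_col F v"
  define X where "X = (\<Sum>b\<in>?free. cell_prob F {} a v - cell_prob F {} b v - (?g a - ?g b) / real n)"
  define Z where "Z = S * (K * e / real n) + (\<Sum>b\<in>?free. row_correction F b) / real n"
  have m: "m > 0" "m = real n - \<psi>" "has_order 0 2 m" "has_order 1 (-2) (inverse m)"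
    using has_order_card_free_rows[OF sparse a(2)] card_free_rows[OF sparseD(1)[OF sparse]]
    by (simp_all add: m_def \<psi>_def)
  have X: "has_order (60 + 0) (-3 + 2) X"
    unfolding X_def using a
    by (intro has_order_sum m(3)[unfolded m_def] cell_prob_diff_second_order[OF adm]) (auto simp: free_rows_def)
  have orders: "has_order 3 1 e" "has_order 2 1 \<psi>" "has_order 6 2 S" "has_order 6 3 (\<Sum>b\<in>?free. row_correction F b)"
    unfolding e_def \<psi>_def S_def
    by (rule has_order_mono, (rule has_order_col_excess has_order_row_card has_order_total_excess
        has_order_excess_along_col has_order_sum_row_correction sparse a
          has_order_intros | simp add: free_rows_def)+)+
  have Z: "has_order 15 1 Z" unfolding Z_def K_def
    by (rule has_order_mono, (rule orders has_order_intros | simp)+)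
  have "(\<Sum>b\<in>?free. cell_prob F {} a v - cell_prob F {} b v) = X + (m * ?g a - (S + Z)) / real n"
    unfolding X_def Z_def S_def K_def e_def sum_row_profile_free_rows[OF sparse, symmetric]
    by (simp add: sum_subtractf m_def flip: sum_divide_distrib)
  then have "cell_prob F {} a v - l = (X + (m * ?g a - (S + Z)) / real n + e) / m"
    using cell_prob_eq_mean[OF adm a(2), of a] by (simp add: m_def e_def row_def)
  also have "\<dots> = ?g a / real n + e / real n + e * \<psi> / (real n)\<^sup>2 - S / (real n)\<^sup>2
      + (X / m - Z / (real n * m) + e * \<psi>\<^sup>2 / ((real n)\<^sup>2 * m) - S * \<psi> / ((real n)\<^sup>2 * m))"
    using m n_pos by (intro column_average_identity) auto
  finally have eq: "cell_prob F {} a v - (l + (row_excess F a + e) / real n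
      - total_excess F / (real n)\<^sup>2 + (row_correction F a + col_correction F v) / (real n)\<^sup>2
      + K * row_excess F a * e / (real n)\<^sup>2)
    = X / m - Z / (real n * m) + e * \<psi>\<^sup>2 / ((real n)\<^sup>2 * m) - S * \<psi> / ((real n)\<^sup>2 * m)"
    unfolding row_profile_def S_def col_correction_def e_def[symmetric] \<psi>_def[symmetric] K_def[symmetric]
    by (simp add: add_divide_distrib diff_divide_distrib algebra_simps power2_eq_square)
  show ?thesis unfolding e_def[symmetric] K_def[symmetric] eq
    by (rule has_order_mono, (rule X Z orders m(4) has_order_intros | simp)+)
qed

end

subsection \<open>The exponent as a potential\<close>

lemma abs_ln_one_minus_cubic_le:
  fixes w :: real
  assumes w: "\<bar>w\<bar> \<le> 1/2"
  shows "\<bar>ln (1 - w) + w + w\<^sup>2 / 2\<bar> \<le> 3 * \<bar>w\<bar> ^ 3"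
proof -
  define D :: "nat \<Rightarrow> real \<Rightarrow> real"
    where "D = (\<lambda>m x. if m = 0 then ln (1 - x) else - fact (m - 1) / (1 - x) ^ m)"
  have "(D m has_real_derivative D (Suc m) x) (at x)" if "m < 3" "\<bar>x\<bar> \<le> \<bar>w\<bar>" for m x
  proof -
    have pos: "1 - x > 0" using that w by linarith
    show ?thesis
    proof (cases m)
      case 0
      then show ?thesis using pos by (auto simp: D_def intro!: derivative_eq_intros)
    next
      case (Suc m')
      have "((\<lambda>x. - fact m' / (1 - x) ^ Suc m') has_real_derivative - fact (Suc m') / (1 - x) ^ Suc (Suc m')) (at x)"
        using pos by - (rule derivative_eq_intros refl | simp)+
      then show ?thesis by (simp add: D_def Suc del: power_Suc fact_Suc)
    qed
  qed
  then obtain x where x: "\<bar>x\<bar> \<le> \<bar>w\<bar>" and "D 0 w = (\<Sum>m<3. D m 0 / fact m * w ^ m) + D 3 x / fact 3 * w ^ 3"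
    using Maclaurin_bi_le[of D "D 0" 3 w] by blast
  then have "ln (1 - w) + w + w\<^sup>2 / 2 = - (w ^ 3 / (3 * (1 - x) ^ 3))"
    by (simp add: D_def numeral_eq_Suc)
  then have "\<bar>ln (1 - w) + w + w\<^sup>2 / 2\<bar> = \<bar>w ^ 3 / (3 * (1 - x) ^ 3)\<bar>"
    by (simp only: abs_minus_cancel)
  moreover have "\<bar>w ^ 3 / (3 * (1 - x) ^ 3)\<bar> \<le> \<bar>w\<bar> ^ 3 / (3 * (1/2) ^ 3)"
  proof -
    have pos: "1 - x > 0" and "(1/2) ^ 3 \<le> (1 - x) ^ 3" using x w by (auto intro!: power_mono)
    then have "\<bar>w\<bar> ^ 3 / (3 * (1 - x) ^ 3) \<le> \<bar>w\<bar> ^ 3 / (3 * (1/2) ^ 3)"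
      by (intro divide_left_mono mult_left_mono) auto
    then show ?thesis using pos by (simp add: abs_mult power_abs)
  qed
  moreover have "\<bar>w\<bar> ^ 3 / (3 * (1/2) ^ 3) \<le> 3 * \<bar>w\<bar> ^ 3" by (simp add: power_divide)
  ultimately show ?thesis by linarith
qed

definition exponent_form ::
    "real \<Rightarrow> real \<Rightarrow> real \<Rightarrow> real \<Rightarrow> real \<Rightarrow> real \<Rightarrow> real \<Rightarrow> real \<Rightarrow> real \<Rightarrow> real \<Rightarrow> real" where
  "exponent_form l N X X2 R11 Y R02 R03 R12 R21 =
      l * X / ((1 - l) * N) + l * X2 / (2 * (1 - l) * N\<^sup>2) - R11 / ((1 - l) * N) - Y / (l * (1 - l) * N\<^sup>2)
      + l * R02 / (2 * (1 - l) * N) + l * (1 - 2*l) * R03 / (6 * (1 - l)\<^sup>2 * N\<^sup>2)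
      - (1 - 2*l) * R12 / (2 * (1 - l)\<^sup>2 * N\<^sup>2) - R21 / (2 * (1 - l)\<^sup>2 * N\<^sup>2)"

definition degree_moment :: "nat \<Rightarrow> (nat \<Rightarrow> real) \<Rightarrow> (nat \<Rightarrow> real) \<Rightarrow> (nat \<times> nat) set \<Rightarrow> nat \<Rightarrow> nat \<Rightarrow> real" where
  "degree_moment n \<delta> \<eta> H h k = (\<Sum>j<n. \<delta> j ^ h * row_card H j ^ k) + (\<Sum>j<n. \<eta> j ^ h * col_card H j ^ k)"

definition potential :: "real \<Rightarrow> nat \<Rightarrow> (nat \<Rightarrow> real) \<Rightarrow> (nat \<Rightarrow> real) \<Rightarrow> (nat \<times> nat) set \<Rightarrow> real" where
  "potential l n \<delta> \<eta> H = exponent_form l (real n) (real (card H)) ((real (card H))\<^sup>2)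
     (degree_moment n \<delta> \<eta> H 1 1) (\<Sum>(j,k)\<in>H. \<delta> j * \<eta> k) (degree_moment n \<delta> \<eta> H 0 2)
     (degree_moment n \<delta> \<eta> H 0 3) (degree_moment n \<delta> \<eta> H 1 2) (degree_moment n \<delta> \<eta> H 2 1)"

lemma exponent_form_diff:
  "exponent_form l N X X2 R11 Y R02 R03 R12 R21 - exponent_form l N X' X2' R11' Y' R02' R03' R12' R21'
   = exponent_form l N (X - X') (X2 - X2') (R11 - R11') (Y - Y') (R02 - R02') (R03 - R03') (R12 - R12') (R21 - R21')"
  by (simp add: exponent_form_def diff_divide_distrib right_diff_distrib)

lemma sum_diff_single:
  fixes f g :: "'a \<Rightarrow> 'b :: ab_group_add"
  assumes "finite A" "j \<in> A" "\<And>i. i \<in> A \<Longrightarrow> i \<noteq> j \<Longrightarrow> f i = g i"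
  shows "(\<Sum>i\<in>A. f i) - (\<Sum>i\<in>A. g i) = f j - g j"
proof -
  have "(\<Sum>i\<in>A - {j}. f i) = (\<Sum>i\<in>A - {j}. g i)" using assms by (intro sum.cong) auto
  then show ?thesis using assms(1,2) by (simp add: sum.remove)
qed

lemma row_card_insert:
  assumes "finite H" "(j,k) \<notin> H"
  shows "row_card (insert (j,k) H) i = row_card H i + of_bool (i = j)"
    "col_card (insert (j,k) H) i = col_card H i + of_bool (i = k)"
  using assms by (auto simp: row_insert col_insert finite_row)

context
  fixes n j k :: nat and l :: real and H :: "(nat \<times> nat) set" and \<delta> \<eta> \<delta>' \<eta>' :: "nat \<Rightarrow> real"
  assumes H: "finite H" "(j,k) \<notin> H" and jk: "j < n" "k < n"
    and \<delta>': "\<And>i. \<delta>' i = \<delta> i + l * of_bool (i = j)" and \<eta>': "\<And>i. \<eta>' i = \<eta> i + l * of_bool (i = k)"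
begin

lemma degree_moment_insert:
  "degree_moment n \<delta>' \<eta>' (insert (j,k) H) h m - degree_moment n \<delta> \<eta> H h m
    = ((\<delta> j + l) ^ h * (row_card H j + 1) ^ m - \<delta> j ^ h * row_card H j ^ m)
      + ((\<eta> k + l) ^ h * (col_card H k + 1) ^ m - \<eta> k ^ h * col_card H k ^ m)"
proof -
  let ?H = "insert (j,k) H"
  have "(\<Sum>i<n. \<delta>' i ^ h * row_card ?H i ^ m) - (\<Sum>i<n. \<delta> i ^ h * row_card H i ^ m)
    = \<delta>' j ^ h * row_card ?H j ^ m - \<delta> j ^ h * row_card H j ^ m"
    by (rule sum_diff_single) (use jk in \<open>auto simp: row_card_insert[OF H] \<delta>'\<close>)
  moreover have "(\<Sum>i<n. \<eta>' i ^ h * col_card ?H i ^ m) - (\<Sum>i<n. \<eta> i ^ h * col_card H i ^ m)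
    = \<eta>' k ^ h * col_card ?H k ^ m - \<eta> k ^ h * col_card H k ^ m"
    by (rule sum_diff_single) (use jk in \<open>auto simp: row_card_insert[OF H] \<eta>'\<close>)
  ultimately show ?thesis by (simp add: degree_moment_def row_card_insert[OF H] \<delta>' \<eta>')
qed

lemma sum_arcs_insert:
  "(\<Sum>(a,b)\<in>insert (j,k) H. \<delta>' a * \<eta>' b) - (\<Sum>(a,b)\<in>H. \<delta> a * \<eta> b)
    = (\<delta> j + l) * (\<eta> k + l) + l * ((\<Sum>w\<in>row H j. \<eta> w) + (\<Sum>b\<in>col H k. \<delta> b))"
proof -
  have "(\<Sum>(a,b)\<in>H. of_bool (a = j) * \<eta> b) = (\<Sum>(a,b)\<in>{p \<in> H. fst p = j}. \<eta> b)"
    using H(1) by (intro sum.mono_neutral_cong_right) (auto split: if_splits)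
  also have "\<dots> = (\<Sum>w\<in>row H j. \<eta> w)"
    by (rule sum.reindex_bij_witness[of _ "\<lambda>w. (j,w)" snd]) auto
  finally have in_row: "(\<Sum>(a,b)\<in>H. of_bool (a = j) * \<eta> b) = (\<Sum>w\<in>row H j. \<eta> w)" .
  have "(\<Sum>(a,b)\<in>H. of_bool (b = k) * \<delta> a) = (\<Sum>(a,b)\<in>{p \<in> H. snd p = k}. \<delta> a)"
    using H(1) by (intro sum.mono_neutral_cong_right) (auto split: if_splits)
  also have "\<dots> = (\<Sum>b\<in>col H k. \<delta> b)"
    by (rule sum.reindex_bij_witness[of _ "\<lambda>b. (b,k)" fst]) auto
  finally have in_col: "(\<Sum>(a,b)\<in>H. of_bool (b = k) * \<delta> a) = (\<Sum>b\<in>col H k. \<delta> b)" .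
  have "(\<Sum>(a,b)\<in>H. \<delta>' a * \<eta>' b)
    = (\<Sum>(a,b)\<in>H. \<delta> a * \<eta> b + l * (of_bool (a = j) * \<eta> b) + l * (of_bool (b = k) * \<delta> a))"
    using H(2) by (intro sum.cong refl) (auto simp: \<delta>' \<eta>' algebra_simps)
  also have "\<dots> = (\<Sum>(a,b)\<in>H. \<delta> a * \<eta> b) + l * (\<Sum>w\<in>row H j. \<eta> w) + l * (\<Sum>b\<in>col H k. \<delta> b)"
    unfolding in_row[symmetric] in_col[symmetric] by (simp only: split_def sum.distrib sum_distrib_left)
  finally show ?thesis using H by (simp add: \<delta>' \<eta>' algebra_simps)
qed

lemma potential_insert:
  "potential l n \<delta>' \<eta>' (insert (j,k) H) - potential l n \<delta> \<eta> H
    = exponent_form l (real n) 1 (2 * real (card H) + 1)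
      ((\<delta> j + l * row_card H j + l) + (\<eta> k + l * col_card H k + l))
      ((\<delta> j + l) * (\<eta> k + l) + l * ((\<Sum>w\<in>row H j. \<eta> w) + (\<Sum>b\<in>col H k. \<delta> b)))
      ((2 * row_card H j + 1) + (2 * col_card H k + 1))
      ((3 * (row_card H j)\<^sup>2 + 3 * row_card H j + 1) + (3 * (col_card H k)\<^sup>2 + 3 * col_card H k + 1))
      ((\<delta> j * (2 * row_card H j + 1) + l * (row_card H j + 1)\<^sup>2)
        + (\<eta> k * (2 * col_card H k + 1) + l * (col_card H k + 1)\<^sup>2))
      (((\<delta> j)\<^sup>2 + 2 * l * \<delta> j * (row_card H j + 1) + l\<^sup>2 * (row_card H j + 1))
        + ((\<eta> k)\<^sup>2 + 2 * l * \<eta> k * (col_card H k + 1) + l\<^sup>2 * (col_card H k + 1)))"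
proof -
  have card: "real (card (insert (j,k) H)) = real (card H) + 1" using H by simp
  show ?thesis
    unfolding potential_def exponent_form_diff degree_moment_insert sum_arcs_insert card
    by (simp add: power2_eq_square power3_eq_cube algebra_simps)
qed

end

lemma exponent_form_increment:
  fixes l N X x y d e E :: real
  assumes "l \<noteq> 0" "1 - l \<noteq> 0" "N \<noteq> 0"
  shows "exponent_form l N 1 (2 * X + 1) ((d + l * x + l) + (e + l * y + l)) ((d + l) * (e + l) + l * E)
      ((2 * x + 1) + (2 * y + 1)) ((3 * x\<^sup>2 + 3 * x + 1) + (3 * y\<^sup>2 + 3 * y + 1))
      ((d * (2 * x + 1) + l * (x + 1)\<^sup>2) + (e * (2 * y + 1) + l * (y + 1)\<^sup>2))
      ((d\<^sup>2 + 2 * l * d * (x + 1) + l\<^sup>2 * (x + 1)) + (e\<^sup>2 + 2 * l * e * (y + 1) + l\<^sup>2 * (y + 1)))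
    = - (d + e) / (1 - l) / N
      + (l * X / (1 - l) - (d * e + l * E) / (l * (1 - l)) - (d * x + e * y) / (1 - l)
        - (d\<^sup>2 + e\<^sup>2) / 2 / (1 - l)\<^sup>2) / N\<^sup>2
      + (l / 2 / (1 - l) - (d * l + e * l + l * l) / (l * (1 - l))
        + (l * (1 - 2 * l) * (3 * x + 3 * y + 2) / 6
          - (1 - 2 * l) * (d + l * (2 * x + 1) + e + l * (2 * y + 1)) / 2
          - (2 * l * d + l\<^sup>2 * (x + 1) + 2 * l * e + l\<^sup>2 * (y + 1)) / 2) / (1 - l)\<^sup>2) / N\<^sup>2"
proof -
  define i g M where "i = 1 / (1 - l)" and "g = 1 / l" and "M = 1 / N"
  have form: "exponent_form l N A B C D F G H J = l * A * i * M + l * B * (1/2) * i * M\<^sup>2 - C * i * M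
    - D * (g * i) * M\<^sup>2
      + l * F * (1/2) * i * M + l * (1 - 2*l) * G * (1/6) * i\<^sup>2 * M\<^sup>2
      - (1 - 2*l) * H * (1/2) * i\<^sup>2 * M\<^sup>2 - J * (1/2) * i\<^sup>2 * M\<^sup>2" for A B C D F G H J
    by (simp add: exponent_form_def i_def g_def M_def power_divide)
  have divide: "z / (1 - l) = z * i" "z / (l * (1 - l)) = z * (g * i)" "z / (1 - l)\<^sup>2 = z * i\<^sup>2"
    "z / N = z * M" "z / N\<^sup>2 = z * M\<^sup>2" for z
    by (simp_all add: i_def g_def M_def power_divide)
  have "(1 - l) * i = 1" using assms(2) by (simp add: i_def)
  then have "i = (1 - l) * i\<^sup>2" by (simp add: power2_eq_square)
  then have "M\<^sup>2 * (i * (d * x + e * y)) = M\<^sup>2 * ((1 - l) * i\<^sup>2 * (d * x + e * y))" by simp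
  then show ?thesis unfolding form divide
    by (simp add: algebra_simps power2_eq_square add_divide_distrib diff_divide_distrib)
qed

lemma log_step_identity:
  fixes l N d e x y E X \<rho> z z1 z2 z3 :: real
  assumes nz: "l \<noteq> 0" "1 - l \<noteq> 0" "N \<noteq> 0"
    and z: "z = z1 + z2 + z3" and z1: "z1 = (d + e) / N"
    and z2: "z2 = \<rho> / N + (x * d + y * e + E + (1 - 2 * l) / (l * (1 - l)) * d * e - l * X) / N\<^sup>2"
  shows "- (d + e) / (1 - l) / N
      + (l * X / (1 - l) - (d * e + l * E) / (l * (1 - l)) - (d * x + e * y) / (1 - l)
        - (d\<^sup>2 + e\<^sup>2) / 2 / (1 - l)\<^sup>2) / N\<^sup>2
      - \<rho> / (1 - l) / N + (z / (1 - l) + z\<^sup>2 / 2 / (1 - l)\<^sup>2)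
    = z3 / (1 - l) + (z2 + z3) * (z1 + z) / 2 / (1 - l)\<^sup>2"
proof -
  define i g M K where "i = 1 / (1 - l)" and "g = 1 / l" and "M = 1 / N" and "K = (1 - 2 * l) * (g * i)"
  have divide: "c / (1 - l) = c * i" "c / (l * (1 - l)) = c * (g * i)" "c / (1 - l)\<^sup>2 = c * i\<^sup>2"
    "c / N = c * M" "c / N\<^sup>2 = c * M\<^sup>2" for c
    by (simp_all add: i_def g_def M_def power_divide)
  have gil: "g * i * l = i" using nz(1) by (simp add: g_def)
  have "(1 - 2 * l) * i + l * i = (1 - l) * i" by (simp add: algebra_simps)
  also have "\<dots> = 1" using nz(2) by (simp add: i_def)
  finally have il: "(1 - 2 * l) * i + l * i = 1" .
  have "i * K + i\<^sup>2 = g * i * ((1 - 2 * l) * i + l * i)"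
    using gil unfolding K_def by (simp add: algebra_simps power2_eq_square)
  then have iK: "i * K + i\<^sup>2 = g * i" unfolding il by simp
  have "- (d + e) * i * M + (l * X * i - (d * e + l * E) * (g * i) - (d * x + e * y) * i
    - (d\<^sup>2 + e\<^sup>2) / 2 * i\<^sup>2) * M\<^sup>2
    - \<rho> * i * M + (z1 * i + z2 * i + z1\<^sup>2 / 2 * i\<^sup>2) = M\<^sup>2 * (d * e * ((i * K + i\<^sup>2) - g * i) + E * (i - g * i * l))"
    unfolding z1 z2 divide K_def[symmetric] by (simp add: algebra_simps power2_eq_square add_divide_distrib)
  also have "\<dots> = 0" by (simp add: iK gil)
  moreover have "z * i + z\<^sup>2 / 2 * i\<^sup>2 = (z1 * i + z2 * i + z1\<^sup>2 / 2 * i\<^sup>2)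
    + (z3 * i + (z2 + z3) * (z1 + z) / 2 * i\<^sup>2)"
    unfolding z by (simp add: power2_eq_square algebra_simps add_divide_distrib)
  ultimately show ?thesis unfolding divide by linarith
qed

subsection \<open>Exposing the arcs one at a time\<close>

abbreviation diag :: "nat \<Rightarrow> (nat \<times> nat) set" where
  "diag n \<equiv> Id_on {..<n}"

lemma arcs_eq: "arcs n = {..<n} \<times> {..<n} - diag n"
  by (auto simp: arcs_def)

lemma arcs_subset: "arcs n \<subseteq> {..<n} \<times> {..<n}"
  by (auto simp: arcs_def)

lemma finite_arcs: "finite (arcs n)"
  by (rule finite_subset[OF arcs_subset]) simp

lemma card_diag: "card (diag n) = n" "finite (diag n)"
proof -
  have "diag n = (\<lambda>i. (i,i)) ` {..<n}" by auto
  then show "card (diag n) = n" "finite (diag n)" by (auto simp: card_image inj_on_def)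
qed

context
  fixes n :: nat and H :: "(nat \<times> nat) set"
  assumes H: "H \<subseteq> arcs n"
begin

lemma card_diag_Un: "card (diag n \<union> H) = n + card H"
proof -
  have "finite H" using H finite_arcs by (rule finite_subset)
  moreover have "diag n \<inter> H = {}" using H by (auto simp: arcs_def)
  ultimately show ?thesis by (simp add: card_Un_disjoint card_diag)
qed

lemma row_diag_Un:
  assumes "j < n"
  shows "row (diag n \<union> H) j = insert j (row H j)" "col (diag n \<union> H) j = insert j (col H j)"
    "j \<notin> row H j" "j \<notin> col H j"
  using assms H by (auto simp: arcs_def)

lemma row_card_diag_Un:
  assumes "j < n"
  shows "row_card (diag n \<union> H) j = row_card H j + 1" "col_card (diag n \<union> H) j = col_card H j + 1"
  using row_diag_Un[OF assms] finite_subset[OF H finite_arcs] by (simp_all add: finite_row)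

end

context near_regular begin

lemma card_matrices_insert_notin:
  assumes "(a,v) \<notin> F" "Q \<subseteq> F" "\<Omega> F Q \<noteq> {}"
  shows "real (card (\<Omega> (insert (a,v) F) Q)) = real (card (\<Omega> F Q)) * (1 - cell_prob F Q a v)"
proof -
  have "card (\<Omega> F Q) > 0" using assms(3) by (simp add: card_gt_0_iff finite_matrices)
  then have "real (card (\<Omega> F Q)) * cell_prob F Q a v = real (card (\<Omega> F Q \<inter> {G. (a,v) \<in> G}))"
    by (simp add: avg_def finite_matrices)
  moreover have "\<Omega> (insert (a,v) F) Q = \<Omega> F Q - {G. (a,v) \<in> G}"
    unfolding matrices_insert_notin[OF assms(1,2)] by auto
  ultimately show ?thesis
    using card_Int_Diff[of "\<Omega> F Q" "{G. (a,v) \<in> G}"] by (simp add: finite_matrices right_diff_distrib)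
qed

definition thin :: "(nat \<times> nat) set \<Rightarrow> bool" where
  "thin H \<longleftrightarrow> H \<subseteq> arcs n \<and> real n + real (card H) \<le> \<theta> * real n
    \<and> (\<forall>a<n. row_card H a + 1 \<le> \<theta> * r \<and> col_card H a + 1 \<le> \<theta> * r)"

lemma thin_subset:
  assumes "thin H" "H' \<subseteq> H"
  shows "thin H'"
proof -
  have fin: "finite H" using assms(1) finite_arcs finite_subset by (auto simp: thin_def)
  have "row H' a \<subseteq> row H a" "col H' a \<subseteq> col H a" for a using assms(2) by auto
  then have "row_card H' a \<le> row_card H a" "col_card H' a \<le> col_card H a" "card H' \<le> card H" for a
    using fin assms(2) by (auto intro!: card_mono finite_row)
  then show ?thesis using assms unfolding thin_def by (smt (verit) of_nat_mono subset_trans)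
qed

lemma thin_admissible:
  assumes "thin H" "\<Omega> (diag n \<union> H) {} \<noteq> {}"
  shows "admissible 0 (diag n \<union> H) {}"
proof -
  have H: "H \<subseteq> arcs n" using assms(1) by (simp add: thin_def)
  have "diag n \<union> H \<subseteq> {..<n} \<times> {..<n}" using H arcs_subset by blast
  then show ?thesis
    using assms card_diag_Un[OF H] row_card_diag_Un[OF H] by (simp add: admissible_def sparse_def thin_def)
qed

end

text \<open>The density \<open>l\<close> is not forced to be the average degree divided by \<open>n\<close>: complementation turns
  \<open>\<lambda>\<close> into \<open>1 - \<lambda> - 1/n\<close>, whereas the exponent is wanted at \<open>1 - \<lambda>\<close>. Avoiding \<open>H\<close> corresponds to
  \<open>\<rho> = l\<close> and \<open>B = 1 - p\<close>, containing \<open>H\<close> to \<open>\<rho> = l - 1\<close> and \<open>B = p\<close> for the complementary degrees.\<close>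

locale arc_exposure = near_regular +
  fixes \<rho> B :: real
  assumes rho: "\<bar>\<rho>\<bar> \<le> 1" and total_eq: "(\<Sum>a<n. real (s a)) = l * (real n)\<^sup>2 + (\<rho> - l) * real n"
    and ln_B: "has_order 3 (-3) (ln B - (ln (1 - l) - \<rho> / (1 - l) / real n))"
begin

definition row_dev :: "(nat \<times> nat) set \<Rightarrow> nat \<Rightarrow> real" where
  "row_dev H j = real (s j) - l * real n + l * row_card H j + (l - \<rho>)"

definition col_dev :: "(nat \<times> nat) set \<Rightarrow> nat \<Rightarrow> real" where
  "col_dev H k = real (t k) - l * real n + l * col_card H k + (l - \<rho>)"

abbreviation pot :: "(nat \<times> nat) set \<Rightarrow> real" where
  "pot H \<equiv> potential l n (row_dev H) (col_dev H) H"

lemma has_order_rho [has_order_intros]: "has_order 0 0 \<rho>"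
  using rho by (rule has_order_unit)

lemma excess_diag_Un:
  assumes "H \<subseteq> arcs n" "j < n"
  shows "row_excess (diag n \<union> H) j = row_dev H j + \<rho>" "col_excess (diag n \<union> H) j = col_dev H j + \<rho>"
  using row_card_diag_Un[OF assms]
  by (simp_all add: row_excess_def col_excess_def row_dev_def col_dev_def algebra_simps)

context
  fixes H :: "(nat \<times> nat) set" and j k :: nat
  assumes H: "H \<subseteq> arcs n" and adm: "admissible 0 (diag n \<union> H) {}"
    and jk: "(j,k) \<in> arcs n" "(j,k) \<notin> H"
begin

abbreviation (input) d where "d \<equiv> row_dev H j"
abbreviation (input) e where "e \<equiv> col_dev H k"
abbreviation (input) x where "x \<equiv> row_card H j"
abbreviation (input) y where "y \<equiv> col_card H k"
abbreviation (input) E where "E \<equiv> (\<Sum>w\<in>row H j. col_dev H w) + (\<Sum>b\<in>col H k. row_dev H b)"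
abbreviation (input) P where "P \<equiv> cell_prob (diag n \<union> H) {} j k"

lemma new_cell: "j < n" "k < n" "(j,k) \<notin> diag n \<union> H"
  using jk by (auto simp: arcs_def)

lemma has_order_devs:
  assumes "a < n"
  shows "has_order 4 1 (row_dev H a)" "has_order 4 1 (col_dev H a)"
    "has_order 3 1 (row_card H a)" "has_order 3 1 (col_card H a)"
proof -
  note sparse = admissibleD(6)[OF adm]
  have eq: "row_dev H a = row_excess (diag n \<union> H) a - \<rho>" "col_dev H a = col_excess (diag n \<union> H) a - \<rho>"
    "row_card H a = row_card (diag n \<union> H) a - 1" "col_card H a = col_card (diag n \<union> H) a - 1"
    using excess_diag_Un[OF H assms] row_card_diag_Un[OF H assms] by simp_all
  show "has_order 4 1 (row_dev H a)" "has_order 4 1 (col_dev H a)"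
    "has_order 3 1 (row_card H a)" "has_order 3 1 (col_card H a)"
    unfolding eq
    by (rule has_order_mono, (rule has_order_row_excess[OF sparse assms] has_order_col_excess[OF sparse assms]
      has_order_row_card[OF sparse assms] has_order_intros | simp)+)+
qed

lemma has_order_sum_devs: "has_order 8 2 E"
proof -
  have sub: "row H j \<subseteq> {..<n}" "col H k \<subseteq> {..<n}" using H arcs_subset by fastforce+
  have "has_order (4 + 3) (1 + 1) (\<Sum>w\<in>row H j. col_dev H w)" "has_order (4 + 3) (1 + 1) (\<Sum>b\<in>col H k. row_dev H b)"
    using sub new_cell by (intro has_order_sum has_order_devs; auto)+
  note orders = this
  show ?thesis by (rule has_order_mono, (rule orders has_order_add | simp)+)
qed

lemma has_order_card_arcs: "has_order 2 2 (real (card H))"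
  using card_diag_Un[OF H] by (intro has_order_dominated[OF has_order_card[OF admissibleD(6)[OF adm]]]) simp

lemmas arc_orders = has_order_devs[OF new_cell(1)] has_order_devs[OF new_cell(2)] has_order_sum_devs
  has_order_card_arcs

lemma potential_increment:
  "has_order 20 (-3) (pot (insert (j,k) H) - pot H - (- (d + e) / (1 - l) / real n
    + (l * real (card H) / (1 - l) - (d * e + l * E) / variance - (d * x + e * y) / (1 - l)
      - (d\<^sup>2 + e\<^sup>2) / 2 / (1 - l)\<^sup>2) / (real n)\<^sup>2))"
proof -
  have H': "finite H" by (rule finite_subset[OF H finite_arcs])
  have devs: "row_dev (insert (j,k) H) i = row_dev H i + l * of_bool (i = j)"
    "col_dev (insert (j,k) H) i = col_dev H i + l * of_bool (i = k)" for i
    by (simp_all add: row_dev_def col_dev_def row_card_insert[OF H' jk(2)] algebra_simps)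
  have nz: "l \<noteq> 0" "1 - l \<noteq> 0" "real n \<noteq> 0" using l_bounds n_pos by auto
  show ?thesis
    unfolding potential_insert[OF H' jk(2) new_cell(1,2) devs] exponent_form_increment[OF nz] add_diff_cancel_left'
    by (rule has_order_mono, (rule arc_orders has_order_intros | simp)+)
qed

lemma cell_prob_arc:
  "has_order 70 (-3) (P - l - (d + e) / real n
    - (\<rho> / real n + (x * d + y * e + E + skewness * d * e - l * real (card H)) / (real n)\<^sup>2))"
proof -
  define E1 E2 K where "E1 = (\<Sum>w\<in>row H j. col_dev H w)" and "E2 = (\<Sum>b\<in>col H k. row_dev H b)" and "K = skewness"
  define R where "R = (x + 1) * \<rho> + d + (y + 1) * \<rho> + e
    + (col_dev H j + \<rho> + x * \<rho>) + (row_dev H k + \<rho> + y * \<rho>) + K * (\<rho> * (d + e + \<rho>))"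
  let ?F = "diag n \<union> H"
  have sub: "row H a \<subseteq> {..<n}" "col H a \<subseteq> {..<n}" "finite (row H a)" "finite (col H a)" for a
    using H arcs_subset finite_subset[OF H finite_arcs] by (fastforce intro: finite_row)+
  have "(\<Sum>w\<in>row H j. col_excess ?F w) = E1 + x * \<rho>" "(\<Sum>b\<in>col H k. row_excess ?F b) = E2 + y * \<rho>"
  proof -
    have "(\<Sum>w\<in>row H j. col_excess ?F w) = (\<Sum>w\<in>row H j. col_dev H w + \<rho>)"
      "(\<Sum>b\<in>col H k. row_excess ?F b) = (\<Sum>b\<in>col H k. row_dev H b + \<rho>)"
      using sub by (auto intro!: sum.cong excess_diag_Un[OF H])
    then show "(\<Sum>w\<in>row H j. col_excess ?F w) = E1 + x * \<rho>" "(\<Sum>b\<in>col H k. row_excess ?F b) = E2 + y * \<rho>"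
      by (simp_all add: sum.distrib E1_def E2_def)
  qed
  then have "excess_along_row ?F j = (col_dev H j + \<rho>) + (E1 + x * \<rho>)"
    "excess_along_col ?F k = (row_dev H k + \<rho>) + (E2 + y * \<rho>)"
    using sub row_diag_Un[OF H] new_cell
    by (simp_all add: excess_along_row_def excess_along_col_def excess_diag_Un[OF H])
  then have corrections: "row_correction ?F j = (x + 1) * (d + \<rho>) + (col_dev H j + \<rho>) + (E1 + x * \<rho>)"
    "col_correction ?F k = (y + 1) * (e + \<rho>) + (row_dev H k + \<rho>) + (E2 + y * \<rho>)"
    using new_cell by (simp_all add: row_correction_def col_correction_def excess_diag_Un[OF H]
      row_card_diag_Un[OF H])
  have total: "total_excess ?F = \<rho> * real n + l * real (card H)"
    unfolding total_excess_def total_eq card_diag_Un[OF H] by (simp add: algebra_simps)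
  have "\<rho> * real n / (real n)\<^sup>2 = \<rho> / real n" using n_pos by (simp add: power2_eq_square)
  then have eq: "P - l - (d + e) / real n
      - (\<rho> / real n + (x * d + y * e + (E1 + E2) + K * d * e - l * real (card H)) / (real n)\<^sup>2)
    = P - (l + (row_excess ?F j + col_excess ?F k) / real n - total_excess ?F / (real n)\<^sup>2
        + (row_correction ?F j + col_correction ?F k) / (real n)\<^sup>2
          + K * row_excess ?F j * col_excess ?F k / (real n)\<^sup>2)
      + R / (real n)\<^sup>2"
    unfolding corrections total excess_diag_Un[OF H new_cell(1)] excess_diag_Un[OF H new_cell(2)] R_def
    by (simp add: algebra_simps add_divide_distrib diff_divide_distrib)
  have R: "has_order 20 1 R" unfolding R_def K_def
    by (rule has_order_mono, (rule arc_orders has_order_intros | simp)+)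
  show ?thesis unfolding E1_def[symmetric] E2_def[symmetric] K_def[symmetric] eq
    by (rule has_order_mono, (rule cell_prob_second_order[OF adm new_cell, folded K_def] R has_order_intros | simp)+)
qed

lemma ln_one_minus_cell_prob:
  "has_order 40 (-3) (ln (1 - P) - (ln (1 - l) - ((P - l) / (1 - l) + (P - l)\<^sup>2 / 2 / (1 - l)\<^sup>2)))"
proof -
  define w where "w = (P - l) / (1 - l)"
  have w_order: "has_order 11 (-1) w" unfolding w_def
    by (rule has_order_mono, (rule cell_prob_rough[OF adm new_cell] has_order_intros | simp)+)
  then have "\<bar>w\<bar> \<le> 1 / 100" by (rule has_order_small) simp_all
  then have w_le: "\<bar>w\<bar> \<le> 1/2" by linarith
  have "(1 - l) * w = P - l" using l_bounds by (simp add: w_def)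
  then have "1 - P = (1 - l) * (1 - w)" by (simp add: right_diff_distrib)
  then have "ln (1 - P) = ln (1 - l) + ln (1 - w)" using l_bounds w_le by (simp add: ln_mult)
  then have eq: "ln (1 - P) - (ln (1 - l) - ((P - l) / (1 - l) + (P - l)\<^sup>2 / 2 / (1 - l)\<^sup>2))
    = ln (1 - w) + w + w\<^sup>2 / 2"
    by (simp add: w_def power_divide)
  show ?thesis unfolding eq
  proof (rule has_order_dominated[OF _ abs_ln_one_minus_cubic_le[OF w_le]])
    show "has_order 40 (-3) (3 * \<bar>w\<bar> ^ 3)" by (rule has_order_mono, (rule w_order has_order_intros | simp)+)
  qed
qed

lemma potential_step:
  "has_order 80 (-3) (pot (insert (j,k) H) - pot H + ln B - ln (1 - P))"
proof -
  define z where "z = P - l"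
  define z1 where "z1 = (d + e) / real n"
  define z2 where "z2 = \<rho> / real n + (x * d + y * e + E + skewness * d * e - l * real (card H)) / (real n)\<^sup>2"
  define z3 where "z3 = z - z1 - z2"
  define \<Delta> where "\<Delta> = - (d + e) / (1 - l) / real n
    + (l * real (card H) / (1 - l) - (d * e + l * E) / variance - (d * x + e * y) / (1 - l)
      - (d\<^sup>2 + e\<^sup>2) / 2 / (1 - l)\<^sup>2) / (real n)\<^sup>2"
  have z: "has_order 10 (-1) z" unfolding z_def by (rule cell_prob_rough[OF adm new_cell])
  have z1: "has_order 6 (-1) z1" unfolding z1_def
    by (rule has_order_mono, (rule arc_orders has_order_intros | simp)+)
  have z2: "has_order 20 (-2) z2" unfolding z2_def
    by (rule has_order_mono, (rule arc_orders has_order_intros | simp)+)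
  have z3: "has_order 70 (-3) z3" unfolding z3_def z_def z1_def z2_def by (rule cell_prob_arc)
  have z3': "has_order 0 (-2) z3" by (rule has_order_absorb[OF z3]) simp_all
  have "\<Delta> - \<rho> / (1 - l) / real n + (z / (1 - l) + z\<^sup>2 / 2 / (1 - l)\<^sup>2)
    = z3 / (1 - l) + (z2 + z3) * (z1 + z) / 2 / (1 - l)\<^sup>2"
    unfolding \<Delta>_def using l_bounds n_pos
    by (intro log_step_identity) (auto simp: z3_def z1_def z2_def)
  then have eq: "pot (insert (j,k) H) - pot H + ln B - ln (1 - P)
    = (pot (insert (j,k) H) - pot H - \<Delta>) + (ln B - (ln (1 - l) - \<rho> / (1 - l) / real n))
      - (ln (1 - P) - (ln (1 - l) - (z / (1 - l) + z\<^sup>2 / 2 / (1 - l)\<^sup>2)))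
      + (z3 / (1 - l) + (z2 + z3) * (z1 + z) / 2 / (1 - l)\<^sup>2)" by simp
  have quadratic: "has_order 40 (-3) ((z2 + z3) * (z1 + z) / 2 / (1 - l)\<^sup>2)"
    by (rule has_order_mono, (rule z z1 z2 z3' has_order_intros | simp)+)
  show ?thesis unfolding eq
    by (rule has_order_mono, (rule potential_increment[folded \<Delta>_def] ln_B ln_one_minus_cell_prob[folded z_def]
        quadratic z3 has_order_intros | simp)+)
qed

end

lemma ln_ratio_eq_potential:
  assumes nonempty: "\<Omega> (diag n) {} \<noteq> {}" and "finite H" "thin H"
  shows "\<Omega> (diag n \<union> H) {} \<noteq> {} \<and>
    \<bar>ln (real (card (\<Omega> (diag n \<union> H) {})) / real (card (\<Omega> (diag n) {}))) - real (card H) * ln B - pot H\<bar>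
      \<le> real (card H) * (\<theta> ^ 80 * r powi (-3))"
  using assms(2,3)
proof (induction H rule: finite_induct)
  case empty
  have "pot {} = 0" by (simp add: potential_def exponent_form_def degree_moment_def row_def)
  then show ?case using nonempty by (simp add: finite_matrices)
next
  case (insert p H)
  obtain j k where p: "p = (j,k)" by (cases p)
  let ?N = "\<lambda>H. real (card (\<Omega> (diag n \<union> H) {}))" and ?P = "cell_prob (diag n \<union> H) {} j k"
  have thin: "thin H" using insert.prems by (rule thin_subset) auto
  have IH: "\<Omega> (diag n \<union> H) {} \<noteq> {}"
    "\<bar>ln (?N H / real (card (\<Omega> (diag n) {}))) - real (card H) * ln B - pot H\<bar>
      \<le> real (card H) * (\<theta> ^ 80 * r powi (-3))"
    using insert.IH[OF thin] by auto
  note adm = thin_admissible[OF thin IH(1)]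
  have H: "H \<subseteq> arcs n" "(j,k) \<in> arcs n" "(j,k) \<notin> H" using insert by (auto simp: p thin_def)
  then have new: "j < n" "k < n" "(j,k) \<notin> diag n \<union> H" by (auto simp: arcs_def)
  have nonempty': "\<Omega> (diag n \<union> insert p H) {} \<noteq> {}"
    using admissibleD(5)[OF admissible_insert(2)[OF adm _ new]] by (simp add: p)
  have pos: "?N H > 0" "real (card (\<Omega> (diag n) {})) > 0" "?P < 1"
    using IH(1) nonempty cell_prob_strict[OF adm new] by (simp_all add: card_gt_0_iff finite_matrices)
  have "?N (insert p H) = ?N H * (1 - ?P)"
    using card_matrices_insert_notin[OF new(3) _ IH(1)] by (simp add: p)
  then have "ln (?N (insert p H) / real (card (\<Omega> (diag n) {})))
    = ln (?N H / real (card (\<Omega> (diag n) {}))) + ln (1 - ?P)"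
    using pos by (simp add: ln_mult ln_div)
  moreover have "\<bar>pot (insert p H) - pot H + ln B - ln (1 - ?P)\<bar> \<le> \<theta> ^ 80 * r powi (-3)"
    using has_orderD[OF potential_step[OF H(1) adm H(2,3)]] by (simp add: p)
  moreover have "real (card (insert p H)) * c = real (card H) * c + c" for c
    using insert.hyps by (simp add: algebra_simps)
  ultimately show ?case using IH(2) nonempty' by (simp only: simp_thms)
qed

end

subsection \<open>Existence of digraphs with given degrees\<close>

definition move_arc :: "nat \<Rightarrow> nat \<Rightarrow> nat \<Rightarrow> (nat \<times> nat) set \<Rightarrow> (nat \<times> nat) set" where
  "move_arc a b v G = insert (b,v) (G - {(a,v)})"

lemma card_move_arc:
  assumes G: "finite G" and ab: "a \<noteq> b" and v: "(a,v) \<in> G" "(b,v) \<notin> G"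
  shows "card (move_arc a b v G) = card G" "card (col (move_arc a b v G) w) = card (col G w)"
    "card (row (move_arc a b v G) c)
      = ((\<lambda>c. card (row G c))(a := card (row G a) - 1, b := card (row G b) + 1)) c"
proof -
  show "card (move_arc a b v G) = card G"
    unfolding move_arc_def by (rule card_exchange) (use v G in auto)
  have "card (insert b (col G v - {a})) = card (col G v)"
    by (rule card_exchange) (use v G in \<open>simp_all add: finite_row\<close>)
  moreover have "col (move_arc a b v G) w = (if w = v then insert b (col G v - {a}) else col G w)"
    using ab by (auto simp: move_arc_def)
  ultimately show "card (col (move_arc a b v G) w) = card (col G w)"
    by (cases "w = v") (simp_all only: if_True if_False simp_thms)
  have "row (move_arc a b v G) c = (if c = a then row G c - {v} else if c = b then insert v (row G c) else row G c)"
    using ab by (auto simp: move_arc_def)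
  then show "card (row (move_arc a b v G) c)
      = ((\<lambda>c. card (row G c))(a := card (row G a) - 1, b := card (row G b) + 1)) c"
    using ab v G by (simp add: finite_row)
qed

lemma move_arc_matrices:
  assumes G: "G \<in> matrices n s t F {}" and v: "v \<in> surplus n F a b G" and ab: "a < n" "b < n" "a \<noteq> b"
  shows "move_arc a b v G \<in> matrices n (s(a := s a - 1, b := s b + 1)) t F {}"
proof -
  note G' = matricesD[OF G]
  have v': "(a,v) \<in> G" "(b,v) \<notin> G" "(b,v) \<notin> F" "v < n" using v by (auto simp: mem_surplus)
  have "move_arc a b v G \<subseteq> {..<n} \<times> {..<n}" "move_arc a b v G \<inter> F = {}"
    using G'(1,2) v' ab by (auto simp: move_arc_def)
  then show ?thesis
    using G'(4,5) ab by (simp add: matrices_def card_move_arc[OF G'(3) ab(3) v'(1,2)])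
qed

lemma matrices_converse:
  assumes "matrices n s t (diag n) {} \<noteq> {}" shows "matrices n t s (diag n) {} \<noteq> {}"
proof -
  obtain G where "G \<in> matrices n s t (diag n) {}" using assms by blast
  then have "G\<inverse> \<in> matrices n t s (diag n) {}" by (auto simp: matrices_def)
  then show ?thesis by blast
qed

lemma sum_remove2:
  fixes f :: "'a \<Rightarrow> 'b :: comm_monoid_add"
  assumes "finite A" "a \<in> A" "b \<in> A" "a \<noteq> b"
  shows "(\<Sum>c\<in>A. f c) = f a + (f b + (\<Sum>c\<in>A - {a,b}. f c))"
proof -
  have "(\<Sum>c\<in>A - {a}. f c) = f b + (\<Sum>c\<in>A - {a} - {b}. f c)" using assms by (intro sum.remove) auto
  also have "A - {a} - {b} = A - {a,b}" by auto
  finally show ?thesis using assms by (simp add: sum.remove)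
qed

lemma sum_fun_upd2:
  fixes F :: "'a \<Rightarrow> 'c \<Rightarrow> 'b :: comm_monoid_add"
  assumes "finite A" "a \<in> A" "b \<in> A" "a \<noteq> b"
  shows "(\<Sum>c\<in>A. F c ((f(a := x, b := y)) c)) = F a x + (F b y + (\<Sum>c\<in>A - {a,b}. F c (f c)))"
proof -
  have "(\<Sum>c\<in>A - {a,b}. F c ((f(a := x, b := y)) c)) = (\<Sum>c\<in>A - {a,b}. F c (f c))"
    by (intro sum.cong) auto
  then show ?thesis using assms(4) by (simp add: sum_remove2[OF assms])
qed

lemma exists_less_of_sum_eq:
  fixes f g :: "'a \<Rightarrow> nat"
  assumes "finite A" "(\<Sum>x\<in>A. f x) = (\<Sum>x\<in>A. g x)" "x \<in> A" "f x \<noteq> g x"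
  shows "\<exists>y\<in>A. f y < g y"
proof (rule ccontr)
  assume "\<not> ?thesis"
  then have "g y \<le> f y" if "y \<in> A" for y using that by (meson not_le)
  then have "g x = f x" using assms by (intro sum_mono_inv[of g A f]) auto
  then show False using assms(4) by simp
qed

context near_regular begin

lemma converse_near_regular: "near_regular \<theta> r n t s l"
proof unfold_locales
  have "(\<Sum>a<n. real (t a)) = (\<Sum>a<n. real (s a))" using sum_eq by (simp flip: of_nat_sum)
  then show "\<bar>(\<Sum>a<n. real (t a)) - l * (real n)\<^sup>2\<bar> \<le> \<theta> * real n" using total_dev by simp
qed (use n_eq l_ge l_le s_dev t_dev sum_eq in auto)

lemma near_regular_between:
  assumes "near_regular \<theta> r n s0 t l" "(\<Sum>a<n. s' a) = (\<Sum>a<n. s a)"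
    and between: "\<And>a. a < n \<Longrightarrow> s a \<le> s' a \<and> s' a \<le> s0 a \<or> s0 a \<le> s' a \<and> s' a \<le> s a"
  shows "near_regular \<theta> r n s' t l"
proof -
  interpret other: near_regular \<theta> r n s0 t l by (rule assms(1))
  show ?thesis
  proof unfold_locales
    show "\<bar>real (s' a) - l * real n\<bar> \<le> \<theta> * r" if "a < n" for a
      using between[OF that] s_dev[OF that] other.s_dev[OF that] by linarith
    have "(\<Sum>a<n. real (s' a)) = (\<Sum>a<n. real (s a))" using assms(2) by (simp flip: of_nat_sum)
    then show "\<bar>(\<Sum>a<n. real (s' a)) - l * (real n)\<^sup>2\<bar> \<le> \<theta> * real n" using total_dev by simp
  qed (use n_eq l_ge l_le t_dev sum_eq assms(2) in auto)
qed

lemma admissible_diag: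
  assumes "\<Omega> (diag n) {} \<noteq> {}"
  shows "admissible 0 (diag n) {}"
proof -
  have "row (diag n) a = {a}" "col (diag n) a = {a}" if "a < n" for a using that by auto
  moreover have "1 \<le> \<theta> * r" "real n \<le> \<theta> * real n"
    using mult_mono[of 1 \<theta> 1 r] mult_right_mono[of 1 \<theta> "real n"] theta_pos r_pos by simp_all
  ultimately show ?thesis using assms by (auto simp: admissible_def sparse_def card_diag)
qed

lemma exists_codegree_le:
  assumes adm: "admissible k F Q" and ab: "a < n" "b < n" "a \<noteq> b"
  shows "\<exists>G\<in>\<Omega> F Q. codegree G a b \<le> l\<^sup>2 * real n + \<theta> ^ 6 * r"
proof -
  let ?dev = "\<lambda>G. (codegree G a b - l\<^sup>2 * real n) ^ 4"
  obtain G where G: "G \<in> \<Omega> F Q" and G_le: "?dev G \<le> avg (\<Omega> F Q) ?dev"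
    using exists_le_avg[OF finite_matrices admissibleD(5)[OF adm], of ?dev] by blast
  have "has_order (6 * 4) (1 * int 4) (?dev G)"
  proof (rule has_order_dominated)
    show "has_order (6 * 4) (1 * int 4) (avg (\<Omega> F Q) ?dev)"
      using has_order_codegree_power4[OF adm ab(1,2) ab(3)[symmetric]] by simp
    have "\<bar>?dev G\<bar> = ?dev G" by simp
    then show "\<bar>?dev G\<bar> \<le> avg (\<Omega> F Q) ?dev" using G_le by (rule ord_eq_le_trans)
  qed
  then have "has_order 6 1 (codegree G a b - l\<^sup>2 * real n)" by (rule has_order_of_power) simp
  then have "codegree G a b \<le> l\<^sup>2 * real n + \<theta> ^ 6 * r" using has_orderD by fastforce
  then show ?thesis using G by blast
qed

lemma exists_surplus:
  assumes nonempty: "\<Omega> (diag n) {} \<noteq> {}" and ab: "a < n" "b < n" "a \<noteq> b"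
  shows "\<exists>G\<in>\<Omega> (diag n) {}. surplus n (diag n) a b G \<noteq> {}"
proof -
  obtain G where G: "G \<in> \<Omega> (diag n) {}" and codegree: "codegree G a b \<le> l\<^sup>2 * real n + \<theta> ^ 6 * r"
    using exists_codegree_le[OF admissible_diag[OF nonempty] ab] by blast
  have "frozen_cols (diag n) a b = {a, b}" using ab by auto
  then have frozen: "real (card (row G a \<inter> frozen_cols (diag n) a b)) \<le> 2"
    using card_mono[of "{a,b}" "row G a \<inter> {a,b}"] ab by simp
  have "real (card (row G a \<inter> row G b \<inter> free_cols n (diag n) a b)) \<le> codegree G a b"
    using matricesD(3)[OF G] by (auto intro!: card_mono finite_row)
  then have surplus_ge: "real (card (surplus n (diag n) a b G)) \<ge> variance * real n - (\<theta> * r + \<theta> ^ 6 * r + 2)"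
    using card_surplus[OF G ab(1), of "diag n" b] frozen codegree s_dev[OF ab(1)]
    by (simp add: algebra_simps power2_eq_square)
  have "has_order 8 1 (\<theta> * r + \<theta> ^ 6 * r + 2)"
    by (rule has_order_mono, (rule has_order_intros | simp)+)
  then have "\<bar>\<theta> * r + \<theta> ^ 6 * r + 2\<bar> < variance * real n" by (rule has_order_less_variance_n) simp
  then have "real (card (surplus n (diag n) a b G)) > 0" using surplus_ge by linarith
  then show ?thesis using G by (auto simp: card_gt_0_iff)
qed

end

lemma matrices_nonempty_transfer:
  assumes s0: "near_regular \<theta> r n s0 t l" "matrices n s0 t (diag n) {} \<noteq> {}" and s: "near_regular \<theta> r n s t l"
  shows "matrices n s t (diag n) {} \<noteq> {}"
  using s
proof (induction "\<Sum>a<n. nat \<bar>int (s a) - int (s0 a)\<bar>" arbitrary: s rule: less_induct)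
  case less
  show ?case
  proof (cases "\<forall>a<n. s a = s0 a")
    case True
    then show ?thesis using s0(2) matrices_cong[of n s s0] by auto
  next
    case False
    then obtain c where c: "c \<in> {..<n}" "s c \<noteq> s0 c" by auto
    have sums: "(\<Sum>a<n. s a) = (\<Sum>a<n. s0 a)"
      using near_regular.sum_eq[OF s0(1)] near_regular.sum_eq[OF less.prems] by simp
    obtain a where a: "a < n" "s a < s0 a" using exists_less_of_sum_eq[OF _ sums c] by auto
    obtain b where b: "b < n" "s0 b < s b"
      using exists_less_of_sum_eq[OF _ sums[symmetric] c(1)] c(2) by auto
    have ab: "a \<noteq> b" using a b by auto
    define s' where "s' = s(a := s a + 1, b := s b - 1)"
    have mem: "finite {..<n}" "a \<in> {..<n}" "b \<in> {..<n}" using a b by simp_all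
    note split_s' = sum_fun_upd2[OF mem ab, where f = s and x = "s a + 1" and y = "s b - 1", folded s'_def]
    have sum': "(\<Sum>c<n. s' c) = (\<Sum>c<n. s c)"
      using split_s'[of "\<lambda>_ k. k"] sum_remove2[OF mem ab, of s] b by simp
    have decreases: "(\<Sum>c<n. nat \<bar>int (s' c) - int (s0 c)\<bar>) < (\<Sum>c<n. nat \<bar>int (s c) - int (s0 c)\<bar>)"
      using split_s'[of "\<lambda>c k. nat \<bar>int k - int (s0 c)\<bar>"]
        sum_remove2[OF mem ab, of "\<lambda>c. nat \<bar>int (s c) - int (s0 c)\<bar>"] a b
      by simp
    have near': "near_regular \<theta> r n s' t l"
      using a b ab by (intro near_regular.near_regular_between[OF less.prems s0(1) sum']) (auto simp: s'_def)
    obtain G v where "G \<in> matrices n s' t (diag n) {}" "v \<in> surplus n (diag n) a b G"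
      using near_regular.exists_surplus[OF near' less.hyps[OF decreases near'] a(1) b(1) ab] by blast
    then have "move_arc a b v G \<in> matrices n (s'(a := s' a - 1, b := s' b + 1)) t (diag n) {}"
      using a b ab by (intro move_arc_matrices)
    moreover have "s'(a := s' a - 1, b := s' b + 1) = s" using a b ab by (auto simp: s'_def)
    ultimately show ?thesis by auto
  qed
qed

lemma sum_squares_move_arc_less:
  assumes ab: "a < n" "b < n" and G: "finite G" "(a,v) \<in> G" "(b,v) \<notin> G"
    and gap: "card (row G b) + 1 < card (row G a)"
  shows "(\<Sum>c<n. (card (row (move_arc a b v G) c))\<^sup>2) < (\<Sum>c<n. (card (row G c))\<^sup>2)"
proof -
  have ab': "a \<noteq> b" using gap by auto
  have mem: "finite {..<n}" "a \<in> {..<n}" "b \<in> {..<n}" using ab by simp_all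
  obtain m where m: "card (row G a) = card (row G b) + 2 + m"
    using gap by (auto simp: less_iff_Suc_add)
  show ?thesis
    unfolding card_move_arc(3)[OF G(1) ab' G(2,3)] sum_fun_upd2[OF mem ab', where F = "\<lambda>_ k. k\<^sup>2"]
      sum_remove2[OF mem ab', of "\<lambda>c. (card (row G c))\<^sup>2"]
    by (simp add: m power2_eq_square algebra_simps)
qed

text \<open>A digraph that minimises the sum of the squared degrees is balanced: otherwise moving an arc
  from a large row to a small one would decrease the sum.\<close>

lemma balanced_rows:
  assumes G: "G \<subseteq> arcs n"
    and min: "\<And>G'. G' \<subseteq> arcs n \<Longrightarrow> card G' = card G \<Longrightarrow>
      (\<Sum>a<n. (card (row G a))\<^sup>2) + (\<Sum>v<n. (card (col G v))\<^sup>2)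
        \<le> (\<Sum>a<n. (card (row G' a))\<^sup>2) + (\<Sum>v<n. (card (col G' v))\<^sup>2)"
    and ab: "a < n" "b < n"
  shows "card (row G a) \<le> card (row G b) + 1"
proof (rule ccontr)
  assume "\<not> ?thesis"
  then have gap: "card (row G b) + 1 < card (row G a)" by simp
  then have ab': "a \<noteq> b" by auto
  have fin: "finite G" by (rule finite_subset[OF G finite_arcs])
  have "card (insert b (row G b)) < card (row G a)" using gap fin by (simp add: card_insert_if finite_row)
  then have "\<not> row G a \<subseteq> insert b (row G b)"
    using card_mono[of "insert b (row G b)" "row G a"] fin by (auto simp: finite_row)
  then obtain v where "v \<in> row G a" "v \<notin> insert b (row G b)" by blast
  then have v: "(a,v) \<in> G" "(b,v) \<notin> G" "v \<noteq> b" by auto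
  have "move_arc a b v G \<subseteq> arcs n" using G ab v by (auto simp: move_arc_def arcs_def)
  from min[OF this card_move_arc(1)[OF fin ab' v(1,2)]] show False
    using sum_squares_move_arc_less[OF ab fin v(1,2) gap] by (simp add: card_move_arc(2)[OF fin ab' v(1,2)])
qed

lemma exists_balanced_digraph:
  assumes "D \<le> card (arcs n)"
  shows "\<exists>G\<subseteq>arcs n. card G = D \<and>
    (\<forall>a<n. \<forall>b<n. card (row G a) \<le> card (row G b) + 1 \<and> card (col G a) \<le> card (col G b) + 1)"
proof -
  define f where "f G = (\<Sum>a<n. (card (row G a))\<^sup>2) + (\<Sum>v<n. (card (col G v))\<^sup>2)" for G
  obtain G0 where "G0 \<subseteq> arcs n" "card G0 = D" using assms obtain_subset_with_card_n by metis
  then obtain G where G: "G \<subseteq> arcs n" "card G = D" and min: "\<And>G'. G' \<subseteq> arcs n \<Longrightarrow> card G' = D \<Longrightarrow> f G \<le> f G'"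
    using ex_has_least_nat[of "\<lambda>G. G \<subseteq> arcs n \<and> card G = D" G0 f] by auto
  have "card (row G a) \<le> card (row G b) + 1" if "a < n" "b < n" for a b
    using min G that by (intro balanced_rows) (auto simp: f_def)
  moreover have "card (col G a) \<le> card (col G b) + 1" if "a < n" "b < n" for a b
  proof (rule balanced_rows[OF _ _ that])
    show "G\<inverse> \<subseteq> arcs n" using G(1) by (auto simp: arcs_def)
    fix G' assume G': "G' \<subseteq> arcs n" "card G' = card (G\<inverse>)"
    have "f G \<le> f (G'\<inverse>)" using G' G(2) by (intro min) (auto simp: arcs_def)
    then show "(\<Sum>a<n. (card (row (G\<inverse>) a))\<^sup>2) + (\<Sum>v<n. (card (col (G\<inverse>) v))\<^sup>2)
      \<le> (\<Sum>a<n. (card (row G' a))\<^sup>2) + (\<Sum>v<n. (card (col G' v))\<^sup>2)" by (simp add: f_def)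
  qed
  ultimately show ?thesis using G by blast
qed

context near_regular begin

lemma sum_le_card_arcs: "(\<Sum>a<n. s a) \<le> card (arcs n)"
proof -
  have "card (arcs n) = n * n - n"
    unfolding arcs_eq by (subst card_Diff_subset) (auto simp: card_diag)
  then have card: "real (card (arcs n)) = (real n)\<^sup>2 - real n" by (simp add: of_nat_diff power2_eq_square)
  have "has_order 2 1 (\<theta> + 1)"
    by (rule has_order_mono, (rule has_order_intros | simp)+)
  then have "\<bar>\<theta> + 1\<bar> < (1 - l) * real n" by (rule has_order_less_complement_n) simp
  then have "(\<theta> + 1) * real n \<le> (1 - l) * real n * real n" by (intro mult_right_mono) auto
  then have "(\<Sum>a<n. real (s a)) \<le> real (card (arcs n))"
    using total_dev by (simp add: card power2_eq_square algebra_simps)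
  then show ?thesis by (simp flip: of_nat_sum)
qed

lemma balanced_dev:
  fixes f :: "nat \<Rightarrow> nat"
  assumes f: "\<And>a b. a < n \<Longrightarrow> b < n \<Longrightarrow> f a \<le> f b + 1" and sum_f: "(\<Sum>a<n. f a) = (\<Sum>a<n. s a)" and a: "a < n"
  shows "\<bar>real (f a) - l * real n\<bar> \<le> \<theta> * r"
proof -
  have "real (f a) \<le> real (f b) + 1" "real (f b) \<le> real (f a) + 1" if "b < n" for b
    using f[OF a that] f[OF that a] by (metis of_nat_1 of_nat_add of_nat_le_iff)+
  then have "(\<Sum>b<n. real (f a)) \<le> (\<Sum>b<n. real (f b) + 1)" "(\<Sum>b<n. real (f b)) \<le> (\<Sum>b<n. real (f a) + 1)"
    by (intro sum_mono; simp)+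
  moreover have "(\<Sum>b<n. real (f b)) = (\<Sum>b<n. real (s b))" using sum_f by (simp flip: of_nat_sum)
  ultimately have bound: "\<bar>real n * real (f a) - l * (real n)\<^sup>2\<bar> \<le> real n * (\<theta> + 1)"
    using total_dev by (simp add: sum.distrib algebra_simps)
  have factor: "real n * real (f a) - l * (real n)\<^sup>2 = real n * (real (f a) - l * real n)"
    by (simp add: power2_eq_square algebra_simps)
  have "real n * \<bar>real (f a) - l * real n\<bar> \<le> real n * (\<theta> + 1)"
    using bound unfolding factor abs_mult by simp
  then have "\<bar>real (f a) - l * real n\<bar> \<le> \<theta> + 1" using n_pos by simp
  also have "\<theta> + 1 \<le> \<theta> * 2" using theta_pos by simp
  also have "\<dots> \<le> \<theta> * r" using theta_pos r_ge_10000 by (intro mult_left_mono) auto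
  finally show ?thesis .
qed

theorem matrices_nonempty: "\<Omega> (diag n) {} \<noteq> {}"
proof -
  obtain G where G: "G \<subseteq> arcs n" "card G = (\<Sum>a<n. s a)"
    and balanced: "\<And>a b. a < n \<Longrightarrow> b < n \<Longrightarrow> card (row G a) \<le> card (row G b) + 1 \<and> card (col G a) \<le> card (col G b) + 1"
    using exists_balanced_digraph[OF sum_le_card_arcs] by blast
  define s0 t0 where "s0 a = card (row G a)" and "t0 v = card (col G v)" for a v
  have "G \<subseteq> {..<n} \<times> {..<n}" "G\<inverse> \<subseteq> {..<n} \<times> {..<n}" using G(1) arcs_subset by auto
  then have sums: "(\<Sum>a<n. s0 a) = (\<Sum>a<n. s a)" "(\<Sum>v<n. t0 v) = (\<Sum>a<n. s a)"
    using G(2) by (simp_all add: s0_def t0_def sum_card_row)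
  have near: "near_regular \<theta> r n s' t' l"
    if "s' \<in> {s, s0}" "t' \<in> {t, t0}" for s' t'
  proof unfold_locales
    have "s0 a \<le> s0 b + 1" "t0 a \<le> t0 b + 1" if "a < n" "b < n" for a b
      using balanced[OF that] by (simp_all add: s0_def t0_def)
    then show "\<bar>real (s' a) - l * real n\<bar> \<le> \<theta> * r" "\<bar>real (t' a) - l * real n\<bar> \<le> \<theta> * r" if "a < n" for a
      using \<open>s' \<in> {s, s0}\<close> \<open>t' \<in> {t, t0}\<close> s_dev[OF that] t_dev[OF that]
        balanced_dev[OF _ sums(1) that] balanced_dev[OF _ sums(2) that] by auto
    have sum': "(\<Sum>a<n. s' a) = (\<Sum>a<n. s a)" "(\<Sum>a<n. t' a) = (\<Sum>a<n. s a)"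
      using \<open>s' \<in> {s, s0}\<close> \<open>t' \<in> {t, t0}\<close> sums sum_eq by auto
    then show "(\<Sum>a<n. s' a) = (\<Sum>a<n. t' a)" by simp
    have "(\<Sum>a<n. real (s' a)) = (\<Sum>a<n. real (s a))" using sum'(1) by (simp flip: of_nat_sum)
    then show "\<bar>(\<Sum>a<n. real (s' a)) - l * (real n)\<^sup>2\<bar> \<le> \<theta> * real n" using total_dev by simp
  qed (use n_eq l_ge l_le in auto)
  have "G \<in> matrices n s0 t0 (diag n) {}"
    using G(1) by (auto simp: matrices_def s0_def t0_def arcs_def)
  then have "matrices n s t0 (diag n) {} \<noteq> {}"
    using matrices_nonempty_transfer[OF near[of s0 t0] _ near[of s t0]] by auto
  then have "matrices n t s (diag n) {} \<noteq> {}"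
    using matrices_nonempty_transfer[OF near_regular.converse_near_regular[OF near[of s t0]]
      matrices_converse converse_near_regular]
    by auto
  then show ?thesis by (rule matrices_converse)
qed

end

subsection \<open>Probabilities of avoiding and of containing \<open>H\<close>\<close>

lemma outdeg_eq: "outdeg G j = card (row G j)"
  and indeg_eq: "indeg G k = card (col G k)"
  by (simp_all add: outdeg_def indeg_def row_def)

lemma digraphs_deg_avoiding: "{G \<in> digraphs_deg n s t. G \<inter> H = {}} = matrices n s t (diag n \<union> H) {}"
  by (auto simp: digraphs_deg_def matrices_def outdeg_eq indeg_eq arcs_eq)

lemma digraphs_deg_eq: "digraphs_deg n s t = matrices n s t (diag n) {}"
  using digraphs_deg_avoiding[of n s t "{}"] by simp

lemma Xarcs_eq:
  assumes "H \<subseteq> arcs n" shows "Xarcs n H = real (card H)"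
  using sum_card_row[of H n] assms arcs_subset[of n]
  unfolding Xarcs_def outdeg_eq by (simp flip: of_nat_sum)

lemma (in arc_exposure) prob_avoid:
  assumes H: "thin H" and B: "B > 0"
  shows "\<exists>d. \<bar>d\<bar> \<le> real (card H) * (\<theta> ^ 80 * r powi (-3)) \<and>
    prob_D n s t (\<lambda>G. G \<inter> H = {}) = B powr real (card H) * exp (pot H + d)"
proof -
  let ?N = "real (card (\<Omega> (diag n \<union> H) {}))" and ?Z = "real (card (\<Omega> (diag n) {}))"
  have "finite H" using H finite_arcs finite_subset by (auto simp: thin_def)
  note ratio = ln_ratio_eq_potential[OF matrices_nonempty this H]
  define d where "d = ln (?N / ?Z) - real (card H) * ln B - pot H"
  have pos: "?N > 0" "?Z > 0" using ratio matrices_nonempty by (simp_all add: card_gt_0_iff finite_matrices)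
  have "prob_D n s t (\<lambda>G. G \<inter> H = {}) = ?N / ?Z"
    unfolding prob_D_def digraphs_deg_avoiding unfolding digraphs_deg_eq ..
  also have "\<dots> = exp (ln (?N / ?Z))" using pos by simp
  also have "ln (?N / ?Z) = real (card H) * ln B + (pot H + d)" by (simp add: d_def)
  also have "exp \<dots> = B powr real (card H) * exp (pot H + d)" using B by (simp add: powr_def exp_add)
  finally show ?thesis using ratio unfolding d_def by blast
qed

lemma potential_cong:
  assumes "H \<subseteq> arcs n" "\<And>j. j < n \<Longrightarrow> \<delta> j = \<delta>' j" "\<And>k. k < n \<Longrightarrow> \<eta> k = \<eta>' k"
  shows "potential l n \<delta> \<eta> H = potential l n \<delta>' \<eta>' H"
proof -
  have "degree_moment n \<delta> \<eta> H h k = degree_moment n \<delta>' \<eta>' H h k" for h k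
    unfolding degree_moment_def by (intro arg_cong2[of _ _ _ _ "(+)"] sum.cong) (auto simp: assms)
  moreover have "(\<Sum>(j,k)\<in>H. \<delta> j * \<eta> k) = (\<Sum>(j,k)\<in>H. \<delta>' j * \<eta>' k)"
    using assms(1) by (intro sum.cong) (auto simp: assms(2,3) arcs_def)
  ultimately show ?thesis unfolding potential_def by simp
qed

lemma potential_eq_Mexp:
  assumes "H \<subseteq> arcs n"
  shows "potential (lam n s) n (dlt n s H) (eta n s t H) H = Mexp n s t H"
  unfolding potential_def exponent_form_def degree_moment_def Mexp_def Let_def Xarcs_eq[OF assms]
    Rs_def Cs_def outdeg_eq indeg_eq Ysum_def ..

lemma exponent_form_complement:
  fixes l N X X2 R02 R03 R11 R12 R21 Y :: real
  shows "exponent_form (1 - l) N X X2 (R02 - R11) Y R02 R03 (R03 - R12) (R03 - 2 * R12 + R21)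
    = (1 - l) * X / (l * N) + (1 - l) * X2 / (2 * l * N\<^sup>2) + R11 / (l * N) - R21 / (2 * l\<^sup>2 * N\<^sup>2)
      - (1 + l) * R02 / (2 * l * N) + (1 + 2*l) * R12 / (2 * l\<^sup>2 * N\<^sup>2)
      - (1 + l) * (1 + 2*l) * R03 / (6 * l\<^sup>2 * N\<^sup>2) - Y / (l * (1 - l) * N\<^sup>2)"
proof -
  define g i M where "g = 1 / l" and "i = 1 / (1 - l)" and "M = 1 / N"
  have "exponent_form (1 - l) N X X2 (R02 - R11) Y R02 R03 (R03 - R12) (R03 - 2 * R12 + R21)
    = (1 - l) * X * g * M + (1 - l) * X2 / 2 * g * M\<^sup>2 - (R02 - R11) * g * M - Y * (g * i) * M\<^sup>2
      + (1 - l) * R02 / 2 * g * M + (1 - l) * (1 - 2 * (1 - l)) * R03 / 6 * g\<^sup>2 * M\<^sup>2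
      - (1 - 2 * (1 - l)) * (R03 - R12) / 2 * g\<^sup>2 * M\<^sup>2 - (R03 - 2 * R12 + R21) / 2 * g\<^sup>2 * M\<^sup>2"
    by (simp add: exponent_form_def g_def i_def M_def power_divide mult.commute)
  also have "\<dots> = (1 - l) * X * g * M + (1 - l) * X2 / 2 * g * M\<^sup>2 + R11 * g * M - R21 / 2 * g\<^sup>2 * M\<^sup>2
      - (1 + l) * R02 / 2 * g * M + (1 + 2*l) * R12 / 2 * g\<^sup>2 * M\<^sup>2
      - (1 + l) * (1 + 2*l) * R03 / 6 * g\<^sup>2 * M\<^sup>2 - Y * (g * i) * M\<^sup>2"
    by (simp add: algebra_simps power2_eq_square add_divide_distrib diff_divide_distrib)
  finally show ?thesis by (simp add: g_def i_def M_def power_divide)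
qed

lemma potential_eq_Texp:
  assumes "H \<subseteq> arcs n"
  shows "potential (1 - lam n s) n (\<lambda>j. row_card H j - dlt n s H j) (\<lambda>k. col_card H k - eta n s t H k) H
    = Texp n s t H"
proof -
  define S where "S h k = Rs n s H h k + Cs n s t H h k" for h k
  let ?\<delta> = "\<lambda>j. row_card H j - dlt n s H j" and ?\<eta> = "\<lambda>k. col_card H k - eta n s t H k"
  have moments: "degree_moment n ?\<delta> ?\<eta> H 1 1 = S 0 2 - S 1 1"
    "degree_moment n ?\<delta> ?\<eta> H 0 2 = S 0 2" "degree_moment n ?\<delta> ?\<eta> H 0 3 = S 0 3"
    "degree_moment n ?\<delta> ?\<eta> H 1 2 = S 0 3 - S 1 2"
    "degree_moment n ?\<delta> ?\<eta> H 2 1 = S 0 3 - 2 * S 1 2 + S 2 1"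
    by (simp_all add: degree_moment_def S_def Rs_def Cs_def outdeg_eq indeg_eq sum_subtractf sum.distrib
        sum_distrib_left power2_eq_square power3_eq_cube algebra_simps)
  have arcs: "(\<Sum>(j,k)\<in>H. ?\<delta> j * ?\<eta> k) = Ysum n s t H - Y01 n s H - Y10 n s t H + Y11 H"
    unfolding Ysum_def Y01_def Y10_def Y11_def outdeg_eq indeg_eq sum_subtractf[symmetric] sum.distrib[symmetric]
    by (intro sum.cong refl) (auto simp: algebra_simps)
  show ?thesis
    unfolding potential_def moments arcs exponent_form_complement Texp_def Let_def Xarcs_eq[OF assms] S_def ..
qed

subsection \<open>Complementation\<close>

context
  fixes n :: nat and s t :: "nat \<Rightarrow> nat"
  assumes degree_le: "\<And>j. j < n \<Longrightarrow> s j \<le> n - 1" "\<And>j. j < n \<Longrightarrow> t j \<le> n - 1"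
begin

lemma card_row_complement:
  assumes "G \<subseteq> arcs n" "j < n"
  shows "card (row (arcs n - G) j) = n - 1 - card (row G j)" "card (col (arcs n - G) j) = n - 1 - card (col G j)"
proof -
  have "row (arcs n - G) j = ({..<n} - {j}) - row G j" "col (arcs n - G) j = ({..<n} - {j}) - col G j"
    using assms by (auto simp: arcs_def)
  moreover have "row G j \<subseteq> {..<n} - {j}" "col G j \<subseteq> {..<n} - {j}" using assms by (auto simp: arcs_def)
  ultimately show "card (row (arcs n - G) j) = n - 1 - card (row G j)"
    "card (col (arcs n - G) j) = n - 1 - card (col G j)"
    using assms(2) by (simp_all add: card_Diff_subset finite_subset)
qed

lemma card_digraphs_deg_complement:
  "card {G \<in> digraphs_deg n s t. P G}
    = card {G \<in> digraphs_deg n (\<lambda>j. n - 1 - s j) (\<lambda>j. n - 1 - t j). P (arcs n - G)}"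
proof -
  let ?c = "\<lambda>G. arcs n - G"
  have involution: "?c (?c G) = G" if "G \<in> digraphs_deg n s' t'" for G s' t'
    using that by (auto simp: digraphs_deg_def)
  have complement: "?c G \<in> digraphs_deg n (\<lambda>j. n - 1 - s' j) (\<lambda>j. n - 1 - t' j)"
    if "G \<in> digraphs_deg n s' t'" for G s' t'
    using that card_row_complement[of G] by (simp add: digraphs_deg_def outdeg_eq indeg_eq)
  have "n - 1 - (n - 1 - s j) = s j" "n - 1 - (n - 1 - t j) = t j" if "j < n" for j
    using degree_le[OF that] by simp_all
  then have degrees: "digraphs_deg n (\<lambda>j. n - 1 - (n - 1 - s j)) (\<lambda>j. n - 1 - (n - 1 - t j)) = digraphs_deg n s t"
    by (auto simp: digraphs_deg_def simp del: diff_diff_left)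
  show ?thesis
  proof (rule bij_betw_same_card[of ?c], rule bij_betw_byWitness[where f' = ?c])
    show "?c ` {G \<in> digraphs_deg n s t. P G}
      \<subseteq> {G \<in> digraphs_deg n (\<lambda>j. n - 1 - s j) (\<lambda>j. n - 1 - t j). P (?c G)}"
    proof (rule image_subsetI)
      fix G assume "G \<in> {G \<in> digraphs_deg n s t. P G}"
      then show "?c G \<in> {G \<in> digraphs_deg n (\<lambda>j. n - 1 - s j) (\<lambda>j. n - 1 - t j). P (?c G)}"
        using involution[of G s t] complement[of G s t] by simp
    qed
    show "?c ` {G \<in> digraphs_deg n (\<lambda>j. n - 1 - s j) (\<lambda>j. n - 1 - t j). P (?c G)}
      \<subseteq> {G \<in> digraphs_deg n s t. P G}"
      using complement[of _ "\<lambda>j. n - 1 - s j" "\<lambda>j. n - 1 - t j"] unfolding degrees by auto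
  qed (use involution in blast)+
qed

lemma prob_contain_eq_prob_avoid:
  assumes "H \<subseteq> arcs n"
  shows "prob_D n s t (\<lambda>G. H \<subseteq> G) = prob_D n (\<lambda>j. n - 1 - s j) (\<lambda>j. n - 1 - t j) (\<lambda>G. G \<inter> H = {})"
proof -
  have "H \<subseteq> arcs n - G \<longleftrightarrow> G \<inter> H = {}" for G using assms by auto
  then show ?thesis
    unfolding prob_D_def
    using card_digraphs_deg_complement[of "\<lambda>G. H \<subseteq> G"] card_digraphs_deg_complement[of "\<lambda>_. True"] by simp
qed

end

subsection \<open>Estimates on a given scale\<close>

context near_regular begin

lemma has_order_ln_one_minus_density:
  defines "p \<equiv> l * real n / (real n - 1)"
  shows "1 - p > 0" "has_order 3 (-3) (ln (1 - p) - (ln (1 - l) - l / (1 - l) / real n))"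
proof -
  define w where "w = l / (1 - l) / (real n - 1)"
  have eq: "1 - p = (1 - l) * (1 - w)"
    using l_bounds n_ge by (simp add: p_def w_def divide_simps) (simp add: algebra_simps)
  have w_order: "has_order 2 (-2) w" unfolding w_def
    by (rule has_order_mono, (rule has_order_inverse_n_minus_1 has_order_intros | simp)+)
  then have "\<bar>w\<bar> \<le> 1 / 100" by (rule has_order_small) simp_all
  then have w: "\<bar>w\<bar> \<le> 1/2" by linarith
  then show "1 - p > 0" unfolding eq using l_bounds by simp
  have "ln (1 - p) = ln (1 - l) + ln (1 - w)" unfolding eq using l_bounds w by (simp add: ln_mult)
  moreover have "w - l / (1 - l) / real n = w / real n"
    using n_ge by (simp add: w_def divide_simps) (simp add: algebra_simps)
  ultimately have ln_eq: "ln (1 - p) - (ln (1 - l) - l / (1 - l) / real n) = (ln (1 - w) + w) - w / real n" by simp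
  have "\<bar>ln (1 - w) + w\<bar> \<le> 2 * w\<^sup>2"
    using abs_ln_one_plus_x_minus_x_bound[of "- w"] w by simp
  then have "has_order 5 (-4) (ln (1 - w) + w)"
    by (rule has_order_dominated[rotated]) (rule has_order_mono, (rule w_order has_order_intros | simp)+)
  note this [THEN has_order_absorb, of 0 "-3"]
  then have ln_order: "has_order 0 (-3) (ln (1 - w) + w)" by simp
  have rest: "has_order 0 (-3) (w / real n)"
    by (rule has_order_absorb, (rule w_order has_order_intros | simp)+)
  show "has_order 3 (-3) (ln (1 - p) - (ln (1 - l) - l / (1 - l) / real n))"
    unfolding ln_eq by (rule has_order_mono, (rule ln_order rest has_order_intros | simp)+)
qed

lemma has_order_ln_density:
  defines "p \<equiv> l * real n / (real n - 1)"
  shows "p > 0" "has_order 3 (-3) (ln p - (ln l + 1 / real n))"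
proof -
  let ?w = "1 / real n"
  show "p > 0" using l_bounds n_ge by (simp add: p_def)
  have "p * (1 - ?w) = l" using n_ge by (simp add: p_def field_simps)
  then have "ln l = ln p + ln (1 - ?w)" using \<open>p > 0\<close> n_ge by (subst ln_mult_pos[symmetric]) auto
  then have eq: "ln p - (ln l + ?w) = - (ln (1 - ?w) + ?w)" by simp
  have "\<bar>ln (1 - ?w) + ?w\<bar> \<le> 2 * ?w\<^sup>2"
    using abs_ln_one_plus_x_minus_x_bound[of "- ?w"] n_ge by simp
  then have "has_order 1 (-4) (ln (1 - ?w) + ?w)"
    by (rule has_order_dominated[rotated]) (rule has_order_mono, (rule has_order_intros | simp)+)
  then show "has_order 3 (-3) (ln p - (ln l + 1 / real n))"
    unfolding eq by (rule has_order_minus[OF has_order_mono]) simp_all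
qed

lemma degrees_le:
  assumes "j < n" shows "s j \<le> n - 1" "t j \<le> n - 1"
proof -
  have "has_order 3 1 (\<theta> * r + 1)"
    by (rule has_order_mono, (rule has_order_intros | simp)+)
  then have "\<bar>\<theta> * r + 1\<bar> < (1 - l) * real n" by (rule has_order_less_complement_n) simp
  then have "\<theta> * r + l * real n \<le> real n - 1" by (simp add: algebra_simps)
  then have "real (s j) \<le> real n - 1" "real (t j) \<le> real n - 1" using s_dev[OF assms] t_dev[OF assms] by linarith+
  then show "s j \<le> n - 1" "t j \<le> n - 1" by linarith+
qed

end

locale scaled_degrees = scale \<theta> "sqrt (real n)" for \<theta> :: real and n :: nat +
  fixes s t :: "nat \<Rightarrow> nat" and H :: "(nat \<times> nat) set"
  assumes lam: "1 / \<theta> \<le> lam n s" "lam n s \<le> 1 - 1 / \<theta>"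
    and dev: "j < n \<Longrightarrow> \<bar>real (s j) - sbar n s\<bar> + 1 \<le> \<theta> * sqrt (real n)"
      "j < n \<Longrightarrow> \<bar>real (t j) - sbar n s\<bar> + 1 \<le> \<theta> * sqrt (real n)"
    and deg: "j < n \<Longrightarrow> real (outdeg H j) + 1 \<le> \<theta> * sqrt (real n)"
      "j < n \<Longrightarrow> real (indeg H j) + 1 \<le> \<theta> * sqrt (real n)"
    and H: "H \<subseteq> arcs n" and Xarcs_le: "real n + Xarcs n H \<le> \<theta> * real n"
    and sums: "(\<Sum>j<n. s j) = (\<Sum>j<n. t j)"
begin

lemma sbar_eq: "sbar n s = lam n s * real n"
  using r_pos by (simp add: lam_def)

lemma sum_s: "(\<Sum>j<n. real (s j)) = lam n s * (real n)\<^sup>2"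
  using r_pos by (simp add: lam_def sbar_def power2_eq_square)

sublocale near_regular \<theta> "sqrt (real n)" n s t "lam n s"
proof unfold_locales
  show "\<bar>(\<Sum>j<n. real (s j)) - lam n s * (real n)\<^sup>2\<bar> \<le> \<theta> * real n"
    using theta_pos by (simp add: sum_s)
  show "\<bar>real (s j) - lam n s * real n\<bar> \<le> \<theta> * sqrt (real n)" "\<bar>real (t j) - lam n s * real n\<bar> \<le> \<theta> * sqrt (real n)"
    if "j < n" for j
    using dev[OF that] by (simp_all add: sbar_eq)
qed (use lam sums in simp_all)

abbreviation p where "p \<equiv> sbar n s / (real n - 1)"

interpretation avoiding: arc_exposure \<theta> "sqrt (real n)" n s t "lam n s" "lam n s" "1 - p"
  using l_bounds has_order_ln_one_minus_density(2) by unfold_locales (simp_all add: sum_s sbar_eq)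

lemma thin_H: "thin H"
  using H deg Xarcs_le by (simp add: thin_def outdeg_eq indeg_eq Xarcs_eq)

lemma prob_avoid_estimate:
  "\<exists>d. \<bar>d\<bar> \<le> Xarcs n H * (\<theta> ^ 80 * sqrt (real n) powi (-3)) \<and>
    prob_D n s t (\<lambda>G. G \<inter> H = {}) = (1 - p) powr Xarcs n H * exp (Mexp n s t H + d)"
proof -
  have "avoiding.row_dev H = dlt n s H" "avoiding.col_dev H = eta n s t H"
    by (auto simp: avoiding.row_dev_def avoiding.col_dev_def dlt_def eta_def outdeg_eq indeg_eq sbar_eq)
  then have "avoiding.pot H = Mexp n s t H" using potential_eq_Mexp[OF H, of s t] by simp
  moreover have "1 - p > 0" using has_order_ln_one_minus_density(1) by (simp add: sbar_eq)
  ultimately show ?thesis using avoiding.prob_avoid[OF thin_H] by (simp add: Xarcs_eq[OF H])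
qed

lemma real_complement_degrees:
  assumes "j < n"
  shows "real (n - 1 - s j) = real n - 1 - real (s j)" "real (n - 1 - t j) = real n - 1 - real (t j)"
  using degrees_le[OF assms] assms by (simp_all add: of_nat_diff)

lemma sum_complement_degrees:
  "(\<Sum>j<n. real (n - 1 - s j)) = (1 - lam n s) * (real n)\<^sup>2 - real n"
  "(\<Sum>j<n. real (n - 1 - t j)) = (1 - lam n s) * (real n)\<^sup>2 - real n"
proof -
  have "(\<Sum>j<n. real (n - 1 - s j)) = (\<Sum>j<n. real n - 1 - real (s j))"
    "(\<Sum>j<n. real (n - 1 - t j)) = (\<Sum>j<n. real n - 1 - real (t j))"
    by (intro sum.cong refl; simp only: lessThan_iff real_complement_degrees)+
  moreover have "(\<Sum>j<n. real (t j)) = lam n s * (real n)\<^sup>2"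
    unfolding sum_s[symmetric] using sums by (simp flip: of_nat_sum)
  moreover have "real n * (real n - 1) - l * (real n)\<^sup>2 = (1 - l) * (real n)\<^sup>2 - real n" for l
    by (simp add: power2_eq_square algebra_simps)
  ultimately show "(\<Sum>j<n. real (n - 1 - s j)) = (1 - lam n s) * (real n)\<^sup>2 - real n"
    "(\<Sum>j<n. real (n - 1 - t j)) = (1 - lam n s) * (real n)\<^sup>2 - real n"
    by (simp_all add: sum_subtractf sum_s)
qed

lemma near_regular_complement:
  "near_regular \<theta> (sqrt (real n)) n (\<lambda>j. n - 1 - s j) (\<lambda>j. n - 1 - t j) (1 - lam n s)"
proof unfold_locales
  show "\<bar>real (n - 1 - s j) - (1 - lam n s) * real n\<bar> \<le> \<theta> * sqrt (real n)"
    "\<bar>real (n - 1 - t j) - (1 - lam n s) * real n\<bar> \<le> \<theta> * sqrt (real n)" if "j < n" for j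
    using dev[OF that] unfolding real_complement_degrees[OF that] sbar_eq by (simp_all add: algebra_simps)
  show "\<bar>(\<Sum>j<n. real (n - 1 - s j)) - (1 - lam n s) * (real n)\<^sup>2\<bar> \<le> \<theta> * real n"
    unfolding sum_complement_degrees using theta_pos mult_right_mono[of 1 \<theta> "real n"] by simp
  have "(\<Sum>j<n. real (n - 1 - s j)) = (\<Sum>j<n. real (n - 1 - t j))" unfolding sum_complement_degrees ..
  then show "(\<Sum>j<n. n - 1 - s j) = (\<Sum>j<n. n - 1 - t j)" by (simp flip: of_nat_sum)
qed (use lam in simp_all)

lemma prob_contain_estimate:
  "\<exists>d. \<bar>d\<bar> \<le> Xarcs n H * (\<theta> ^ 80 * sqrt (real n) powi (-3)) \<and>
    prob_D n s t (\<lambda>G. H \<subseteq> G) = p powr Xarcs n H * exp (Texp n s t H + d)"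
proof -
  have p: "p > 0" "has_order 3 (-3) (ln p - (ln (lam n s) + 1 / real n))"
    using has_order_ln_density by (simp_all add: sbar_eq)
  interpret containing: arc_exposure \<theta> "sqrt (real n)" n "\<lambda>j. n - 1 - s j" "\<lambda>j. n - 1 - t j" "1 - lam n s"
    "- lam n s" p
    using near_regular_complement
  proof (rule arc_exposure.intro, unfold_locales)
    show "\<bar>- lam n s\<bar> \<le> 1" using l_bounds by simp
    show "(\<Sum>j<n. real (n - 1 - s j)) = (1 - lam n s) * (real n)\<^sup>2 + (- lam n s - (1 - lam n s)) * real n"
      unfolding sum_complement_degrees by (simp add: algebra_simps)
    show "has_order 3 (-3) (ln p - (ln (1 - (1 - lam n s)) - - lam n s / (1 - (1 - lam n s)) / real n))"
      using p(2) l_bounds by simp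
  qed
  have "containing.row_dev H j = row_card H j - dlt n s H j" "containing.col_dev H j = col_card H j - eta n s t H j"
    if "j < n" for j
    unfolding containing.row_dev_def containing.col_dev_def dlt_def eta_def real_complement_degrees[OF that]
      outdeg_eq indeg_eq sbar_eq by (simp_all add: algebra_simps)
  then have "containing.pot H
    = potential (1 - lam n s) n (\<lambda>j. row_card H j - dlt n s H j) (\<lambda>k. col_card H k - eta n s t H k) H"
    by (rule potential_cong[OF H])
  also have "\<dots> = Texp n s t H" by (rule potential_eq_Texp[OF H])
  finally have pot: "containing.pot H = Texp n s t H" .
    show ?thesis
    using containing.prob_avoid[OF thin_H p(1)]
    by (simp only: prob_contain_eq_prob_avoid[OF degrees_le H] Xarcs_eq[OF H] pot)
qed

end

subsection \<open>The asymptotic regime\<close>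

lemma density_bounds:
  fixes l L \<theta> :: real
  assumes "l * (1 - l) / 2 > 0" and "(1 - 2 * l)\<^sup>2 / (3 * (l * (1 - l) / 2)) \<le> L" and \<theta>: "3 * L + 8 \<le> \<theta>"
  shows "1 / \<theta> \<le> l" "l \<le> 1 - 1 / \<theta>"
proof -
  have pos: "l * (1 - l) > 0" using assms(1) by simp
  then have l: "0 < l" "l < 1" by (auto simp: zero_less_mult_iff)
  have "(1 - 2 * l)\<^sup>2 = 1 - 4 * (l * (1 - l))" by (simp add: power2_eq_square algebra_simps)
  then have "2 \<le> (3 * L + 8) * (l * (1 - l))"
    using assms(2) pos by (simp add: divide_le_eq algebra_simps)
  also have "\<dots> \<le> \<theta> * (l * (1 - l))" using \<theta> pos by (intro mult_right_mono) auto
  finally have bound: "2 \<le> \<theta> * (l * (1 - l))" .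
  then have "\<theta> > 0" using pos by (metis less_le_trans zero_less_mult_pos2 zero_less_numeral)
  moreover from this l have "\<theta> * (l * (1 - l)) \<le> \<theta> * l" "\<theta> * (l * (1 - l)) \<le> \<theta> * (1 - l)"
    by (auto simp: mult_left_le mult_left_le_one_le)
  then have "1 \<le> \<theta> * l" "1 \<le> \<theta> * (1 - l)" using bound by linarith+
  ultimately show "1 / \<theta> \<le> l" "l \<le> 1 - 1 / \<theta>" by (simp_all add: field_simps)
qed

locale asymptotic_regime =
  fixes a b \<epsilon> K :: real and n :: nat and s t :: "nat \<Rightarrow> nat" and H :: "(nat \<times> nat) set"
  assumes a: "a > 0" and K: "K > 0" and eps: "\<epsilon> > 0" "\<epsilon> \<le> 1/1600" "324 * \<epsilon> \<le> 1/2 - b"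
    and n_large: "(100 + 2 * K + 3 * a / \<epsilon>) powr (1 / \<epsilon>) \<le> real n"
    and dev: "j < n \<Longrightarrow> \<bar>real (s j) - sbar n s\<bar> \<le> K * real n powr (1/2 + \<epsilon>)"
      "j < n \<Longrightarrow> \<bar>real (t j) - sbar n s\<bar> \<le> K * real n powr (1/2 + \<epsilon>)"
    and deg: "j < n \<Longrightarrow> real (outdeg H j) \<le> K * real n powr (1/2 + \<epsilon>)"
      "j < n \<Longrightarrow> real (indeg H j) \<le> K * real n powr (1/2 + \<epsilon>)"
    and H: "H \<subseteq> arcs n" and Xarcs_le: "Xarcs n H \<le> K * real n powr (1 + 2 * \<epsilon>)"
    and sums: "(\<Sum>j<n. s j) = (\<Sum>j<n. t j)"
    and density: "Acst n s > 0" "(1 - 2 * lam n s)\<^sup>2 / (3 * Acst n s) \<le> a * ln (real n)"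
begin

abbreviation u where "u \<equiv> real n powr \<epsilon>"
abbreviation theta ("\<theta>") where "\<theta> \<equiv> real n powr (4 * \<epsilon>)"

lemma constant_pos: "100 + 2 * K + 3 * a / \<epsilon> > 0"
  using a K eps(1) by (simp add: add_pos_pos)

lemma n_ge_1: "real n \<ge> 1"
proof -
  have "(100 + 2 * K + 3 * a / \<epsilon>) powr (1 / \<epsilon>) > 0" using constant_pos by simp
  then have "real n > 0" using n_large by linarith
  then show ?thesis by simp
qed

lemma u_ge: "u \<ge> 100" "u \<ge> K" "u \<ge> 3 * a / \<epsilon>"
proof -
  have "((100 + 2 * K + 3 * a / \<epsilon>) powr (1 / \<epsilon>)) powr \<epsilon> \<le> u"
    using n_large eps(1) by (intro powr_mono2) auto
  then have "100 + 2 * K + 3 * a / \<epsilon> \<le> u" using constant_pos eps(1) by (simp add: powr_powr)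
  moreover have "3 * a / \<epsilon> > 0" using a eps(1) by simp
  ultimately show "u \<ge> 100" "u \<ge> K" "u \<ge> 3 * a / \<epsilon>" using K by linarith+
qed

lemma theta_power: "\<theta> ^ k = real n powr (4 * real k * \<epsilon>)" "\<theta> = u ^ 4"
  using n_ge_1 by (simp_all add: powr_power mult_ac)

lemma u_powers: "100 * u \<le> u ^ 2" "100 * u ^ 2 \<le> u ^ 3" "100 * u ^ 3 \<le> \<theta>"
proof -
  have step: "100 * u ^ k \<le> u ^ (k + 1)" for k
    using u_ge(1) by (simp add: mult_right_mono del: powr_power)
  show "100 * u \<le> u ^ 2" "100 * u ^ 2 \<le> u ^ 3" "100 * u ^ 3 \<le> \<theta>"
    using step[of 1] step[of 2] step[of 3] unfolding theta_power(2) by (simp_all add: power2_eq_square)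
qed

lemma sqrt_bound: "K * real n powr (1/2 + \<epsilon>) + 1 \<le> \<theta> * sqrt (real n)"
proof -
  have "K * real n powr (1/2 + \<epsilon>) = K * u * sqrt (real n)"
    using n_ge_1 by (simp add: powr_add powr_half_sqrt)
  also have "\<dots> + 1 \<le> u\<^sup>2 * sqrt (real n) + u\<^sup>2 * sqrt (real n)"
  proof (intro add_mono)
    show "K * u * sqrt (real n) \<le> u\<^sup>2 * sqrt (real n)"
      unfolding power2_eq_square using u_ge(2) by (intro mult_right_mono) auto
    show "1 \<le> u\<^sup>2 * sqrt (real n)"
      using u_ge(1) u_powers(1) n_ge_1 mult_mono[of 1 "u\<^sup>2" 1 "sqrt (real n)"] by simp
  qed
  also have "\<dots> = (2 * u\<^sup>2) * sqrt (real n)" by simp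
  also have "\<dots> \<le> \<theta> * sqrt (real n)" using u_ge(1) u_powers by (intro mult_right_mono) auto
  finally show ?thesis .
qed

lemma linear_bound: "real n + K * real n powr (1 + 2 * \<epsilon>) \<le> \<theta> * real n"
proof -
  have "real n powr (1 + 2 * \<epsilon>) = u\<^sup>2 * real n"
    using n_ge_1 by (simp add: powr_add powr_power mult_ac)
  then have "real n + K * real n powr (1 + 2 * \<epsilon>) = (1 + K * u\<^sup>2) * real n" by (simp add: algebra_simps)
  also have "\<dots> \<le> \<theta> * real n"
  proof (intro mult_right_mono)
    have "K * u\<^sup>2 \<le> u * u\<^sup>2" using u_ge(2) by (intro mult_right_mono) auto
    also have "\<dots> = u ^ 3" by (simp add: power2_eq_square power3_eq_cube)
    finally show "1 + K * u\<^sup>2 \<le> \<theta>" using u_ge(1) u_powers by linarith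
  qed simp
  finally show ?thesis .
qed

lemma ln_bound: "3 * (a * ln (real n)) + 8 \<le> \<theta>"
proof -
  have "ln (real n) \<le> u / \<epsilon>" using n_ge_1 eps(1) by (intro ln_powr_bound) auto
  then have "3 * a * ln (real n) \<le> 3 * a * (u / \<epsilon>)" using a by (intro mult_left_mono) auto
  also have "\<dots> = (3 * a / \<epsilon>) * u" by simp
  also have "\<dots> \<le> u * u" using u_ge by (intro mult_right_mono) auto
  finally have "3 * a * ln (real n) \<le> u\<^sup>2" by (simp add: power2_eq_square)
  then show ?thesis using u_ge(1) u_powers by linarith
qed

sublocale scaled_degrees \<theta> n s t H
proof unfold_locales
  show "\<theta> \<ge> 100" using u_ge(1) u_powers by linarith
  have "\<theta> ^ 200 = real n powr (800 * \<epsilon>)" unfolding theta_power(1)[of 200] by simp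
  also have "\<dots> \<le> real n powr (1/2)" using eps(2) n_ge_1 by (intro powr_mono) auto
  finally show "\<theta> ^ 200 \<le> sqrt (real n)" by (simp add: powr_half_sqrt)
  show "1 / \<theta> \<le> lam n s" "lam n s \<le> 1 - 1 / \<theta>"
    using density_bounds[OF density[unfolded Acst_def] ln_bound] .
  show "\<bar>real (s j) - sbar n s\<bar> + 1 \<le> \<theta> * sqrt (real n)" "\<bar>real (t j) - sbar n s\<bar> + 1 \<le> \<theta> * sqrt (real n)"
    "real (outdeg H j) + 1 \<le> \<theta> * sqrt (real n)" "real (indeg H j) + 1 \<le> \<theta> * sqrt (real n)" if "j < n" for j
    using dev[OF that] deg[OF that] sqrt_bound by linarith+
  show "real n + Xarcs n H \<le> \<theta> * real n" using Xarcs_le linear_bound by linarith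
qed (use H sums in auto)

lemma error_bound: "Xarcs n H * (\<theta> ^ 80 * sqrt (real n) powi (-3)) \<le> real n powr (- b)"
proof -
  have "sqrt (real n) powi (-3) = inverse (sqrt (real n) ^ 3)" by (simp add: power_int_minus)
  also have "\<dots> = real n powr (- 3/2)"
    using n_ge_1 by (simp add: powr_half_sqrt[symmetric] powr_power flip: powr_minus)
  finally have cube: "sqrt (real n) powi (-3) = real n powr (- 3/2)" .
  have "Xarcs n H \<le> \<theta> * real n" using Xarcs_le linear_bound by linarith
  then have "Xarcs n H * (\<theta> ^ 80 * sqrt (real n) powi (-3)) \<le> (\<theta> * real n) * (\<theta> ^ 80 * sqrt (real n) powi (-3))"
    by (intro mult_right_mono) auto
  also have "\<dots> = \<theta> ^ 81 * (real n powr 1 * real n powr (- 3/2))"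
    using n_ge_1 by (simp add: cube numeral_eq_Suc mult_ac)
  also have "\<dots> = real n powr (324 * \<epsilon> - 1/2)"
    unfolding theta_power(1)[of 81] powr_add[symmetric] by simp
  also have "\<dots> \<le> real n powr (- b)" using eps(3) n_ge_1 by (intro powr_mono) auto
  finally show ?thesis .
qed

lemma prob_avoid_asymptotics:
  "\<exists>d. \<bar>d\<bar> \<le> real n powr (- b) \<and> prob_D n s t (\<lambda>G. G \<inter> H = {}) = (1 - p) powr Xarcs n H * exp (Mexp n s t H + d)"
  using prob_avoid_estimate error_bound by (meson order_trans)

lemma prob_contain_asymptotics:
  "\<exists>d. \<bar>d\<bar> \<le> real n powr (- b) \<and> prob_D n s t (\<lambda>G. H \<subseteq> G) = p powr Xarcs n H * exp (Texp n s t H + d)"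
  using prob_contain_estimate error_bound by (meson order_trans)

end

theorem theorem3p2:
  fixes a b :: real
  assumes "a > 0" and "b > 0" and "a + b < 1/2"
  shows "\<exists>\<epsilon>0>0. \<forall>\<epsilon>::real. 0 < \<epsilon> \<and> \<epsilon> < \<epsilon>0 \<longrightarrow>
    (\<forall>K>0. \<exists>Cc::real. \<exists>N0::nat. \<forall>n (s::nat \<Rightarrow> nat) (t::nat \<Rightarrow> nat) (H::(nat \<times> nat) set).
      n \<ge> N0
      \<and> (\<forall>j<n. s j \<ge> 1 \<and> t j \<ge> 1)
      \<and> (\<Sum>j<n. s j) = (\<Sum>j<n. t j)
      \<and> H \<subseteq> arcs n
      \<and> (\<forall>j<n. \<bar>real (s j) - sbar n s\<bar> \<le> K * real n powr (1/2 + \<epsilon>)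
             \<and> \<bar>real (t j) - sbar n s\<bar> \<le> K * real n powr (1/2 + \<epsilon>)
             \<and> real (outdeg H j) \<le> K * real n powr (1/2 + \<epsilon>)
             \<and> real (indeg H j) \<le> K * real n powr (1/2 + \<epsilon>))
      \<and> Xarcs n H \<le> K * real n powr (1 + 2 * \<epsilon>)
      \<and> Acst n s > 0
      \<and> (1 - 2 * lam n s)^2 / (3 * Acst n s) \<le> a * ln (real n)
      \<longrightarrow>
      (let p = sbar n s / (real n - 1); X = Xarcs n H in
        (\<exists>d. \<bar>d\<bar> \<le> Cc * real n powr (-b) \<and>
           prob_D n s t (\<lambda>G. G \<inter> H = {}) = (1 - p) powr X * exp (Mexp n s t H + d))
      \<and> (\<exists>d. \<bar>d\<bar> \<le> Cc * real n powr (-b) \<and>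
           prob_D n s t (\<lambda>G. H \<subseteq> G) = p powr X * exp (Texp n s t H + d))))"
    (is "\<exists>\<epsilon>0>0. \<forall>\<epsilon>. _ \<longrightarrow> (\<forall>K>0. \<exists>Cc N0. \<forall>n s t H. ?regime \<epsilon> K N0 n s t H \<longrightarrow> ?estimates Cc n s t H)")
proof -
  define \<epsilon>0 where "\<epsilon>0 = min (1/1600) ((1/2 - b) / 324)"
  have "\<epsilon>0 > 0" using assms by (simp add: \<epsilon>0_def)
  moreover have "\<exists>Cc N0. \<forall>n s t H. ?regime \<epsilon> K N0 n s t H \<longrightarrow> ?estimates Cc n s t H"
    if eps: "0 < \<epsilon>" "\<epsilon> < \<epsilon>0" and K: "K > 0" for \<epsilon> K
  proof (rule exI[of _ 1], rule exI, intro allI impI)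
    fix n s t H assume regime: "?regime \<epsilon> K (nat \<lceil>(100 + 2 * K + 3 * a / \<epsilon>) powr (1 / \<epsilon>)\<rceil>) n s t H"
    have "\<epsilon> \<le> 1/1600" "324 * \<epsilon> \<le> 1/2 - b" using eps(2) by (simp_all add: \<epsilon>0_def)
    moreover have "(100 + 2 * K + 3 * a / \<epsilon>) powr (1 / \<epsilon>) \<le> real n" using regime by linarith
    ultimately interpret asymptotic_regime a b \<epsilon> K n s t H
      using assms(1) eps(1) K regime by unfold_locales auto
    show "?estimates 1 n s t H" using prob_avoid_asymptotics prob_contain_asymptotics by (simp add: Let_def)
  qed
  ultimately show ?thesis by blast
qed

end
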